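(* Let $(E,\mathcal E)$ be a measurable space such that $\mathcal E$ is countably generated and $\Delta:=\{(x,x):x\in E\}\in\mathcal E\otimes\mathcal E$. Let $P$ be a Markov kernel on $E$ which admits an invariant probability measure $\mu$ (not assumed to be unique). Consider the following conditions. (P$_2$) $P_n(x,\cdot)$ converges to $\mu$ in total variation as $n\to\infty$ for $\mu$-almost all $x\in E$, and $\lim_{n\to\infty}d(P_n(x,\cdot),\mu)<1$ for all $x\in E$. (A$_2$) For all $(x,y)\in E\times E$ there exists some $n=n_{x,y}\in\mathbb N$ such that $P_n(x,\cdot)$ and $P_n(y,\cdot)$ are non-singular. (B$_2$) $P$ is aperiodic and irreducible. (C$_2$) For all $x,y\in E$ there exist some $k\in\mathbb N_0$ and a coupling $\zeta\in C(P_k(x,\cdot),P_k(y,\cdot))$ such that $\zeta(\Delta)>0$. (C$_2'$) For all $x,y\in E$ there exists a coupling $(X_k)_{k\in\mathbb N_0}$, $(Y_k)_{k\in\mathbb N_0}$ of $\mathbb P_x$ and $\mathbb P_y$ on some probability space $(\Omega,\mathcal F,\mathbb P)$ such that $\liminf_{n\to\infty}\mathbb P(X_k=Y_k\text{ for all }k\ge n)>0$, and for $\mu\otimes\mu$-almost every $(x,y)\in E\times E$ there exists a coupling $(X_k)_{k\in\mathbb N_0}$, $(Y_k)_{k\in\mathbb N_0}$ of $\mathbb P_x$ and $\mathbb P_y$ on some probability space $(\Omega,\mathcal F,\mathbb P)$ such that $\lim_{n\to\infty}\mathbb P(X_k=Y_k\text{ for all }k\ge n)=1$. (G$_2$) For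 each pair $(x,y)\in E\times E$ there exist some $k\in\mathbb N$ and $\zeta\in\tilde C(P_k(x,\cdot),P_k(y,\cdot))$ such that $\zeta(\Delta)>0$. Then (A$_2$), (B$_2$), (C$_2$), (G$_2$) and (P$_2$) are equivalent, and they are implied by (C$_2'$). If $(E,\mathcal E)$ is a Borel space, then each of these equivalent conditions implies (C$_2'$).
   Context: $\mathbb N=\{1,2,\dots\}$, $\mathbb N_0=\mathbb N\cup\{0\}$. $P_n(\cdot,\cdot)$ is the $n$-step transition probability of $P$; $X=(X_n)_{n\in\mathbb N_0}$ is the Markov chain with kernel $P$, and $\mathbb P_x$ is its law on $(E^{\mathbb N_0},\mathcal E^{\otimes\mathbb N_0})$ when started at $x\in E$. The total variation metric is $d(\nu_1,\nu_2)=\sup_{A\in\mathcal E}|\nu_1(A)-\nu_2(A)|$ (the limit $\lim_n d(P_n(x,\cdot),\mu)$ always exists, since this sequence is non-increasing). Two measures $\nu_1,\nu_2$ on $(E,\mathcal E)$ are non-singular if there is no $A\in\mathcal E$ with $\nu_1(A)=0$ and $\nu_2(A^c)=0$. Aperiodicity (with respect to $\mu$): for an integer $d\ge2$, $P$ is $d$-periodic if there are disjoint sets $E_1,\dots,E_d\in\mathcal E$ with $\mu(E_1)>0$ such that $P(x,E_{i+1})=1$ for all $x\in E_i$, $1\le i\le d$, where $E_{d+1}:=E_1$. $P$ is aperiodic if it is not $d$-periodic for any $d\ge2$. Irreducibility: $P$ is irreducible if there exists a non-trivial $\sigma$-finite measure $\phi$ on $(E,\mathcal E)$ such that for all $A\in\mathcal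 E$ with $\phi(A)>0$ and all $x\in E$, $\mathbb P_x\big(\bigcup_{n=1}^\infty\{X_n\in A\}\big)>0$. Couplings: for probability measures $\nu_1,\nu_2$ on a measurable space $(\bar E,\bar{\mathcal E})$, $C(\nu_1,\nu_2)$ is the set of probability measures on $(\bar E\times\bar E,\bar{\mathcal E}\otimes\bar{\mathcal E})$ with first marginal $\nu_1$ and second marginal $\nu_2$; a pair of $\bar E$-valued random variables on a common probability space is a coupling of $\nu_1,\nu_2$ if its joint law is in $C(\nu_1,\nu_2)$. $\tilde C(\nu_1,\nu_2)$ is the set of probability measures $\xi$ on $\bar E\times\bar E$ whose marginals $\xi^1,\xi^2$ satisfy $\xi^1\ll\nu_1$ and $\xi^2\ll\nu_2$. Borel space: a measurable space isomorphic (as a measurable space) to a Borel subset of $[0,1]$. *)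

theory Defs
  imports "HOL-Probability.Probability"
begin

section \<open>Measurable spaces\<close>

text \<open>A measurable space is represented by an arbitrary measure \<open>M\<close> on it; only
  \<open>space M\<close> and \<open>sets M\<close> are used.\<close>

definition countably_generated :: "'a measure \<Rightarrow> bool" where
  "countably_generated M \<longleftrightarrow>
     (\<exists>G. countable G \<and> G \<subseteq> Pow (space M) \<and> sets M = sigma_sets (space M) G)"

definition diagonal :: "'a measure \<Rightarrow> ('a \<times> 'a) set" where
  "diagonal M = {(x, x) | x. x \<in> space M}"

definition borel_space :: "'a measure \<Rightarrow> bool" where
  "borel_space M \<longleftrightarrow>
     (\<exists>B f. B \<in> sets (borel :: real measure) \<and> B \<subseteq> {0..1} \<and>
        bij_betw f (space M) B \<and>
        f \<in> M \<rightarrow>\<^sub>M restrict_space borel B \<and>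
        inv_into (space M) f \<in> restrict_space borel B \<rightarrow>\<^sub>M M)"


section \<open>Relations between measures\<close>

definition tv_dist :: "'a measure \<Rightarrow> 'a measure \<Rightarrow> 'a measure \<Rightarrow> real" where
  "tv_dist M \<nu>\<^sub>1 \<nu>\<^sub>2 = (SUP A\<in>sets M. \<bar>measure \<nu>\<^sub>1 A - measure \<nu>\<^sub>2 A\<bar>)"

definition non_singular :: "'a measure \<Rightarrow> 'a measure \<Rightarrow> 'a measure \<Rightarrow> bool" where
  "non_singular M \<nu>\<^sub>1 \<nu>\<^sub>2 \<longleftrightarrow>
     \<not> (\<exists>A\<in>sets M. emeasure \<nu>\<^sub>1 A = 0 \<and> emeasure \<nu>\<^sub>2 (space M - A) = 0)"

definition couplings :: "'b measure \<Rightarrow> 'b measure \<Rightarrow> 'b measure \<Rightarrow> ('b \<times> 'b) measure set" where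
  "couplings N \<nu>\<^sub>1 \<nu>\<^sub>2 =
     {\<zeta>. prob_space \<zeta> \<and> sets \<zeta> = sets (N \<Otimes>\<^sub>M N) \<and> distr \<zeta> N fst = \<nu>\<^sub>1 \<and> distr \<zeta> N snd = \<nu>\<^sub>2}"

definition ac_couplings :: "'b measure \<Rightarrow> 'b measure \<Rightarrow> 'b measure \<Rightarrow> ('b \<times> 'b) measure set" where
  "ac_couplings N \<nu>\<^sub>1 \<nu>\<^sub>2 =
     {\<xi>. prob_space \<xi> \<and> sets \<xi> = sets (N \<Otimes>\<^sub>M N) \<and>
        absolutely_continuous \<nu>\<^sub>1 (distr \<xi> N fst) \<and> absolutely_continuous \<nu>\<^sub>2 (distr \<xi> N snd)}"

definition is_coupling ::
    "'w measure \<Rightarrow> 'b measure \<Rightarrow> ('w \<Rightarrow> 'b) \<Rightarrow> ('w \<Rightarrow> 'b) \<Rightarrow> 'b measure \<Rightarrow> 'b measure \<Rightarrow> bool" where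
  "is_coupling \<Omega> N X Y \<nu>\<^sub>1 \<nu>\<^sub>2 \<longleftrightarrow>
     prob_space \<Omega> \<and> X \<in> \<Omega> \<rightarrow>\<^sub>M N \<and> Y \<in> \<Omega> \<rightarrow>\<^sub>M N \<and>
     distr \<Omega> (N \<Otimes>\<^sub>M N) (\<lambda>\<omega>. (X \<omega>, Y \<omega>)) \<in> couplings N \<nu>\<^sub>1 \<nu>\<^sub>2"


section \<open>Markov chains\<close>

text \<open>A Markov kernel on \<open>M\<close> is a function \<open>K \<in> M \<rightarrow>\<^sub>M prob_algebra M\<close>.\<close>

primrec n_step :: "'a measure \<Rightarrow> ('a \<Rightarrow> 'a measure) \<Rightarrow> nat \<Rightarrow> 'a \<Rightarrow> 'a measure" where
  "n_step M K 0 x = return M x"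
| "n_step M K (Suc n) x = n_step M K n x \<bind> K"

text \<open>Conditional law of the state at time \<open>n\<close> given the states at times \<open>0, \<dots>, n - 1\<close>, for the
  chain started at \<open>x\<close>; this is the input to the Ionescu-Tulcea construction.\<close>

definition chain_step ::
    "'a measure \<Rightarrow> ('a \<Rightarrow> 'a measure) \<Rightarrow> 'a \<Rightarrow> nat \<Rightarrow> (nat \<Rightarrow> 'a) \<Rightarrow> 'a measure" where
  "chain_step M K x n \<omega> = (case n of 0 \<Rightarrow> return M x | Suc m \<Rightarrow> K (\<omega> m))"

abbreviation path_space :: "'a measure \<Rightarrow> (nat \<Rightarrow> 'a) measure" where
  "path_space M \<equiv> Pi\<^sub>M UNIV (\<lambda>_. M)"

definition chain_law :: "'a measure \<Rightarrow> ('a \<Rightarrow> 'a measure) \<Rightarrow> 'a \<Rightarrow> (nat \<Rightarrow> 'a) measure" where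
  "chain_law M K x =
     projective_family.lim UNIV (Ionescu_Tulcea.CI (chain_step M K x) (\<lambda>_. M)) (\<lambda>_. M)"

lemma Ionescu_Tulcea_chain_step:
  fixes M :: "'a measure"
  assumes K: "K \<in> M \<rightarrow>\<^sub>M prob_algebra M" and x: "x \<in> space M"
  shows "Ionescu_Tulcea (chain_step M K x) (\<lambda>_. M)"
proof (rule Ionescu_Tulcea.intro)
  show "chain_step M K x i \<in> Pi\<^sub>M {0..<i} (\<lambda>_. M) \<rightarrow>\<^sub>M subprob_algebra M" for i :: nat
  proof (cases i)
    case 0
    have "return M x \<in> space (subprob_algebra M)"
      using x by (simp add: space_subprob_algebra prob_space_return prob_space_imp_subprob_space)
    then show ?thesis
      by (simp add: 0 chain_step_def[abs_def])
  next
    case (Suc m)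
    have "(\<lambda>\<omega>. \<omega> m) \<in> Pi\<^sub>M {0..<i} (\<lambda>_. M) \<rightarrow>\<^sub>M M"
      by (rule measurable_component_singleton) (simp add: Suc)
    from measurable_compose[OF this measurable_prob_algebraD[OF K]] show ?thesis
      by (simp add: Suc chain_step_def[abs_def])
  qed
next
  fix i :: nat and \<omega> :: "nat \<Rightarrow> 'a" assume "\<omega> \<in> space (Pi\<^sub>M {0..<i} (\<lambda>_. M))"
  then show "prob_space (chain_step M K x i \<omega>)"
    using x measurable_space[OF K]
    by (auto simp: chain_step_def space_prob_algebra space_PiM PiE_iff prob_space_return
        split: nat.split)
qed

definition invariant_prob :: "'a measure \<Rightarrow> ('a \<Rightarrow> 'a measure) \<Rightarrow> 'a measure \<Rightarrow> bool" where
  "invariant_prob M K \<mu> \<longleftrightarrow> prob_space \<mu> \<and> sets \<mu> = sets M \<and> \<mu> \<bind> K = \<mu>"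

text \<open>The classes are \<open>Es 1, \<dots>, Es d\<close>; the index \<open>i mod d + 1\<close> is the cyclic successor of \<open>i\<close>.\<close>

definition periodic ::
    "'a measure \<Rightarrow> ('a \<Rightarrow> 'a measure) \<Rightarrow> 'a measure \<Rightarrow> nat \<Rightarrow> bool" where
  "periodic M K \<mu> d \<longleftrightarrow>
     (\<exists>Es. (\<forall>i\<in>{1..d}. Es i \<in> sets M) \<and> disjoint_family_on Es {1..d} \<and>
        emeasure \<mu> (Es 1) > 0 \<and>
        (\<forall>i\<in>{1..d}. \<forall>x\<in>Es i. emeasure (K x) (Es (i mod d + 1)) = 1))"

definition aperiodic :: "'a measure \<Rightarrow> ('a \<Rightarrow> 'a measure) \<Rightarrow> 'a measure \<Rightarrow> bool" where
  "aperiodic M K \<mu> \<longleftrightarrow> (\<forall>d\<ge>2. \<not> periodic M K \<mu> d)"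

definition irreducible_kernel :: "'a measure \<Rightarrow> ('a \<Rightarrow> 'a measure) \<Rightarrow> bool" where
  "irreducible_kernel M K \<longleftrightarrow>
     (\<exists>\<phi>. sigma_finite_measure \<phi> \<and> sets \<phi> = sets M \<and> emeasure \<phi> (space M) > 0 \<and>
        (\<forall>A\<in>sets M. emeasure \<phi> A > 0 \<longrightarrow>
          (\<forall>x\<in>space M.
             emeasure (chain_law M K x) {\<omega> \<in> space (path_space M). \<exists>n\<ge>1. \<omega> n \<in> A} > 0)))"


section \<open>The conditions\<close>

definition cond_P2 :: "'a measure \<Rightarrow> ('a \<Rightarrow> 'a measure) \<Rightarrow> 'a measure \<Rightarrow> bool" where
  "cond_P2 M K \<mu> \<longleftrightarrow>
     (AE x in \<mu>. (\<lambda>n. tv_dist M (n_step M K n x) \<mu>) \<longlonglongrightarrow> 0) \<and>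
     (\<forall>x\<in>space M. \<exists>l<1. (\<lambda>n. tv_dist M (n_step M K n x) \<mu>) \<longlonglongrightarrow> l)"

definition cond_A2 :: "'a measure \<Rightarrow> ('a \<Rightarrow> 'a measure) \<Rightarrow> bool" where
  "cond_A2 M K \<longleftrightarrow>
     (\<forall>x\<in>space M. \<forall>y\<in>space M. \<exists>n\<ge>1. non_singular M (n_step M K n x) (n_step M K n y))"

definition cond_B2 :: "'a measure \<Rightarrow> ('a \<Rightarrow> 'a measure) \<Rightarrow> 'a measure \<Rightarrow> bool" where
  "cond_B2 M K \<mu> \<longleftrightarrow> aperiodic M K \<mu> \<and> irreducible_kernel M K"

definition cond_C2 :: "'a measure \<Rightarrow> ('a \<Rightarrow> 'a measure) \<Rightarrow> bool" where
  "cond_C2 M K \<longleftrightarrow>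
     (\<forall>x\<in>space M. \<forall>y\<in>space M. \<exists>k. \<exists>\<zeta>\<in>couplings M (n_step M K k x) (n_step M K k y).
        emeasure \<zeta> (diagonal M) > 0)"

definition cond_G2 :: "'a measure \<Rightarrow> ('a \<Rightarrow> 'a measure) \<Rightarrow> bool" where
  "cond_G2 M K \<longleftrightarrow>
     (\<forall>x\<in>space M. \<forall>y\<in>space M. \<exists>k\<ge>1. \<exists>\<zeta>\<in>ac_couplings M (n_step M K k x) (n_step M K k y).
        emeasure \<zeta> (diagonal M) > 0)"

text \<open>HOL cannot quantify over types inside a formula, so the type \<open>'w\<close> of the sample spaces is
  a parameter of the last condition. As a hypothesis the condition is meant for arbitrary
  \<open>'w\<close>; as a conclusion it is meant for a concrete \<open>'w\<close>.\<close>

definition agree_from :: "'w measure \<Rightarrow> ('w \<Rightarrow> nat \<Rightarrow> 'a) \<Rightarrow> ('w \<Rightarrow> nat \<Rightarrow> 'a) \<Rightarrow> nat \<Rightarrow> 'w set" where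
  "agree_from \<Omega> X Y n = {\<omega> \<in> space \<Omega>. \<forall>k\<ge>n. X \<omega> k = Y \<omega> k}"

definition cond_C2' ::
    "'w itself \<Rightarrow> 'a measure \<Rightarrow> ('a \<Rightarrow> 'a measure) \<Rightarrow> 'a measure \<Rightarrow> bool" where
  "cond_C2' _ M K \<mu> \<longleftrightarrow>
     (\<forall>x\<in>space M. \<forall>y\<in>space M. \<exists>(\<Omega> :: 'w measure) X Y.
        is_coupling \<Omega> (path_space M) X Y (chain_law M K x) (chain_law M K y) \<and>
        liminf (\<lambda>n. emeasure \<Omega> (agree_from \<Omega> X Y n)) > 0) \<and>
     (AE (x, y) in \<mu> \<Otimes>\<^sub>M \<mu>. \<exists>(\<Omega> :: 'w measure) X Y.
        is_coupling \<Omega> (path_space M) X Y (chain_law M K x) (chain_law M K y) \<and>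
        (\<lambda>n. emeasure \<Omega> (agree_from \<Omega> X Y n)) \<longlonglongrightarrow> 1)"

end

theory Submission
  imports Defs
begin

text \<open>
  Let \<open>h x y\<close> be the limit of the total variation distance of \<open>P_n x\<close> and \<open>P_n y\<close>. It is
  subharmonic for two independent copies of the chain, whose invariant law is \<open>\<mu> \<otimes> \<mu>\<close>; since the
  second moment of \<open>h\<close> is preserved, \<open>h\<close> is almost surely constant along the product chain. If this
  constant is \<open>c\<close>, cancelling the common part of \<open>P_n x\<close> and \<open>P_n y\<close> gives
  \<open>c \<le> c * tv (P_n x) (P_n y)\<close>, and \<open>n \<longrightarrow> \<infinity>\<close> gives \<open>c \<le> c * c\<close>, that is, \<open>c\<close> is \<open>0\<close> or \<open>1\<close>. Under
  (A2) the value \<open>1\<close> is impossible, so \<open>h = 0\<close> almost everywhere, and integrating over \<open>\<mu>\<close> yields (P2).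

  Under (B2), \<open>h = 1\<close> almost everywhere is impossible because arbitrarily many mutually singular
  laws would each overlap with \<open>\<mu>\<close> by a fixed amount. So some point \<open>x0\<close> merges with a set of
  positive measure, and the sets of points that merge with the chain from \<open>x0\<close> observed \<open>n\<close> steps
  later form a cycle; aperiodicity and irreducibility reduce the cycle to one set of full measure.

  The couplings of (C2') are Goldstein's maximal couplings. The only place where the Borel assumption
  enters is the gluing of two path laws along a common future: the initial states are regenerated
  one by one from the future and an independent uniform variable.
\<close>

section \<open>Probability measures and kernels\<close>

text \<open>Limits of distances are taken between arbitrary laws and not only between points,
  because cancelling the common part of \<open>P n x\<close> and \<open>P n y\<close> leaves laws
  that no longer belong to the chain. These remainders are absolutely continuous with respect to the
  laws they come from, so an almost sure statement about \<open>h\<close> survives the cancellation.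
  Countable generation enters through the measurability of \<open>h\<close>. The zero-one law
  concerns almost every pair, whereas the conditions concern all points. In passing from (P2) to
  single points, the bridge is that a law at distance less than one from \<mu> cannot be carried by
  a \<mu>-null set. A set of full measure for it therefore contains a point at which all almost sure
  statements hold. For (C2') it is not enough to couple the states optimally at each time
  separately: one coupling of whole paths must agree from time \<open>n\<close> on with probability
  at least \<open>1 - tv_dist M (P n x) (P n y)\<close>, for all \<open>n\<close> at once. Hence the
  mass matched at time \<open>n\<close> is taken out of the path laws for good, and later times only
  work on what remains.\<close>

lemma prob_algebraD:
  assumes "p \<in> space (prob_algebra M)"
  shows "prob_space p" "sets p = sets M" "space p = space M"
  using assms by (auto simp: space_prob_algebra dest: sets_eq_imp_space_eq)

lemma measure_prob_le_1: "p \<in> space (prob_algebra M) \<Longrightarrow> measure p A \<le> 1"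
  by (rule prob_space.prob_le_1) (rule prob_algebraD)

lemma measurable_prob_algebra_cong:
  assumes "p \<in> space (prob_algebra M)"
  shows "measurable p N = measurable M N"
  by (rule measurable_cong_sets) (simp_all add: prob_algebraD[OF assms])

lemma integrable_prob_bounded:
  fixes f :: "'a \<Rightarrow> real"
  assumes "p \<in> space (prob_algebra M)" "f \<in> borel_measurable M"
    and "\<And>x. x \<in> space M \<Longrightarrow> \<bar>f x\<bar> \<le> B"
  shows "integrable p f"
proof -
  interpret prob_space p by (rule prob_algebraD[OF assms(1)])
  show ?thesis
    using assms
    by (intro integrable_const_bound[where B=B])
       (auto simp: prob_algebraD[OF assms(1)] measurable_prob_algebra_cong[OF assms(1)])
qed

lemma bind_in_prob_algebra:
  assumes "p \<in> space (prob_algebra M)" "k \<in> M \<rightarrow>\<^sub>M prob_algebra N"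
  shows "p \<bind> k \<in> space (prob_algebra N)"
  using prob_space_bind'[OF assms] sets_bind'[OF assms] by (simp add: space_prob_algebra)

lemma return_in_prob_algebra: "x \<in> space M \<Longrightarrow> return M x \<in> space (prob_algebra M)"
  by (simp add: space_prob_algebra prob_space_return)

lemma measurable_measure_kernel:
  assumes "k \<in> M \<rightarrow>\<^sub>M prob_algebra N" "A \<in> sets N"
  shows "(\<lambda>x. measure (k x) A) \<in> borel_measurable M"
  using measurable_compose[OF assms(1) measurable_measure_prob_algebra[OF assms(2)]] .

lemma measure_bind_prob:
  assumes p: "p \<in> space (prob_algebra M)" and k: "k \<in> M \<rightarrow>\<^sub>M prob_algebra N" and A: "A \<in> sets N"
  shows "measure (p \<bind> k) A = (\<integral>x. measure (k x) A \<partial>p)"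
proof -
  interpret prob_space p by (rule prob_algebraD[OF p])
  interpret subprob_space p by (rule prob_space_imp_subprob_space) unfold_locales
  have "k \<in> p \<rightarrow>\<^sub>M subprob_algebra N"
    using measurable_prob_algebraD[OF k] by (simp add: measurable_prob_algebra_cong[OF p])
  from measure_bind[OF this A] show ?thesis .
qed

lemma integral_bind_prob:
  fixes f :: "'a \<Rightarrow> real"
  assumes p: "p \<in> space (prob_algebra M)" and k: "k \<in> M \<rightarrow>\<^sub>M prob_algebra N"
    and f: "f \<in> borel_measurable N" and B: "\<And>x. x \<in> space N \<Longrightarrow> \<bar>f x\<bar> \<le> B"
  shows "(\<integral>x. f x \<partial>(p \<bind> k)) = (\<integral>x. \<integral>y. f y \<partial>k x \<partial>p)"
proof (rule integral_bind[OF f B])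
  show "k \<in> p \<rightarrow>\<^sub>M subprob_algebra N"
    using measurable_prob_algebraD[OF k] by (simp add: measurable_prob_algebra_cong[OF p])
  show "finite_measure p"
    by (rule prob_space.finite_measure) (rule prob_algebraD[OF p])
  show "AE x in p. emeasure (k x) (space (k x)) \<le> ennreal 1"
  proof (rule AE_I2)
    fix x assume "x \<in> space p"
    then have "k x \<in> space (prob_algebra N)"
      using measurable_space[OF k] by (simp add: prob_algebraD[OF p])
    then show "emeasure (k x) (space (k x)) \<le> ennreal 1"
      using in_space_prob_algebra[of "k x" N] by (simp add: prob_algebraD)
  qed
qed simp

section \<open>Total variation\<close>

context
  fixes M :: "'a measure" and p q :: "'a measure"
  assumes p: "p \<in> space (prob_algebra M)" and q: "q \<in> space (prob_algebra M)"
begin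

interpretation p: prob_space p by (rule prob_algebraD[OF p])
interpretation q: prob_space q by (rule prob_algebraD[OF q])

lemma abs_measure_diff_le_1: "\<bar>measure p A - measure q A\<bar> \<le> 1"
  using p.prob_le_1[of A] q.prob_le_1[of A] measure_nonneg[of p A] measure_nonneg[of q A] by linarith

lemma tv_dist_upper: "A \<in> sets M \<Longrightarrow> \<bar>measure p A - measure q A\<bar> \<le> tv_dist M p q"
  unfolding tv_dist_def
  by (rule cSUP_upper) (auto intro!: bdd_aboveI[of _ 1] abs_measure_diff_le_1)

text \<open>Passing to the complement flips the sign of the difference of two probability measures,
  so one-sided bounds control the absolute value.\<close>

lemma tv_dist_least:
  assumes "\<And>A. A \<in> sets M \<Longrightarrow> measure p A - measure q A \<le> c"
  shows "tv_dist M p q \<le> c"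
  unfolding tv_dist_def
proof (rule cSUP_least)
  show "sets M \<noteq> {}" using sets.top by blast
  fix A assume A: "A \<in> sets M"
  have "measure p (space M - A) = 1 - measure p A" "measure q (space M - A) = 1 - measure q A"
    using p.prob_compl[of A] q.prob_compl[of A] A
    by (simp_all add: prob_algebraD[OF p] prob_algebraD[OF q])
  then show "\<bar>measure p A - measure q A\<bar> \<le> c"
    using assms[OF A] assms[of "space M - A"] A by auto
qed

lemma tv_dist_nonneg: "0 \<le> tv_dist M p q"
  using tv_dist_upper[of "{}"] by simp

lemma tv_dist_le_1: "tv_dist M p q \<le> 1"
  by (rule tv_dist_least) (use abs_measure_diff_le_1 in \<open>auto simp: abs_le_iff\<close>)

lemma tv_dist_commute: "tv_dist M p q = tv_dist M q p"
  unfolding tv_dist_def by (simp add: abs_minus_commute)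

end

lemma tv_dist_triangle:
  assumes p: "p \<in> space (prob_algebra M)" and q: "q \<in> space (prob_algebra M)"
    and r: "r \<in> space (prob_algebra M)"
  shows "tv_dist M p r \<le> tv_dist M p q + tv_dist M q r"
proof (rule tv_dist_least[OF p r])
  fix A assume A: "A \<in> sets M"
  show "measure p A - measure r A \<le> tv_dist M p q + tv_dist M q r"
    using tv_dist_upper[OF p q A] tv_dist_upper[OF q r A] by linarith
qed

text \<open>The supremum over sets of an average is at most the average of the suprema.
  Measurability of the integrand is a hypothesis at this point; \<open>measurable_tv_dist\<close>
  later derives it from countable generation.\<close>

lemma tv_dist_bind_const:
  assumes p: "p \<in> space (prob_algebra M)" and k: "k \<in> M \<rightarrow>\<^sub>M prob_algebra N"
    and r: "r \<in> space (prob_algebra N)"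
    and m: "(\<lambda>x. tv_dist N (k x) r) \<in> borel_measurable M"
  shows "tv_dist N (p \<bind> k) r \<le> (\<integral>x. tv_dist N (k x) r \<partial>p)"
proof (rule tv_dist_least[OF bind_in_prob_algebra[OF p k] r])
  interpret prob_space p by (rule prob_algebraD[OF p])
  note kx = measurable_space[OF k]
  fix A assume A: "A \<in> sets N"
  have 1: "integrable p (\<lambda>x. measure (k x) A)"
    by (rule integrable_prob_bounded[OF p measurable_measure_kernel[OF k A], where B=1])
       (use kx in \<open>auto intro: measure_prob_le_1\<close>)
  have 2: "integrable p (\<lambda>x. tv_dist N (k x) r)"
    by (rule integrable_prob_bounded[OF p m, where B=1])
       (use kx tv_dist_nonneg[OF _ r] tv_dist_le_1[OF _ r] in force)
  have "measure (p \<bind> k) A - measure r A = (\<integral>x. measure (k x) A - measure r A \<partial>p)"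
    using 1 by (simp add: measure_bind_prob[OF p k A] prob_space)
  also have "\<dots> \<le> (\<integral>x. tv_dist N (k x) r \<partial>p)"
    by (rule integral_mono)
       (use 1 2 kx tv_dist_upper[OF _ r A] in \<open>force simp: prob_algebraD[OF p] abs_le_iff\<close>)+
  finally show "measure (p \<bind> k) A - measure r A \<le> (\<integral>x. tv_dist N (k x) r \<partial>p)" .
qed

section \<open>Dominating measures\<close>

text \<open>Used with two nonzero terms in \<open>add_measure\<close>, and with one term per time
  when the glued pieces of a path coupling are put together.\<close>

definition sum_measure :: "'a measure \<Rightarrow> (nat \<Rightarrow> 'a measure) \<Rightarrow> 'a measure" where
  "sum_measure M F = measure_of (space M) (sets M) (\<lambda>A. \<Sum>n. emeasure (F n) A)"

lemma sets_sum_measure [simp, measurable_cong]: "sets (sum_measure M F) = sets M"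
  and space_sum_measure [simp]: "space (sum_measure M F) = space M"
  by (simp_all add: sum_measure_def)

lemma emeasure_sum_measure:
  assumes F: "\<And>n. sets (F n) = sets M" and A: "A \<in> sets M"
  shows "emeasure (sum_measure M F) A = (\<Sum>n. emeasure (F n) A)"
  unfolding sum_measure_def
proof (rule emeasure_measure_of_sigma)
  show "sigma_algebra (space M) (sets M)" by (rule sets.sigma_algebra_axioms)
  show "positive (sets M) (\<lambda>A. \<Sum>n. emeasure (F n) A)" by (simp add: positive_def)
  show "countably_additive (sets M) (\<lambda>A. \<Sum>n. emeasure (F n) A)"
  proof (rule countably_additiveI)
    fix B :: "nat \<Rightarrow> 'a set"
    assume B: "range B \<subseteq> sets M" "disjoint_family B"
    \<comment> \<open>Interchange of two infinite sums, read as Fubini for counting measure on the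
      naturals.\<close>
    have "(\<Sum>i. \<Sum>n. emeasure (F n) (B i)) = (\<Sum>n. \<Sum>i. emeasure (F n) (B i))"
      by (simp add: nn_integral_count_space_nat[symmetric] del: nn_integral_suminf)
         (intro pair_sigma_finite.Fubini' pair_sigma_finite.intro sigma_finite_measure_count_space; simp)
    also have "\<dots> = (\<Sum>n. emeasure (F n) (\<Union>i. B i))"
      using B F by (intro suminf_cong suminf_emeasure) auto
    finally show "(\<Sum>i. \<Sum>n. emeasure (F n) (B i)) = (\<Sum>n. emeasure (F n) (\<Union> (range B)))" .
  qed
qed fact

definition add_measure :: "'a measure \<Rightarrow> 'a measure \<Rightarrow> 'a measure" where
  "add_measure P Q = sum_measure P (\<lambda>n. if n = 0 then P else if n = 1 then Q else null_measure P)"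

lemma sets_add_measure [simp, measurable_cong]: "sets (add_measure P Q) = sets P"
  and space_add_measure [simp]: "space (add_measure P Q) = space P"
  by (simp_all add: add_measure_def)

lemma emeasure_add_measure:
  assumes "sets Q = sets P" "A \<in> sets P"
  shows "emeasure (add_measure P Q) A = emeasure P A + emeasure Q A"
proof -
  have "emeasure (add_measure P Q) A
      = (\<Sum>n. emeasure (if n = 0 then P else if n = 1 then Q else null_measure P) A)"
    unfolding add_measure_def using assms by (intro emeasure_sum_measure) auto
  also have "\<dots> = (\<Sum>n\<in>{0,1::nat}. emeasure (if n = 0 then P else if n = 1 then Q else null_measure P) A)"
    by (rule suminf_finite) auto
  finally show ?thesis by simp
qed

lemma dominating_density:
  assumes P: "finite_measure P" "sets P = sets M" and Q: "finite_measure Q" "sets Q = sets M"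
  obtains L :: "'a measure" and f g :: "'a \<Rightarrow> real"
  where "finite_measure L" "sets L = sets M"
    "f \<in> borel_measurable M" "g \<in> borel_measurable M" "\<And>x. 0 \<le> f x" "\<And>x. 0 \<le> g x"
    "P = density L (\<lambda>x. ennreal (f x))" "Q = density L (\<lambda>x. ennreal (g x))"
proof -
  interpret P: finite_measure P by fact
  interpret Q: finite_measure Q by fact
  define L where "L = add_measure P Q"
  have sets_L: "sets L = sets M" using P by (simp add: L_def)
  have space: "space P = space M" "space Q = space M" "space L = space M"
    using P(2) Q(2) sets_L by (auto dest: sets_eq_imp_space_eq)
  have L: "emeasure L A = emeasure P A + emeasure Q A" if "A \<in> sets M" for A
    using that P Q by (simp add: L_def emeasure_add_measure)
  have fin_L: "finite_measure L"
    by (rule finite_measureI) (simp add: space L)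
  then interpret L: finite_measure L .
  have acP: "absolutely_continuous L P" and acQ: "absolutely_continuous L Q"
    unfolding absolutely_continuous_def null_sets_def using P Q sets_L L by auto
  obtain f where f: "f \<in> borel_measurable L" "AE x in L. RN_deriv L P x = ennreal (f x)" "\<And>x. 0 \<le> f x"
    using L.real_RN_deriv[OF P(1) acP] P sets_L by metis
  obtain g where g: "g \<in> borel_measurable L" "AE x in L. RN_deriv L Q x = ennreal (g x)" "\<And>x. 0 \<le> g x"
    using L.real_RN_deriv[OF Q(1) acQ] Q sets_L by metis
  show thesis
  proof
    show "finite_measure L" by (rule fin_L)
    show "sets L = sets M" by fact
    show "f \<in> borel_measurable M" "g \<in> borel_measurable M"
      using f g by (simp_all cong: measurable_cong_sets[OF sets_L refl])
    show "0 \<le> f x" "0 \<le> g x" for x by fact+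
    have "P = density L (RN_deriv L P)"
      using L.density_RN_deriv[OF acP] P sets_L by simp
    also have "\<dots> = density L (\<lambda>x. ennreal (f x))"
      using f by (intro density_cong) auto
    finally show "P = density L (\<lambda>x. ennreal (f x))" .
    have "Q = density L (RN_deriv L Q)"
      using L.density_RN_deriv[OF acQ] Q sets_L by simp
    also have "\<dots> = density L (\<lambda>x. ennreal (g x))"
      using g by (intro density_cong) auto
    finally show "Q = density L (\<lambda>x. ennreal (g x))" .
  qed
qed

lemma measure_density_real:
  fixes f :: "'a \<Rightarrow> real"
  assumes L: "sets L = sets M" and f: "f \<in> borel_measurable M" "\<And>x. 0 \<le> f x"
    and fin: "finite_measure (density L (\<lambda>x. ennreal (f x)))"
  shows "integrable L f"
    and "A \<in> sets M \<Longrightarrow> measure (density L (\<lambda>x. ennreal (f x))) A = (\<integral>x. f x * indicator A x \<partial>L)"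
proof -
  interpret P: finite_measure "density L (\<lambda>x. ennreal (f x))" by fact
  have [measurable_cong]: "sets L = sets M" by fact
  note [measurable] = f(1)
  have "(\<integral>\<^sup>+x. f x \<partial>L) = emeasure (density L (\<lambda>x. ennreal (f x))) (space L)"
    by (simp add: emeasure_density cong: nn_integral_cong)
  then show "integrable L f"
    using f(2) P.emeasure_finite[of "space L"]
    by (intro integrableI_nonneg) (auto simp: less_top[symmetric])
  assume A: "A \<in> sets M"
  have "measure (density L (\<lambda>x. ennreal (f x))) A = (\<integral>x. indicator A x \<partial>density L (\<lambda>x. ennreal (f x)))"
    using A L by (simp add: sets.Int_space_eq2)
  also have "\<dots> = (\<integral>x. f x *\<^sub>R indicat_real A x \<partial>L)"
    using A by (intro integral_density) (simp_all add: f(2))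
  finally show "measure (density L (\<lambda>x. ennreal (f x))) A = (\<integral>x. f x * indicator A x \<partial>L)" by simp
qed

section \<open>Total variation through densities\<close>

lemma measure_diff_density:
  fixes f g :: "'a \<Rightarrow> real"
  assumes L: "sets L = sets M"
    and f: "f \<in> borel_measurable M" "\<And>x. 0 \<le> f x" "finite_measure (density L (\<lambda>x. ennreal (f x)))"
    and g: "g \<in> borel_measurable M" "\<And>x. 0 \<le> g x" "finite_measure (density L (\<lambda>x. ennreal (g x)))"
    and A: "A \<in> sets M"
  shows "integrable L (\<lambda>x. indicator A x * (f x - g x))"
    "measure (density L (\<lambda>x. ennreal (f x))) A - measure (density L (\<lambda>x. ennreal (g x))) A
      = (\<integral>x. indicator A x * (f x - g x) \<partial>L)"
proof -
  have I: "integrable L (\<lambda>x. f x * indicator A x)" "integrable L (\<lambda>x. g x * indicator A x)"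
    using integrable_real_mult_indicator[OF _ measure_density_real(1)[OF L f], of A]
      integrable_real_mult_indicator[OF _ measure_density_real(1)[OF L g], of A] A L
    by simp_all
  have eq: "f x * indicator A x - g x * indicator A x = indicator A x * (f x - g x)" for x
    by (simp split: split_indicator)
  show "integrable L (\<lambda>x. indicator A x * (f x - g x))"
    using Bochner_Integration.integrable_diff[OF I] by (simp add: eq)
  show "measure (density L (\<lambda>x. ennreal (f x))) A - measure (density L (\<lambda>x. ennreal (g x))) A
      = (\<integral>x. indicator A x * (f x - g x) \<partial>L)"
    unfolding measure_density_real(2)[OF L f A] measure_density_real(2)[OF L g A]
      Bochner_Integration.integral_diff[OF I, symmetric] eq ..
qed

text \<open>The set where the first density exceeds the second is the positive set of a Hahn
  decomposition of \<open>p - q\<close>. It realises the supremum, and the positive part of the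
  density difference integrates to the same value.\<close>

lemma tv_dist_density:
  assumes p: "p \<in> space (prob_algebra M)" and q: "q \<in> space (prob_algebra M)"
    and L: "sets L = sets M"
    and f: "f \<in> borel_measurable M" "\<And>x. 0 \<le> f x" "p = density L (\<lambda>x. ennreal (f x))"
    and g: "g \<in> borel_measurable M" "\<And>x. 0 \<le> g x" "q = density L (\<lambda>x. ennreal (g x))"
  shows "integrable L f" "integrable L g"
    "(\<integral>x. max 0 (f x - g x) \<partial>L) = tv_dist M p q"
    "measure p {x \<in> space M. g x < f x} - measure q {x \<in> space M. g x < f x} = tv_dist M p q"
proof -
  have [measurable_cong]: "sets L = sets M" by fact
  have sp: "space L = space M" using L by (auto dest: sets_eq_imp_space_eq)
  note [measurable] = f(1) g(1)
  have fin: "finite_measure (density L (\<lambda>x. ennreal (f x)))" "finite_measure (density L (\<lambda>x. ennreal (g x)))"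
    using prob_space.finite_measure[OF prob_algebraD(1)[OF p]] prob_space.finite_measure[OF prob_algebraD(1)[OF q]]
    by (simp_all add: f(3) g(3))
  show If: "integrable L f" by (rule measure_density_real(1)[OF L f(1,2) fin(1)])
  show Ig: "integrable L g" by (rule measure_density_real(1)[OF L g(1,2) fin(2)])
  note diff = measure_diff_density[OF L f(1,2) fin(1) g(1,2) fin(2), folded f(3) g(3)]
  have Im: "integrable L (\<lambda>x. max 0 (f x - g x))" using If Ig by auto
  let ?A = "{x \<in> space M. g x < f x}"
  have A: "?A \<in> sets M" by measurable
  have eq: "measure p ?A - measure q ?A = (\<integral>x. max 0 (f x - g x) \<partial>L)"
    unfolding diff(2)[OF A] by (rule Bochner_Integration.integral_cong) (auto simp: sp indicator_def)
  have "tv_dist M p q \<le> (\<integral>x. max 0 (f x - g x) \<partial>L)"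
  proof (rule tv_dist_least[OF p q])
    fix B assume B[measurable]: "B \<in> sets M"
    show "measure p B - measure q B \<le> (\<integral>x. max 0 (f x - g x) \<partial>L)"
      unfolding diff(2)[OF B] by (rule integral_mono[OF diff(1)[OF B] Im]) (auto simp: indicator_def)
  qed
  moreover have "(\<integral>x. max 0 (f x - g x) \<partial>L) \<le> tv_dist M p q"
    using tv_dist_upper[OF p q A] eq by linarith
  ultimately show "(\<integral>x. max 0 (f x - g x) \<partial>L) = tv_dist M p q"
    "measure p ?A - measure q ?A = tv_dist M p q"
    using eq by linarith+
qed

lemma tv_dist_attained:
  assumes p: "p \<in> space (prob_algebra M)" and q: "q \<in> space (prob_algebra M)"
  obtains A where "A \<in> sets M" "measure p A - measure q A = tv_dist M p q"
proof -
  obtain L f g where *: "finite_measure L" "sets L = sets M"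
    "f \<in> borel_measurable M" "g \<in> borel_measurable M" "\<And>x. 0 \<le> f x" "\<And>x. 0 \<le> g x"
    "p = density L (\<lambda>x. ennreal (f x))" "q = density L (\<lambda>x. ennreal (g x))"
    by (rule dominating_density[of p M q])
       (use prob_algebraD[OF p] prob_algebraD[OF q] in \<open>auto simp: prob_space.finite_measure\<close>)
  note [measurable] = *(3,4)
  show thesis
    by (rule that[OF _ tv_dist_density(4)[OF p q *(2,3,5,7,4,6,8)]]) measurable
qed

text \<open>As the supremum is attained, distance one is witnessed by a single set that is null for
  one law and of full measure for the other.\<close>

lemma non_singular_iff_tv_dist:
  assumes p: "p \<in> space (prob_algebra M)" and q: "q \<in> space (prob_algebra M)"
  shows "non_singular M p q \<longleftrightarrow> tv_dist M p q < 1"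
proof -
  interpret p: prob_space p by (rule prob_algebraD[OF p])
  interpret q: prob_space q by (rule prob_algebraD[OF q])
  have q_compl: "measure q (space M - A) = 1 - measure q A" if "A \<in> sets M" for A
    using q.prob_compl[of A] that by (simp add: prob_algebraD[OF q])
  have "\<not> non_singular M p q \<longleftrightarrow> tv_dist M p q = 1"
  proof
    assume "\<not> non_singular M p q"
    then obtain A where A: "A \<in> sets M" "emeasure p A = 0" "emeasure q (space M - A) = 0"
      by (auto simp: non_singular_def)
    then have "measure p A = 0" "measure q A = 1"
      using q_compl[OF A(1)] by (auto simp: measure_def)
    then show "tv_dist M p q = 1"
      using tv_dist_upper[OF p q A(1)] tv_dist_le_1[OF p q] by simp
  next
    assume 1: "tv_dist M p q = 1"
    obtain A where A: "A \<in> sets M" "measure q A - measure p A = 1"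
      using tv_dist_attained[OF q p] 1 tv_dist_commute[OF p q] by metis
    have "measure p A = 0" "measure q (space M - A) = 0"
      using A(2) q_compl[OF A(1)] q.prob_le_1[of A] measure_nonneg[of p A] by linarith+
    then show "\<not> non_singular M p q"
      using A(1) by (auto simp: non_singular_def p.emeasure_eq_measure q.emeasure_eq_measure)
  qed
  then show ?thesis using tv_dist_le_1[OF p q] by linarith
qed

text \<open>Against the density difference, no test function with values in the unit interval does
  better than the indicator of the positive set. Applied to the transition probabilities into a set,
  this is the contraction property \<open>tv_dist_bind_le\<close>.\<close>

lemma integral_diff_le_tv_dist:
  fixes \<phi> :: "'a \<Rightarrow> real"
  assumes p: "p \<in> space (prob_algebra M)" and q: "q \<in> space (prob_algebra M)"
    and \<phi>: "\<phi> \<in> borel_measurable M" "\<And>x. x \<in> space M \<Longrightarrow> 0 \<le> \<phi> x" "\<And>x. x \<in> space M \<Longrightarrow> \<phi> x \<le> 1"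
  shows "(\<integral>x. \<phi> x \<partial>p) - (\<integral>x. \<phi> x \<partial>q) \<le> tv_dist M p q"
proof -
  obtain L f g where *: "finite_measure L" "sets L = sets M"
    "f \<in> borel_measurable M" "g \<in> borel_measurable M" "\<And>x. 0 \<le> f x" "\<And>x. 0 \<le> g x"
    "p = density L (\<lambda>x. ennreal (f x))" "q = density L (\<lambda>x. ennreal (g x))"
    by (rule dominating_density[of p M q])
       (use prob_algebraD[OF p] prob_algebraD[OF q] in \<open>auto simp: prob_space.finite_measure\<close>)
  note tv = tv_dist_density[OF p q *(2,3,5,7,4,6,8)]
  have [measurable_cong]: "sets L = sets M" by fact
  have sp: "space L = space M" using *(2) by (auto dest: sets_eq_imp_space_eq)
  note [measurable] = *(3,4) \<phi>(1)
  have If: "integrable L (\<lambda>x. f x * \<phi> x)" 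
    by (rule Bochner_Integration.integrable_bound[OF tv(1)])
       (use \<phi> *(5) in \<open>auto simp: sp abs_mult mult_left_le\<close>)
  have Ig: "integrable L (\<lambda>x. g x * \<phi> x)" 
    by (rule Bochner_Integration.integrable_bound[OF tv(2)])
       (use \<phi> *(6) in \<open>auto simp: sp abs_mult mult_left_le\<close>)
  have p_eq: "(\<integral>x. \<phi> x \<partial>p) = (\<integral>x. f x *\<^sub>R \<phi> x \<partial>L)"
    unfolding *(7) by (rule integral_density) (simp_all add: *(5))
  have q_eq: "(\<integral>x. \<phi> x \<partial>q) = (\<integral>x. g x *\<^sub>R \<phi> x \<partial>L)"
    unfolding *(8) by (rule integral_density) (simp_all add: *(6))
  have "(\<integral>x. \<phi> x \<partial>p) - (\<integral>x. \<phi> x \<partial>q) = (\<integral>x. f x * \<phi> x - g x * \<phi> x \<partial>L)"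
    unfolding p_eq q_eq real_scaleR_def using If Ig by (rule Bochner_Integration.integral_diff[symmetric])
  also have "\<dots> \<le> (\<integral>x. max 0 (f x - g x) \<partial>L)"
  proof (rule integral_mono)
    show "integrable L (\<lambda>x. f x * \<phi> x - g x * \<phi> x)" using If Ig by (rule Bochner_Integration.integrable_diff)
    show "integrable L (\<lambda>x. max 0 (f x - g x))" using tv(1,2) by auto
    fix x assume "x \<in> space L"
    then have "0 \<le> \<phi> x" "\<phi> x \<le> 1" using \<phi> by (auto simp: sp)
    then have "\<phi> x * (f x - g x) \<le> max 0 (f x - g x)"
      by (cases "0 \<le> f x - g x") (auto intro: mult_left_le_one_le mult_nonneg_nonpos)
    then show "f x * \<phi> x - g x * \<phi> x \<le> max 0 (f x - g x)" by (simp add: algebra_simps)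
  qed
  finally show ?thesis by (simp add: tv)
qed

lemma tv_dist_bind_le:
  assumes p: "p \<in> space (prob_algebra M)" and q: "q \<in> space (prob_algebra M)"
    and k: "k \<in> M \<rightarrow>\<^sub>M prob_algebra N"
  shows "tv_dist N (p \<bind> k) (q \<bind> k) \<le> tv_dist M p q"
proof (rule tv_dist_least[OF bind_in_prob_algebra[OF p k] bind_in_prob_algebra[OF q k]])
  fix A assume A: "A \<in> sets N"
  show "measure (p \<bind> k) A - measure (q \<bind> k) A \<le> tv_dist M p q"
    unfolding measure_bind_prob[OF p k A] measure_bind_prob[OF q k A]
    by (rule integral_diff_le_tv_dist[OF p q measurable_measure_kernel[OF k A]])
       (auto intro: measure_prob_le_1 measurable_space[OF k])
qed

text \<open>\<open>p'\<close> and \<open>q'\<close> are the normalised positive and negative parts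
  of \<open>p - q\<close>. Absolute continuity matters as much as the identity: it carries almost
  sure statements over to the remainders.\<close>

lemma tv_dist_split:
  assumes p: "p \<in> space (prob_algebra M)" and q: "q \<in> space (prob_algebra M)"
    and pos: "0 < tv_dist M p q"
  obtains p' q' where "p' \<in> space (prob_algebra M)" "q' \<in> space (prob_algebra M)"
    "absolutely_continuous p p'" "absolutely_continuous q q'"
    "\<And>\<phi>. \<phi> \<in> borel_measurable M \<Longrightarrow> (\<And>x. x \<in> space M \<Longrightarrow> \<bar>\<phi> x\<bar> \<le> 1) \<Longrightarrow>
       (\<integral>x. \<phi> x \<partial>p) - (\<integral>x. \<phi> x \<partial>q) = tv_dist M p q * ((\<integral>x. \<phi> x \<partial>p') - (\<integral>x. \<phi> x \<partial>q'))"
proof -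
  let ?d = "tv_dist M p q"
  obtain L f g where *: "finite_measure L" "sets L = sets M"
    "f \<in> borel_measurable M" "g \<in> borel_measurable M" "\<And>x. 0 \<le> f x" "\<And>x. 0 \<le> g x"
    "p = density L (\<lambda>x. ennreal (f x))" "q = density L (\<lambda>x. ennreal (g x))"
    by (rule dominating_density[of p M q])
       (use prob_algebraD[OF p] prob_algebraD[OF q] in \<open>auto simp: prob_space.finite_measure\<close>)
  note tv = tv_dist_density[OF p q *(2,3,5,7,4,6,8)]
  note tv' = tv_dist_density[OF q p *(2,4,6,8,3,5,7)]
  have [measurable_cong]: "sets L = sets M" by fact
  have sp: "space L = space M" using *(2) by (auto dest: sets_eq_imp_space_eq)
  note [measurable] = *(3,4)
  define a where "a x = max 0 (f x - g x) / ?d" for x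
  define b where "b x = max 0 (g x - f x) / ?d" for x
  have [measurable]: "a \<in> borel_measurable M" "b \<in> borel_measurable M"
    unfolding a_def b_def by measurable
  have nn: "0 \<le> a x" "0 \<le> b x" for x using pos by (auto simp: a_def b_def)
  have Iab: "integrable L a" "integrable L b"
    unfolding a_def b_def using tv(1,2) by auto
  have mass: "(\<integral>x. a x \<partial>L) = 1" "(\<integral>x. b x \<partial>L) = 1"
    using pos tv(3) tv'(3) tv_dist_commute[OF p q] by (simp_all add: a_def b_def)
  define p' q' where "p' = density L a" and "q' = density L b"
  have prob: "p' \<in> space (prob_algebra M)" "q' \<in> space (prob_algebra M)"
    unfolding p'_def q'_def space_prob_algebra using mass nn Iab *(2)
    by (auto intro!: prob_spaceI simp: emeasure_density nn_integral_eq_integral cong: nn_integral_cong)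
  show thesis
  proof
    show "p' \<in> space (prob_algebra M)" "q' \<in> space (prob_algebra M)" by fact+
    have ac: "absolutely_continuous (density L (\<lambda>x. ennreal (f x))) (density L (\<lambda>x. ennreal (c x)))"
      if [measurable]: "f \<in> borel_measurable M" "c \<in> borel_measurable M"
        and *: "\<And>x. f x \<le> 0 \<Longrightarrow> c x \<le> 0" for f c :: "'a \<Rightarrow> real"
      unfolding absolutely_continuous_def
      by (auto simp: null_sets_density_iff ennreal_eq_0_iff intro: * elim!: eventually_mono)
    show "absolutely_continuous p p'"
      unfolding p'_def *(7) using *(3,6) pos by (intro ac) (auto simp: a_def divide_simps intro: order_trans)
    show "absolutely_continuous q q'"
      unfolding q'_def *(8) using *(4,5) pos by (intro ac) (auto simp: b_def divide_simps intro: order_trans)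
    fix \<phi> :: "'a \<Rightarrow> real"
    assume \<phi>: "\<phi> \<in> borel_measurable M" "\<And>x. x \<in> space M \<Longrightarrow> \<bar>\<phi> x\<bar> \<le> 1"
    note [measurable] = \<phi>(1)
    have I: "integrable L (\<lambda>x. c x * \<phi> x)" if c: "integrable L c" for c :: "'a \<Rightarrow> real"
      using c \<phi>(2)
      by (intro Bochner_Integration.integrable_bound[OF c]) (auto simp: sp abs_mult mult_left_le)
    have dens: "(\<integral>x. \<phi> x \<partial>density L (\<lambda>x. ennreal (c x))) = (\<integral>x. c x * \<phi> x \<partial>L)"
      if "c \<in> borel_measurable M" "\<And>x. 0 \<le> c x" for c :: "'a \<Rightarrow> real"
      using that \<phi>(1) *(2) by (subst integral_density) (simp_all cong: measurable_cong_sets)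
    have "(\<integral>x. \<phi> x \<partial>p) - (\<integral>x. \<phi> x \<partial>q) = (\<integral>x. f x * \<phi> x - g x * \<phi> x \<partial>L)"
      unfolding *(7,8) dens[OF *(3,5)] dens[OF *(4,6)]
      using I[OF tv(1)] I[OF tv(2)] by (rule Bochner_Integration.integral_diff[symmetric])
    also have "\<dots> = (\<integral>x. ?d * (a x * \<phi> x - b x * \<phi> x) \<partial>L)"
      using pos by (intro Bochner_Integration.integral_cong) (auto simp: a_def b_def field_simps max_def)
    also have "\<dots> = ?d * ((\<integral>x. \<phi> x \<partial>p') - (\<integral>x. \<phi> x \<partial>q'))"
      using I[OF Iab(1)] I[OF Iab(2)] nn by (simp add: dens p'_def q'_def)
    finally show "(\<integral>x. \<phi> x \<partial>p) - (\<integral>x. \<phi> x \<partial>q) = ?d * ((\<integral>x. \<phi> x \<partial>p') - (\<integral>x. \<phi> x \<partial>q'))" .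
  qed
qed

section \<open>Measurability of the total variation distance\<close>

text \<open>The sets that can be approximated in symmetric difference are closed under complements
  and countable unions; for a union, continuity from below first cuts it down to finitely many
  members.\<close>

lemma finite_measure_approx_algebra:
  assumes "finite_measure N" and alg: "algebra (space N) \<A>" and sets: "sets N = sigma_sets (space N) \<A>"
    and A: "A \<in> sets N" and e: "0 < (e::real)"
  shows "\<exists>B\<in>\<A>. measure N ((A - B) \<union> (B - A)) < e"
proof -
  interpret finite_measure N by fact
  interpret \<A>: algebra "space N" \<A> by fact
  have \<A>: "B \<in> \<A> \<Longrightarrow> B \<in> sets N" for B using sets by auto
  define Q where "Q A \<longleftrightarrow> A \<in> sets N \<and> (\<forall>e>0. \<exists>B\<in>\<A>. measure N ((A - B) \<union> (B - A)) < e)" for A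
  have Q_Un: "Q (A \<union> A')" if "Q A" "Q A'" for A A'
    unfolding Q_def
  proof (intro conjI allI impI)
    show "A \<union> A' \<in> sets N" using that by (auto simp: Q_def)
    fix e :: real assume "0 < e"
    then have "0 < e / 2" by simp
    with that obtain B B' where B: "B \<in> \<A>" "measure N ((A - B) \<union> (B - A)) < e / 2"
      and B': "B' \<in> \<A>" "measure N ((A' - B') \<union> (B' - A')) < e / 2"
      unfolding Q_def by blast
    have [measurable]: "A \<in> sets N" "A' \<in> sets N" "B \<in> sets N" "B' \<in> sets N"
      using that B(1) B'(1) \<A> by (auto simp: Q_def)
    have "measure N ((A \<union> A' - (B \<union> B')) \<union> (B \<union> B' - (A \<union> A')))
        \<le> measure N (((A - B) \<union> (B - A)) \<union> ((A' - B') \<union> (B' - A')))"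
      by (rule finite_measure_mono) auto
    also have "\<dots> \<le> measure N ((A - B) \<union> (B - A)) + measure N ((A' - B') \<union> (B' - A'))"
      by (rule measure_Un_le) auto
    also have "\<dots> < e" using B B' by simp
    finally show "\<exists>C\<in>\<A>. measure N ((A \<union> A' - C) \<union> (C - (A \<union> A'))) < e"
      using B(1) B'(1) by (intro bexI[of _ "B \<union> B'"]) auto
  qed
  have Q_fin: "Q (\<Union>i<n. F i)" if "\<And>i. Q (F i)" for F :: "nat \<Rightarrow> 'a set" and n
  proof (induction n)
    case 0
    show ?case unfolding Q_def using \<A>.empty_sets by (auto intro!: bexI[of _ "{}"])
  next
    case (Suc n)
    then show ?case using Q_Un[OF Suc that[of n]] by (simp add: lessThan_Suc Un_commute)
  qed
  have "Q A"
    using A unfolding sets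
  proof (induction rule: sigma_sets.induct)
    case (Basic a)
    then show ?case by (auto simp: Q_def \<A> intro!: bexI[of _ a])
  next
    case Empty
    show ?case unfolding Q_def using \<A>.empty_sets by (auto intro!: bexI[of _ "{}"])
  next
    case (Compl a)
    show ?case unfolding Q_def
    proof (intro conjI allI impI)
      show "space N - a \<in> sets N" using Compl by (auto simp: Q_def)
      fix e :: real assume "0 < e"
      with Compl obtain B where B: "B \<in> \<A>" "measure N ((a - B) \<union> (B - a)) < e" by (auto simp: Q_def)
      have "a \<subseteq> space N" "B \<subseteq> space N" using Compl B \<A> sets.sets_into_space by (auto simp: Q_def)
      then have "(space N - a - (space N - B)) \<union> (space N - B - (space N - a)) = (a - B) \<union> (B - a)" by auto
      with B show "\<exists>B\<in>\<A>. measure N ((space N - a - B) \<union> (B - (space N - a))) < e"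
        by (intro bexI[of _ "space N - B"]) auto
    qed
  next
    case (Union F)
    then have F: "\<And>i. F i \<in> sets N" by (auto simp: Q_def)
    show ?case unfolding Q_def
    proof (intro conjI allI impI)
      show "(\<Union>i. F i) \<in> sets N" using F by auto
      fix e :: real assume e: "0 < e"
      have "(\<lambda>n. measure N (\<Union>i<n. F i)) \<longlonglongrightarrow> measure N (\<Union>n. \<Union>i<n. F i)"
        by (rule finite_Lim_measure_incseq) (use F in \<open>auto simp: incseq_def intro: less_le_trans\<close>)
      also have "(\<Union>n. \<Union>i<n. F i) = (\<Union>i. F i)" by auto
      finally have "\<forall>\<^sub>F n in sequentially. dist (measure N (\<Union>i<n. F i)) (measure N (\<Union>i. F i)) < e / 2"
        using e by (intro tendstoD) auto
      then obtain n where n: "dist (measure N (\<Union>i<n. F i)) (measure N (\<Union>i. F i)) < e / 2"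
        by (auto simp: eventually_sequentially)
      let ?U = "\<Union>i. F i" and ?V = "\<Union>i<n. F i"
      have UV: "?U \<in> sets N" "?V \<in> sets N" "?V \<subseteq> ?U" using F by auto
      have d: "measure N (?U - ?V) < e / 2"
        using n finite_measure_Diff[OF UV] unfolding dist_real_def by linarith
      obtain B where B: "B \<in> \<A>" "measure N ((?V - B) \<union> (B - ?V)) < e / 2"
        using Q_fin[of F n] Union e unfolding Q_def by (metis half_gt_zero)
      note [measurable] = UV(1,2) \<A>[OF B(1)]
      have "measure N ((?U - B) \<union> (B - ?U)) \<le> measure N ((?U - ?V) \<union> ((?V - B) \<union> (B - ?V)))"
        by (rule finite_measure_mono) auto
      also have "\<dots> \<le> measure N (?U - ?V) + measure N ((?V - B) \<union> (B - ?V))"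
        by (rule measure_Un_le) auto
      also have "\<dots> < e" using d B by simp
      finally show "\<exists>B\<in>\<A>. measure N ((?U - B) \<union> (B - ?U)) < e" using B(1) by auto
    qed
  qed
  then show ?thesis using e by (auto simp: Q_def)
qed

text \<open>Generating the algebra in countably many stages makes its countability an easy
  induction.\<close>

primrec algebra_stage :: "'a set \<Rightarrow> 'a set set \<Rightarrow> nat \<Rightarrow> 'a set set" where
  "algebra_stage \<Omega> G 0 = insert {} G"
| "algebra_stage \<Omega> G (Suc n) = algebra_stage \<Omega> G n \<union> (\<lambda>A. \<Omega> - A) ` algebra_stage \<Omega> G n \<union>
     (\<lambda>(A, B). A \<union> B) ` (algebra_stage \<Omega> G n \<times> algebra_stage \<Omega> G n)"

lemma countable_generating_algebra:
  assumes "countably_generated M"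
  obtains \<A> where "countable \<A>" "algebra (space M) \<A>" "sets M = sigma_sets (space M) \<A>"
proof -
  obtain G where G: "countable G" "G \<subseteq> Pow (space M)" "sets M = sigma_sets (space M) G"
    using assms by (auto simp: countably_generated_def)
  define S where "S = algebra_stage (space M) G"
  have S: "countable (S n) \<and> S n \<subseteq> sets M" for n
  proof (induction n)
    case 0
    show ?case using G(1,3) by (auto simp: S_def)
  next
    case (Suc n)
    then show ?case by (auto simp: S_def)
  qed
  have mono: "m \<le> n \<Longrightarrow> S m \<subseteq> S n" for m n
    by (rule lift_Suc_mono_le[of S]) (auto simp: S_def)
  show thesis
  proof
    show "countable (\<Union>n. S n)" using S by blast
    show "algebra (space M) (\<Union>n. S n)"
      unfolding algebra_iff_Un
    proof (intro conjI ballI)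
      show "(\<Union>n. S n) \<subseteq> Pow (space M)" using S sets.sets_into_space by blast
      show "{} \<in> (\<Union>n. S n)" unfolding S_def by (rule UN_I[of 0]) auto
      show "space M - A \<in> (\<Union>n. S n)" if A: "A \<in> (\<Union>n. S n)" for A
      proof -
        obtain n where "A \<in> S n" using A by blast
        then have "space M - A \<in> S (Suc n)" by (auto simp: S_def)
        then show ?thesis by blast
      qed
      show "A \<union> B \<in> (\<Union>n. S n)" if AB: "A \<in> (\<Union>n. S n)" "B \<in> (\<Union>n. S n)" for A B
      proof -
        obtain m n where "A \<in> S m" "B \<in> S n" using AB by blast
        then have "A \<in> S (max m n)" "B \<in> S (max m n)"
          using mono[of m "max m n"] mono[of n "max m n"] by auto
        then have "A \<union> B \<in> S (Suc (max m n))" by (force simp: S_def)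
        then show ?thesis by blast
      qed
    qed
    show "sets M = sigma_sets (space M) (\<Union>n. S n)"
    proof
      have "G \<subseteq> S 0" by (auto simp: S_def)
      then have "G \<subseteq> (\<Union>n. S n)" by blast
      then show "sets M \<subseteq> sigma_sets (space M) (\<Union>n. S n)"
        unfolding G(3) by (rule sigma_sets_mono')
      show "sigma_sets (space M) (\<Union>n. S n) \<subseteq> sets M"
        using S by (intro sets.sigma_sets_subset) auto
    qed
  qed
qed

text \<open>By approximation, the supremum over all measurable sets equals the supremum over a
  countable generating algebra, and a countable supremum of measurable functions is
  measurable.\<close>

lemma measurable_tv_dist:
  assumes cg: "countably_generated M"
    and k: "k \<in> N \<rightarrow>\<^sub>M prob_algebra M" and l: "l \<in> N \<rightarrow>\<^sub>M prob_algebra M"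
  shows "(\<lambda>z. tv_dist M (k z) (l z)) \<in> borel_measurable N"
proof -
  obtain \<A> where \<A>: "countable \<A>" "algebra (space M) \<A>" "sets M = sigma_sets (space M) \<A>"
    using countable_generating_algebra[OF cg] .
  interpret \<A>: algebra "space M" \<A> by fact
  have sub: "B \<in> \<A> \<Longrightarrow> B \<in> sets M" for B using \<A>(3) by auto
  have "tv_dist M p q = (SUP A\<in>\<A>. \<bar>measure p A - measure q A\<bar>)"
    if p: "p \<in> space (prob_algebra M)" and q: "q \<in> space (prob_algebra M)" for p q
  proof (rule antisym)
    have bdd: "bdd_above ((\<lambda>A. \<bar>measure p A - measure q A\<bar>) ` \<A>)"
      by (auto intro!: bdd_aboveI[of _ 1] abs_measure_diff_le_1[OF p q])
    show "(SUP A\<in>\<A>. \<bar>measure p A - measure q A\<bar>) \<le> tv_dist M p q"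
      by (rule cSUP_least) (use \<A>.empty_sets sub in \<open>auto intro: tv_dist_upper[OF p q]\<close>)
    show "tv_dist M p q \<le> (SUP A\<in>\<A>. \<bar>measure p A - measure q A\<bar>)"
    proof (rule tv_dist_least[OF p q])
      fix A assume A: "A \<in> sets M"
      interpret p: prob_space p by (rule prob_algebraD[OF p])
      interpret q: prob_space q by (rule prob_algebraD[OF q])
      note [simp] = prob_algebraD(2,3)[OF p] prob_algebraD(2,3)[OF q]
      \<comment> \<open>Approximating with respect to the sum gives one set that is close to
        \<open>A\<close> for both measures at once.\<close>
      let ?N = "add_measure p q"
      have em: "emeasure ?N B = emeasure p B + emeasure q B" if "B \<in> sets M" for B
        by (rule emeasure_add_measure) (use that in simp_all)
      have fin: "finite_measure ?N" by (rule finite_measureI) (simp add: em)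
      have le: "\<bar>measure p A - measure p B\<bar> + \<bar>measure q A - measure q B\<bar> \<le> measure ?N ((A - B) \<union> (B - A))"
        if B: "B \<in> sets M" for B
      proof -
        have *: "\<bar>measure r A - measure r B\<bar> \<le> measure r ((A - B) \<union> (B - A))"
          if r: "prob_space r" "sets r = sets M" for r
        proof -
          interpret r: prob_space r by fact
          have "measure r A \<le> measure r (B \<union> ((A - B) \<union> (B - A)))"
               "measure r B \<le> measure r (A \<union> ((A - B) \<union> (B - A)))"
            using A B r by (auto intro!: r.finite_measure_mono)
          moreover have "measure r (B \<union> ((A - B) \<union> (B - A))) \<le> measure r B + measure r ((A - B) \<union> (B - A))"
            "measure r (A \<union> ((A - B) \<union> (B - A))) \<le> measure r A + measure r ((A - B) \<union> (B - A))"
            using A B r by (auto intro!: measure_Un_le)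
          ultimately show ?thesis by linarith
        qed
        have "emeasure ?N ((A - B) \<union> (B - A)) = emeasure p ((A - B) \<union> (B - A)) + emeasure q ((A - B) \<union> (B - A))"
          using A B by (intro em) auto
        then have "measure ?N ((A - B) \<union> (B - A)) = measure p ((A - B) \<union> (B - A)) + measure q ((A - B) \<union> (B - A))"
          by (simp add: p.emeasure_eq_measure q.emeasure_eq_measure
              finite_measure.emeasure_eq_measure[OF fin] flip: ennreal_plus)
        then show ?thesis
          using *[of p] *[of q] p.prob_space_axioms q.prob_space_axioms by simp
      qed
      show "measure p A - measure q A \<le> (SUP A\<in>\<A>. \<bar>measure p A - measure q A\<bar>)"
      proof (rule field_le_epsilon)
        fix e :: real assume e: "0 < e"
        have "\<exists>B\<in>\<A>. measure ?N ((A - B) \<union> (B - A)) < e"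
          by (rule finite_measure_approx_algebra[OF fin _ _ _ e]) (use \<A> A in simp_all)
        then obtain B where B: "B \<in> \<A>" "measure ?N ((A - B) \<union> (B - A)) < e" by blast
        have "\<bar>measure p B - measure q B\<bar> \<le> (SUP A\<in>\<A>. \<bar>measure p A - measure q A\<bar>)"
          by (rule cSUP_upper[OF B(1) bdd])
        then show "measure p A - measure q A \<le> (SUP A\<in>\<A>. \<bar>measure p A - measure q A\<bar>) + e"
          using le[OF sub[OF B(1)]] B(2) by linarith
      qed
    qed
  qed
  then have "(\<lambda>z. tv_dist M (k z) (l z)) \<in> borel_measurable N \<longleftrightarrow>
      (\<lambda>z. SUP A\<in>\<A>. \<bar>measure (k z) A - measure (l z) A\<bar>) \<in> borel_measurable N"
    using measurable_space[OF k] measurable_space[OF l] by (intro measurable_cong) auto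
  also have "\<dots>"
  proof (rule borel_measurable_cSUP[OF \<A>(1)])
    fix A assume "A \<in> \<A>"
    then show "(\<lambda>z. \<bar>measure (k z) A - measure (l z) A\<bar>) \<in> borel_measurable N"
      using sub measurable_measure_kernel[OF k] measurable_measure_kernel[OF l] by simp
  next
    fix z assume "z \<in> space N"
    then show "bdd_above ((\<lambda>A. \<bar>measure (k z) A - measure (l z) A\<bar>) ` \<A>)"
      using measurable_space[OF k] measurable_space[OF l]
      by (auto intro!: bdd_aboveI[of _ 1] abs_measure_diff_le_1)
  qed
  finally show ?thesis .
qed

section \<open>The limit of the total variation distance\<close>

locale markov_kernel =
  fixes M :: "'a measure" and K :: "'a \<Rightarrow> 'a measure"
  assumes generated: "countably_generated M"
    and kernel: "K \<in> M \<rightarrow>\<^sub>M prob_algebra M"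
begin

abbreviation P :: "nat \<Rightarrow> 'a \<Rightarrow> 'a measure" where "P n x \<equiv> n_step M K n x"

lemma measurable_P [measurable]: "P n \<in> M \<rightarrow>\<^sub>M prob_algebra M"
proof (induction n)
  case 0
  show ?case by (simp add: n_step.simps(1)[abs_def])
next
  case (Suc n)
  then show ?case
    using measurable_bind_prob_space[OF Suc kernel] by (simp add: n_step.simps(2)[abs_def])
qed

lemma P_prob: "x \<in> space M \<Longrightarrow> P n x \<in> space (prob_algebra M)"
  using measurable_space[OF measurable_P] .

lemma bind_P_assoc:
  assumes "p \<in> space (prob_algebra L)" "k \<in> L \<rightarrow>\<^sub>M prob_algebra N" "l \<in> N \<rightarrow>\<^sub>M prob_algebra R"
  shows "(p \<bind> k) \<bind> l = p \<bind> (\<lambda>x. k x \<bind> l)"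
  using measurable_prob_algebraD[OF assms(2)] measurable_prob_algebraD[OF assms(3)]
  by (intro bind_assoc[where N=N and R=R]) (auto simp: measurable_prob_algebra_cong[OF assms(1)])

lemma bind_P_Suc: "p \<in> space (prob_algebra M) \<Longrightarrow> (p \<bind> P n) \<bind> K = p \<bind> P (Suc n)"
  using bind_P_assoc[OF _ measurable_P kernel] by simp

lemma bind_P_0: "p \<in> space (prob_algebra M) \<Longrightarrow> p \<bind> P 0 = p"
  by (simp add: bind_return'' prob_algebraD)

lemma bind_P_add: "p \<in> space (prob_algebra M) \<Longrightarrow> (p \<bind> P m) \<bind> P n = p \<bind> P (m + n)"
proof (induction n)
  case 0
  then show ?case by (simp only: bind_P_0 bind_in_prob_algebra[OF _ measurable_P] add_0_right)
next
  case (Suc n)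
  then show ?case
    using bind_P_Suc[of "p \<bind> P m" n] bind_P_Suc[of p "m + n"] bind_in_prob_algebra[OF Suc.prems measurable_P[of m]]
    by simp
qed

lemma return_bind_P: "x \<in> space M \<Longrightarrow> return M x \<bind> P n = P n x"
  using bind_return[OF measurable_prob_algebraD[OF measurable_P]] .

lemma P_add: "x \<in> space M \<Longrightarrow> P m x \<bind> P n = P (m + n) x"
  using bind_P_add[OF return_in_prob_algebra, of x m n] by (simp add: return_bind_P)

lemma P_1: "x \<in> space M \<Longrightarrow> P 1 x = K x"
  using bind_return[OF measurable_prob_algebraD[OF kernel]] by simp

lemma measurable_tv_bind_P:
  assumes "k \<in> N \<rightarrow>\<^sub>M prob_algebra M" "l \<in> N \<rightarrow>\<^sub>M prob_algebra M"
  shows "(\<lambda>z. tv_dist M (k z \<bind> P m) (l z \<bind> P m)) \<in> borel_measurable N"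
  by (rule measurable_tv_dist[OF generated]) (rule measurable_bind_prob_space[OF _ measurable_P], fact)+

definition lim_tv :: "'a measure \<Rightarrow> 'a measure \<Rightarrow> real" where
  "lim_tv p q = lim (\<lambda>m. tv_dist M (p \<bind> P m) (q \<bind> P m))"

lemma bind_P_in [simp, intro]: "p \<in> space (prob_algebra M) \<Longrightarrow> p \<bind> P m \<in> space (prob_algebra M)"
  by (rule bind_in_prob_algebra[OF _ measurable_P])

lemma decseq_tv:
  assumes p: "p \<in> space (prob_algebra M)" and q: "q \<in> space (prob_algebra M)"
  shows "decseq (\<lambda>m. tv_dist M (p \<bind> P m) (q \<bind> P m))"
proof (rule decseq_SucI)
  fix m
  show "tv_dist M (p \<bind> P (Suc m)) (q \<bind> P (Suc m)) \<le> tv_dist M (p \<bind> P m) (q \<bind> P m)"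
    using tv_dist_bind_le[OF bind_P_in[OF p] bind_P_in[OF q] kernel, of m m]
    by (simp only: bind_P_Suc p q)
qed

lemma lim_tv:
  assumes p: "p \<in> space (prob_algebra M)" and q: "q \<in> space (prob_algebra M)"
  shows "(\<lambda>m. tv_dist M (p \<bind> P m) (q \<bind> P m)) \<longlonglongrightarrow> lim_tv p q"
proof -
  have "convergent (\<lambda>m. tv_dist M (p \<bind> P m) (q \<bind> P m))"
    by (rule convergentI[OF LIMSEQ_decseq_INF[OF _ decseq_tv[OF p q]]])
       (auto intro!: bdd_belowI[of _ 0] tv_dist_nonneg p q)
  then show ?thesis by (simp add: lim_tv_def convergent_LIMSEQ_iff)
qed

lemma lim_tv_eqI:
  assumes "p \<in> space (prob_algebra M)" "q \<in> space (prob_algebra M)"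
    and "(\<lambda>m. tv_dist M (p \<bind> P m) (q \<bind> P m)) \<longlonglongrightarrow> c"
  shows "lim_tv p q = c"
  using LIMSEQ_unique[OF lim_tv[OF assms(1,2)] assms(3)] .

context
  fixes p q
  assumes p: "p \<in> space (prob_algebra M)" and q: "q \<in> space (prob_algebra M)"
begin

lemma lim_tv_le: "lim_tv p q \<le> tv_dist M (p \<bind> P m) (q \<bind> P m)"
  using decseq_ge[OF decseq_tv[OF p q] lim_tv[OF p q]] .

lemma lim_tv_nonneg: "0 \<le> lim_tv p q"
  by (rule LIMSEQ_le_const[OF lim_tv[OF p q]]) (auto intro!: tv_dist_nonneg p q)

lemma lim_tv_le_1: "lim_tv p q \<le> 1"
  using lim_tv_le[of 0] tv_dist_le_1[OF bind_P_in[OF p] bind_P_in[OF q], of 0 0] by linarith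

lemma lim_tv_commute: "lim_tv p q = lim_tv q p"
  using p q by (simp add: lim_tv_def tv_dist_commute[of _ M])

lemma lim_tv_bind: "lim_tv (p \<bind> P n) (q \<bind> P n) = lim_tv p q"
proof (rule lim_tv_eqI)
  show "(\<lambda>m. tv_dist M (p \<bind> P n \<bind> P m) (q \<bind> P n \<bind> P m)) \<longlonglongrightarrow> lim_tv p q"
    using LIMSEQ_ignore_initial_segment[OF lim_tv[OF p q], of n]
    by (simp only: bind_P_add p q add.commute)
qed (auto intro: p q)

end

lemma lim_tv_triangle:
  assumes p: "p \<in> space (prob_algebra M)" and q: "q \<in> space (prob_algebra M)"
    and r: "r \<in> space (prob_algebra M)"
  shows "lim_tv p r \<le> lim_tv p q + lim_tv q r"
  by (rule LIMSEQ_le[OF lim_tv[OF p r] tendsto_add[OF lim_tv[OF p q] lim_tv[OF q r]]])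
     (auto intro!: tv_dist_triangle p q r)

lemma measurable_lim_tv:
  assumes k: "k \<in> N \<rightarrow>\<^sub>M prob_algebra M" and l: "l \<in> N \<rightarrow>\<^sub>M prob_algebra M"
  shows "(\<lambda>z. lim_tv (k z) (l z)) \<in> borel_measurable N"
  by (rule borel_measurable_LIMSEQ_real[OF lim_tv measurable_tv_bind_P[OF k l]])
     (auto intro: measurable_space[OF k] measurable_space[OF l])

text \<open>Convexity of the distance at each fixed time passes to the limit by dominated
  convergence, with the constant one as bound.\<close>

lemma lim_tv_convex:
  assumes p: "p \<in> space (prob_algebra N)" and k: "k \<in> N \<rightarrow>\<^sub>M prob_algebra M"
    and r: "r \<in> space (prob_algebra M)"
  shows "lim_tv (p \<bind> k) r \<le> (\<integral>x. lim_tv (k x) r \<partial>p)"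
proof (rule LIMSEQ_le[OF lim_tv[OF bind_in_prob_algebra[OF p k] r]])
  interpret prob_space p by (rule prob_algebraD[OF p])
  have r': "(\<lambda>_. r) \<in> N \<rightarrow>\<^sub>M prob_algebra M" using r by simp
  note kx = measurable_space[OF k]
  show "(\<lambda>m. \<integral>x. tv_dist M (k x \<bind> P m) (r \<bind> P m) \<partial>p) \<longlonglongrightarrow> (\<integral>x. lim_tv (k x) r \<partial>p)"
  proof (rule integral_dominated_convergence[where w="\<lambda>_. 1"])
    show "(\<lambda>x. lim_tv (k x) r) \<in> borel_measurable p"
      using measurable_lim_tv[OF k r'] by (simp add: measurable_prob_algebra_cong[OF p])
    show "(\<lambda>x. tv_dist M (k x \<bind> P m) (r \<bind> P m)) \<in> borel_measurable p" for m
      using measurable_tv_bind_P[OF k r'] by (simp add: measurable_prob_algebra_cong[OF p])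
    show "AE x in p. (\<lambda>m. tv_dist M (k x \<bind> P m) (r \<bind> P m)) \<longlonglongrightarrow> lim_tv (k x) r"
      using kx r by (intro AE_I2 lim_tv) (auto simp: prob_algebraD[OF p])
    show "AE x in p. norm (tv_dist M (k x \<bind> P m) (r \<bind> P m)) \<le> 1" for m
      using kx r by (intro AE_I2) (auto simp: prob_algebraD[OF p] tv_dist_nonneg tv_dist_le_1)
  qed simp
  have "tv_dist M (p \<bind> k \<bind> P m) (r \<bind> P m) \<le> (\<integral>x. tv_dist M (k x \<bind> P m) (r \<bind> P m) \<partial>p)" for m
    unfolding bind_P_assoc[OF p k measurable_P]
    by (rule tv_dist_bind_const[OF p measurable_bind_prob_space[OF k measurable_P] bind_P_in[OF r]
          measurable_tv_bind_P[OF k r']])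
  then show "\<exists>N. \<forall>m\<ge>N. tv_dist M (p \<bind> k \<bind> P m) (r \<bind> P m) \<le> (\<integral>x. tv_dist M (k x \<bind> P m) (r \<bind> P m) \<partial>p)"
    by blast
qed

definition h :: "'a \<Rightarrow> 'a \<Rightarrow> real" where "h x y = lim_tv (return M x) (return M y)"

lemma h_lim: "x \<in> space M \<Longrightarrow> y \<in> space M \<Longrightarrow> (\<lambda>n. tv_dist M (P n x) (P n y)) \<longlonglongrightarrow> h x y"
  using lim_tv[OF return_in_prob_algebra return_in_prob_algebra, of x y]
  by (simp add: return_bind_P h_def)

lemma h_le: "x \<in> space M \<Longrightarrow> y \<in> space M \<Longrightarrow> h x y \<le> tv_dist M (P n x) (P n y)"
  using lim_tv_le[OF return_in_prob_algebra return_in_prob_algebra, of x y n]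
  by (simp add: return_bind_P h_def)

lemma h_nonneg: "x \<in> space M \<Longrightarrow> y \<in> space M \<Longrightarrow> 0 \<le> h x y"
  and h_le_1: "x \<in> space M \<Longrightarrow> y \<in> space M \<Longrightarrow> h x y \<le> 1"
  and h_commute: "x \<in> space M \<Longrightarrow> y \<in> space M \<Longrightarrow> h x y = h y x"
  by (simp_all add: h_def return_in_prob_algebra lim_tv_nonneg lim_tv_le_1 lim_tv_commute)

lemma h_eq_lim_tv_P: "x \<in> space M \<Longrightarrow> y \<in> space M \<Longrightarrow> h x y = lim_tv (P n x) (P n y)"
  using lim_tv_bind[OF return_in_prob_algebra return_in_prob_algebra, of x y n]
  by (simp add: return_bind_P h_def)

lemma measurable_h [measurable]: "(\<lambda>(x, y). h x y) \<in> borel_measurable (M \<Otimes>\<^sub>M M)"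
  unfolding h_def split_beta' by (rule measurable_lim_tv) measurable

text \<open>Convexity is used once in each argument. For \<open>p = P n x\<close> and
  \<open>q = P n y\<close> the left-hand side is \<open>h x y\<close> and the right-hand side is the
  mean of \<open>h\<close> after \<open>n\<close> steps of two independent copies: this is
  subharmonicity.\<close>

lemma lim_tv_le_integral_h:
  assumes p: "p \<in> space (prob_algebra M)" and q: "q \<in> space (prob_algebra M)"
  shows "lim_tv p q \<le> (\<integral>x. \<integral>y. h x y \<partial>q \<partial>p)"
proof -
  interpret p: prob_space p by (rule prob_algebraD[OF p])
  interpret q: prob_space q by (rule prob_algebraD[OF q])
  note [measurable_cong] = prob_algebraD(2)[OF p] prob_algebraD(2)[OF q]
  note [simp] = prob_algebraD(3)[OF p] prob_algebraD(3)[OF q]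
  have p_ret: "p = p \<bind> return M" and q_ret: "q = q \<bind> return M"
    using bind_P_0[OF p] bind_P_0[OF q] by (simp_all add: n_step.simps(1)[abs_def])
  have x: "lim_tv (return M x) q \<le> (\<integral>y. h x y \<partial>q)" if x: "x \<in> space M" for x
  proof -
    have "lim_tv (return M x) q = lim_tv (q \<bind> return M) (return M x)"
      using q_ret lim_tv_commute[OF return_in_prob_algebra[OF x] q] by simp
    also have "\<dots> \<le> (\<integral>y. lim_tv (return M y) (return M x) \<partial>q)"
      by (rule lim_tv_convex[OF q measurable_return_prob_space return_in_prob_algebra[OF x]])
    also have "\<dots> = (\<integral>y. h x y \<partial>q)"
      using x by (intro Bochner_Integration.integral_cong) (auto simp: h_def lim_tv_commute return_in_prob_algebra)
    finally show ?thesis .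
  qed
  have "lim_tv p q \<le> (\<integral>x. lim_tv (return M x) q \<partial>p)"
    using lim_tv_convex[OF p measurable_return_prob_space q] p_ret by simp
  also have "\<dots> \<le> (\<integral>x. \<integral>y. h x y \<partial>q \<partial>p)"
  proof (rule integral_mono)
    show "integrable p (\<lambda>x. lim_tv (return M x) q)"
      using p q
      by (intro integrable_prob_bounded[where B=1] measurable_lim_tv)
         (auto simp: lim_tv_nonneg lim_tv_le_1 return_in_prob_algebra)
    have 1: "(\<lambda>x. \<integral>y. h x y \<partial>q) \<in> borel_measurable M" by measurable
    show "integrable p (\<lambda>x. \<integral>y. h x y \<partial>q)"
    proof (rule integrable_prob_bounded[OF p 1])
      fix x assume x: "x \<in> space M"
      have I: "integrable q (h x)"
        using x by (intro integrable_prob_bounded[OF q, where B=1]) (auto simp: h_nonneg h_le_1)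
      have "0 \<le> (\<integral>y. h x y \<partial>q)" using x by (intro integral_nonneg_AE AE_I2) (auto simp: h_nonneg)
      moreover have "(\<integral>y. h x y \<partial>q) \<le> 1"
        using x by (intro q.integral_le_const[OF I] AE_I2) (auto simp: h_le_1)
      ultimately show "\<bar>\<integral>y. h x y \<partial>q\<bar> \<le> 1" by simp
    qed
  qed (use x in auto)
  finally show ?thesis .
qed

lemma lim_tv_const:
  assumes p: "p \<in> space (prob_algebra M)" and q: "q \<in> space (prob_algebra M)"
    and c: "AE x in p. AE y in q. h x y = c"
  shows "lim_tv p q \<le> c"
proof -
  interpret p: prob_space p by (rule prob_algebraD[OF p])
  interpret q: prob_space q by (rule prob_algebraD[OF q])
  note [measurable_cong] = prob_algebraD(2)[OF p] prob_algebraD(2)[OF q]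
  note sp = prob_algebraD(3)[OF p] prob_algebraD(3)[OF q]
  have "lim_tv p q \<le> (\<integral>x. \<integral>y. h x y \<partial>q \<partial>p)"
    by (rule lim_tv_le_integral_h[OF p q])
  also have "\<dots> = (\<integral>x. c \<partial>p)"
  proof (rule integral_cong_AE)
    show "AE x in p. (\<integral>y. h x y \<partial>q) = c"
      using c AE_space
    proof eventually_elim
      case (elim x)
      have "(\<integral>y. h x y \<partial>q) = (\<integral>y. c \<partial>q)"
        using elim sp by (intro integral_cong_AE) auto
      then show ?case by (simp add: q.prob_space)
    qed
  qed measurable
  finally show ?thesis by (simp add: p.prob_space)
qed

text \<open>Splitting off the common part of \<open>p\<close> and \<open>q\<close>, on which the chains can be coupled at once.\<close>

lemma lim_tv_const_mult:
  assumes p: "p \<in> space (prob_algebra M)" and q: "q \<in> space (prob_algebra M)"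
    and c: "AE x in p. AE y in q. h x y = c"
  shows "lim_tv p q \<le> tv_dist M p q * c"
proof (cases "tv_dist M p q = 0")
  case True
  then show ?thesis using lim_tv_le[OF p q, of 0] by (simp only: bind_P_0 p q)
next
  case False
  then have pos: "0 < tv_dist M p q" using tv_dist_nonneg[OF p q] by simp
  obtain p' q' where p': "p' \<in> space (prob_algebra M)" and q': "q' \<in> space (prob_algebra M)"
    and ac: "absolutely_continuous p p'" "absolutely_continuous q q'"
    and eq: "\<And>\<phi>. \<phi> \<in> borel_measurable M \<Longrightarrow> (\<And>x. x \<in> space M \<Longrightarrow> \<bar>\<phi> x\<bar> \<le> 1) \<Longrightarrow>
       (\<integral>x. \<phi> x \<partial>p) - (\<integral>x. \<phi> x \<partial>q) = tv_dist M p q * ((\<integral>x. \<phi> x \<partial>p') - (\<integral>x. \<phi> x \<partial>q'))"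
    by (rule tv_dist_split[OF p q pos]) blast
  note [simp] = prob_algebraD(2)[OF p] prob_algebraD(2)[OF q] prob_algebraD(2)[OF p'] prob_algebraD(2)[OF q']
  have AE_ac: "AE x in p'. Q x" if "AE x in p. Q x" for Q
    using absolutely_continuous_AE[OF _ ac(1) that] by simp
  have AE_ac': "AE x in q'. Q x" if "AE x in q. Q x" for Q
    using absolutely_continuous_AE[OF _ ac(2) that] by simp
  \<comment> \<open>The exceptional set for \<open>y\<close> depends on \<open>x\<close>, so the
    statement is transferred first in \<open>x\<close> and then, for each good \<open>x\<close>, in
    \<open>y\<close>.\<close>
  have c': "AE x in p'. AE y in q'. h x y = c"
    using AE_ac[OF c] by eventually_elim (rule AE_ac')
  \<comment> \<open>Applying \<open>P m\<close> is linear, so the difference of the images of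
    \<open>p\<close> and \<open>q\<close> is the same multiple of the difference for the
    remainders.\<close>
  have tv: "tv_dist M (p \<bind> P m) (q \<bind> P m) \<le> tv_dist M p q * tv_dist M (p' \<bind> P m) (q' \<bind> P m)" for m
  proof (rule tv_dist_least[OF bind_P_in[OF p] bind_P_in[OF q]])
    fix A assume A: "A \<in> sets M"
    have "measure (p \<bind> P m) A - measure (q \<bind> P m) A
        = tv_dist M p q * (measure (p' \<bind> P m) A - measure (q' \<bind> P m) A)"
      unfolding measure_bind_prob[OF p measurable_P A] measure_bind_prob[OF q measurable_P A]
        measure_bind_prob[OF p' measurable_P A] measure_bind_prob[OF q' measurable_P A]
      by (rule eq[OF measurable_measure_kernel[OF measurable_P A]])
         (auto intro: measure_prob_le_1 P_prob)
    also have "\<dots> \<le> tv_dist M p q * tv_dist M (p' \<bind> P m) (q' \<bind> P m)"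
      using tv_dist_upper[OF bind_P_in[OF p'] bind_P_in[OF q'] A, of m m] pos
      by (intro mult_left_mono) auto
    finally show "measure (p \<bind> P m) A - measure (q \<bind> P m) A
        \<le> tv_dist M p q * tv_dist M (p' \<bind> P m) (q' \<bind> P m)" .
  qed
  have "lim_tv p q \<le> tv_dist M p q * lim_tv p' q'"
    by (rule LIMSEQ_le[OF lim_tv[OF p q] tendsto_mult_left[OF lim_tv[OF p' q']]]) (use tv in blast)
  also have "\<dots> \<le> tv_dist M p q * c"
    using lim_tv_const[OF p' q' c'] pos by simp
  finally show ?thesis .
qed

end

section \<open>The zero-one law\<close>

text \<open>The second moment of \<open>g\<close> is preserved by \<open>T\<close>, so its conditional variance vanishes.\<close>

lemma subharmonic_invariant_const:
  fixes g :: "'a \<Rightarrow> real"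
  assumes p: "p \<in> space (prob_algebra N)" and T: "T \<in> N \<rightarrow>\<^sub>M prob_algebra N" and inv: "p \<bind> T = p"
    and g: "g \<in> borel_measurable N" and g01: "\<And>z. z \<in> space N \<Longrightarrow> 0 \<le> g z" "\<And>z. z \<in> space N \<Longrightarrow> g z \<le> 1"
    and sub: "\<And>z. z \<in> space N \<Longrightarrow> g z \<le> (\<integral>w. g w \<partial>T z)"
  shows "AE z in p. AE w in T z. g w = g z"
proof -
  note [measurable] = g
  have T': "T \<in> N \<rightarrow>\<^sub>M subprob_algebra N" by (rule measurable_prob_algebraD[OF T])
  note Tz = measurable_space[OF T]
  have int_meas: "(\<lambda>z. \<integral>w. f w \<partial>T z) \<in> borel_measurable N" if "f \<in> borel_measurable N" for f :: "'a \<Rightarrow> real"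
    using measurable_compose[OF T' integral_measurable_subprob_algebra[OF that]] .
  \<comment> \<open>\<open>V z\<close> is the mean of \<open>(g w - g z)\<^sup>2\<close> for
    \<open>w\<close> drawn from \<open>T z\<close>, expanded into moments so that its measurability
    in \<open>z\<close> is clear.\<close>
  define V where "V z = (\<integral>w. (g w)\<^sup>2 \<partial>T z) - 2 * g z * (\<integral>w. g w \<partial>T z) + (g z)\<^sup>2" for z
  have sq: "0 \<le> (g z)\<^sup>2" "(g z)\<^sup>2 \<le> 1" if "z \<in> space N" for z
    using g01[OF that] by (auto simp: power_le_one)
  have I: "integrable (T z) g" "integrable (T z) (\<lambda>w. (g w)\<^sup>2)" if "z \<in> space N" for z
    using that sq g01 by (auto intro!: integrable_prob_bounded[OF Tz, where B=1])
  have V: "(\<integral>w. (g w - g z)\<^sup>2 \<partial>T z) = V z" if z: "z \<in> space N" for z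
  proof -
    interpret prob_space "T z" by (rule prob_algebraD[OF Tz[OF z]])
    have "(\<integral>w. (g w - g z)\<^sup>2 \<partial>T z) = (\<integral>w. (g w)\<^sup>2 - 2 * g z * g w + (g z)\<^sup>2 \<partial>T z)"
      by (rule Bochner_Integration.integral_cong) (auto simp: power2_eq_square algebra_simps)
    also have "\<dots> = V z" using I[OF z] by (simp add: V_def prob_space)
    finally show ?thesis .
  qed
  have V_nonneg: "0 \<le> V z" if "z \<in> space N" for z
    unfolding V[OF that, symmetric] by simp
  have Tg01: "0 \<le> (\<integral>w. f w \<partial>T z) \<and> (\<integral>w. f w \<partial>T z) \<le> 1"
    if z: "z \<in> space N" and f: "f \<in> borel_measurable N" "\<And>z. z \<in> space N \<Longrightarrow> 0 \<le> f z \<and> f z \<le> 1" for z and f :: "'a \<Rightarrow> real"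
  proof -
    interpret prob_space "T z" by (rule prob_algebraD[OF Tz[OF z]])
    have "integrable (T z) f" by (rule integrable_prob_bounded[OF Tz[OF z] f(1), where B=1]) (use f(2) in auto)
    then show ?thesis
      using f(2) by (auto intro!: integral_nonneg_AE integral_le_const simp: prob_algebraD[OF Tz[OF z]])
  qed
  have I2: "integrable p (\<lambda>z. \<integral>w. (g w)\<^sup>2 \<partial>T z)" "integrable p (\<lambda>z. (g z)\<^sup>2)"
    using Tg01[of _ "\<lambda>w. (g w)\<^sup>2"] sq
    by (auto intro!: integrable_prob_bounded[OF p, where B=1] int_meas)
  \<comment> \<open>Subharmonicity is multiplied by the nonnegative number \<open>g z\<close>. The
    resulting upper bound integrates to zero by invariance.\<close>
  have le: "V z \<le> (\<integral>w. (g w)\<^sup>2 \<partial>T z) - (g z)\<^sup>2" if z: "z \<in> space N" for z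
    using mult_left_mono[OF sub[OF z] g01(1)[OF z]] by (simp add: V_def power2_eq_square)
  have V_meas: "V \<in> borel_measurable N"
    unfolding V_def by (intro borel_measurable_add borel_measurable_diff borel_measurable_times int_meas) auto
  have V_int: "integrable p V"
  proof (rule integrable_prob_bounded[OF p V_meas])
    fix z assume z: "z \<in> space N"
    have "(\<integral>w. (g w)\<^sup>2 \<partial>T z) \<le> 1" using Tg01[OF z, of "\<lambda>w. (g w)\<^sup>2"] sq by simp
    then show "\<bar>V z\<bar> \<le> 1" using V_nonneg[OF z] le[OF z] sq(1)[OF z] by linarith
  qed
  have "(\<integral>z. V z \<partial>p) \<le> (\<integral>z. (\<integral>w. (g w)\<^sup>2 \<partial>T z) - (g z)\<^sup>2 \<partial>p)"
    using V_int I2 le by (intro integral_mono) (auto simp: prob_algebraD[OF p])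
  also have "\<dots> = (\<integral>z. (g z)\<^sup>2 \<partial>(p \<bind> T)) - (\<integral>z. (g z)\<^sup>2 \<partial>p)"
    using I2 sq by (subst integral_bind_prob[OF p T, where B=1]) auto
  also have "\<dots> = 0" by (simp add: inv)
  finally have "(\<integral>z. V z \<partial>p) \<le> 0" .
  moreover have V_AE: "AE z in p. 0 \<le> V z" using V_nonneg by (auto simp: prob_algebraD[OF p])
  ultimately have "(\<integral>z. V z \<partial>p) = 0" using integral_nonneg_AE[of V p] by linarith
  then have "AE z in p. V z = 0" using integral_nonneg_eq_0_iff_AE[OF V_int V_AE] by simp
  then show ?thesis
    using AE_space
  proof eventually_elim
    case (elim z)
    then have z: "z \<in> space N" by (simp add: prob_algebraD[OF p])
    have "integrable (T z) (\<lambda>w. (g w - g z)\<^sup>2)"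
    proof (rule integrable_prob_bounded[OF Tz[OF z], where B=1])
      fix w assume "w \<in> space N"
      with g01[of w] g01[OF z] have "\<bar>g w - g z\<bar> \<le> 1" by auto
      then show "\<bar>(g w - g z)\<^sup>2\<bar> \<le> 1" by (simp add: abs_square_le_1)
    qed measurable
    from integral_nonneg_eq_0_iff_AE[OF this] have "AE w in T z. (g w - g z)\<^sup>2 = 0"
      using elim V[OF z] by simp
    then show ?case by eventually_elim simp
  qed
qed

section \<open>The product chain under its invariant law\<close>

locale invariant_kernel = markov_kernel +
  fixes \<mu> :: "'a measure"
  assumes invariant: "invariant_prob M K \<mu>"
begin

lemma \<mu>: "\<mu> \<in> space (prob_algebra M)"
  using invariant by (simp add: invariant_prob_def space_prob_algebra)

sublocale \<mu>: prob_space \<mu> by (rule prob_algebraD[OF \<mu>])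

lemma sets_\<mu> [simp, measurable_cong]: "sets \<mu> = sets M"
  and space_\<mu> [simp]: "space \<mu> = space M"
  by (simp_all add: prob_algebraD[OF \<mu>])

lemma \<mu>_bind_P: "\<mu> \<bind> P n = \<mu>"
proof (induction n)
  case 0
  show ?case by (rule bind_P_0[OF \<mu>])
next
  case (Suc n)
  then show ?case using bind_P_Suc[OF \<mu>, of n] invariant by (simp add: invariant_prob_def)
qed

lemma tv_P_\<mu>_lim:
  assumes x: "x \<in> space M"
  shows "(\<lambda>n. tv_dist M (P n x) \<mu>) \<longlonglongrightarrow> lim_tv (return M x) \<mu>"
  using lim_tv[OF return_in_prob_algebra[OF x] \<mu>] by (simp add: return_bind_P[OF x] \<mu>_bind_P)

sublocale \<mu>\<mu>: pair_prob_space \<mu> \<mu> ..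

lemma \<mu>\<mu>: "\<mu> \<Otimes>\<^sub>M \<mu> \<in> space (prob_algebra (M \<Otimes>\<^sub>M M))"
  by (simp add: space_prob_algebra prob_space_pair \<mu>.prob_space_axioms cong: sets_pair_measure_cong)

lemma measurable_P2: "(\<lambda>z. P n (fst z) \<Otimes>\<^sub>M P n (snd z)) \<in> M \<Otimes>\<^sub>M M \<rightarrow>\<^sub>M prob_algebra (M \<Otimes>\<^sub>M M)"
  by measurable

text \<open>A finite measure on the product is determined by rectangles, where the transition
  probabilities of independent copies factor and each factor is invariant.\<close>

lemma \<mu>\<mu>_bind: "(\<mu> \<Otimes>\<^sub>M \<mu>) \<bind> (\<lambda>z. P n (fst z) \<Otimes>\<^sub>M P n (snd z)) = \<mu> \<Otimes>\<^sub>M \<mu>"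
proof (rule pair_measure_eqI[symmetric])
  show "sigma_finite_measure \<mu>" "sigma_finite_measure \<mu>" by unfold_locales
  show "sets (\<mu> \<Otimes>\<^sub>M \<mu>) = sets ((\<mu> \<Otimes>\<^sub>M \<mu>) \<bind> (\<lambda>z. P n (fst z) \<Otimes>\<^sub>M P n (snd z)))"
    using sets_bind'[OF \<mu>\<mu> measurable_P2] prob_algebraD(2)[OF \<mu>\<mu>] by simp
  fix A B assume "A \<in> sets \<mu>" "B \<in> sets \<mu>"
  then have A: "A \<in> sets M" and B: "B \<in> sets M" by auto
  have Pm: "(\<lambda>x. emeasure (P n x) C) \<in> borel_measurable \<mu>" if "C \<in> sets M" for C
    using measurable_compose[OF measurable_prob_algebraD[OF measurable_P] measurable_emeasure_subprob_algebra[OF that]]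
    by simp
  have Pi: "(\<integral>\<^sup>+x. emeasure (P n x) C \<partial>\<mu>) = emeasure \<mu> C" if "C \<in> sets M" for C
    using emeasure_bind_prob_algebra[OF \<mu> measurable_P that, of n] by (simp add: \<mu>_bind_P)
  note Pm' = Pm[OF A, measurable] Pm[OF B, measurable]
  have "emeasure ((\<mu> \<Otimes>\<^sub>M \<mu>) \<bind> (\<lambda>z. P n (fst z) \<Otimes>\<^sub>M P n (snd z))) (A \<times> B)
      = (\<integral>\<^sup>+z. emeasure (P n (fst z) \<Otimes>\<^sub>M P n (snd z)) (A \<times> B) \<partial>(\<mu> \<Otimes>\<^sub>M \<mu>))"
    by (rule emeasure_bind_prob_algebra[OF \<mu>\<mu> measurable_P2]) (use A B in auto)
  also have "\<dots> = (\<integral>\<^sup>+z. emeasure (P n (fst z)) A * emeasure (P n (snd z)) B \<partial>(\<mu> \<Otimes>\<^sub>M \<mu>))"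
  proof (rule nn_integral_cong)
    fix z assume "z \<in> space (\<mu> \<Otimes>\<^sub>M \<mu>)"
    then have z: "fst z \<in> space M" "snd z \<in> space M" by (auto simp: space_pair_measure)
    interpret sigma_finite_measure "P n (snd z)"
      by (rule finite_measure.axioms(1)[OF prob_space.finite_measure[OF prob_algebraD(1)[OF P_prob[OF z(2)]]]])
    show "emeasure (P n (fst z) \<Otimes>\<^sub>M P n (snd z)) (A \<times> B) = emeasure (P n (fst z)) A * emeasure (P n (snd z)) B"
      using A B z by (intro emeasure_pair_measure_Times) (auto simp: prob_algebraD[OF P_prob])
  qed
  also have "\<dots> = (\<integral>\<^sup>+x. \<integral>\<^sup>+y. emeasure (P n x) A * emeasure (P n y) B \<partial>\<mu> \<partial>\<mu>)"
    by (subst \<mu>.nn_integral_fst[symmetric]) auto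
  also have "\<dots> = (\<integral>\<^sup>+x. emeasure (P n x) A * emeasure \<mu> B \<partial>\<mu>)"
    by (simp add: nn_integral_cmult Pi[OF B] Pm')
  also have "\<dots> = emeasure \<mu> A * emeasure \<mu> B"
    by (simp add: nn_integral_multc Pi[OF A] Pm')
  finally show "emeasure \<mu> A * emeasure \<mu> B
      = emeasure ((\<mu> \<Otimes>\<^sub>M \<mu>) \<bind> (\<lambda>z. P n (fst z) \<Otimes>\<^sub>M P n (snd z))) (A \<times> B)" ..
qed

text \<open>Subharmonicity holds for the \<open>n\<close>-step product kernel directly, so each
  \<open>n\<close> is treated without iterating single steps, and the countably many exceptional
  sets are united.\<close>

lemma h_const:
  "AE z in \<mu> \<Otimes>\<^sub>M \<mu>. \<forall>n. AE u in P n (fst z). AE v in P n (snd z). h u v = h (fst z) (snd z)"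
  unfolding AE_all_countable
proof
  fix n
  let ?T = "\<lambda>z. P n (fst z) \<Otimes>\<^sub>M P n (snd z)" and ?h = "\<lambda>z. h (fst z) (snd z)"
  have h: "?h \<in> borel_measurable (M \<Otimes>\<^sub>M M)" using measurable_h by (simp add: split_beta')
  have "AE z in \<mu> \<Otimes>\<^sub>M \<mu>. AE w in ?T z. ?h w = ?h z"
  proof (rule subharmonic_invariant_const[OF \<mu>\<mu> measurable_P2 \<mu>\<mu>_bind h])
    fix z assume "z \<in> space (M \<Otimes>\<^sub>M M)"
    then have z: "fst z \<in> space M" "snd z \<in> space M" by (auto simp: space_pair_measure)
    show "0 \<le> ?h z" "?h z \<le> 1" using z by (auto simp: h_nonneg h_le_1)
    let ?p = "P n (fst z)" and ?q = "P n (snd z)"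
    note p = P_prob[OF z(1), of n] and q = P_prob[OF z(2), of n]
    interpret p: prob_space ?p by (rule prob_algebraD[OF p])
    interpret q: prob_space ?q by (rule prob_algebraD[OF q])
    interpret pq: pair_prob_space ?p ?q ..
    have pq: "?T z \<in> space (prob_algebra (M \<Otimes>\<^sub>M M))"
      using measurable_space[OF measurable_P2] z by (auto simp: space_pair_measure)
    have "?h z \<le> (\<integral>u. \<integral>v. h u v \<partial>?q \<partial>?p)"
      using lim_tv_le_integral_h[OF p q] h_eq_lim_tv_P[OF z, of n] by simp
    also have "\<dots> = (\<integral>w. ?h w \<partial>?T z)"
      using pq.integral_fst'[of ?h] integrable_prob_bounded[OF pq h, of 1]
      by (auto simp: space_pair_measure h_nonneg h_le_1)
    finally show "?h z \<le> (\<integral>w. ?h w \<partial>?T z)" .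
  qed
  then show "AE z in \<mu> \<Otimes>\<^sub>M \<mu>. AE u in P n (fst z). AE v in P n (snd z). h u v = ?h z"
    using AE_space
  proof eventually_elim
    case (elim z)
    then have z: "fst z \<in> space M" "snd z \<in> space M" by (auto simp: space_pair_measure)
    interpret p: prob_space "P n (fst z)" by (rule prob_algebraD[OF P_prob[OF z(1)]])
    interpret q: prob_space "P n (snd z)" by (rule prob_algebraD[OF P_prob[OF z(2)]])
    interpret pair_prob_space "P n (fst z)" "P n (snd z)" ..
    show ?case using AE_pair[OF elim(1)] by simp
  qed
qed

lemma h_zero_one: "AE z in \<mu> \<Otimes>\<^sub>M \<mu>. h (fst z) (snd z) = 0 \<or> h (fst z) (snd z) = 1"
  using h_const AE_space
proof eventually_elim
  case (elim z)
  then have z: "fst z \<in> space M" "snd z \<in> space M" by (auto simp: space_pair_measure)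
  let ?c = "h (fst z) (snd z)"
  have "?c \<le> tv_dist M (P n (fst z)) (P n (snd z)) * ?c" for n
    using lim_tv_const_mult[OF P_prob[OF z(1)] P_prob[OF z(2)]] elim(1) h_eq_lim_tv_P[OF z] by metis
  moreover have "(\<lambda>n. tv_dist M (P n (fst z)) (P n (snd z)) * ?c) \<longlonglongrightarrow> ?c * ?c"
    by (intro tendsto_mult h_lim z tendsto_const)
  ultimately have "?c \<le> ?c * ?c" by (intro LIMSEQ_le_const) auto
  moreover have "0 \<le> ?c" "?c \<le> 1" using z by (auto simp: h_nonneg h_le_1)
  ultimately show ?case using mult_right_le_one_le[of ?c ?c]
    by (metis antisym mult_cancel_left1)
qed

lemma lim_tv_\<mu>_le:
  assumes x: "x \<in> space M"
  shows "lim_tv (return M x) \<mu> \<le> (\<integral>y. h x y \<partial>\<mu>)"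
proof -
  have "(\<lambda>x. \<integral>y. h x y \<partial>\<mu>) \<in> borel_measurable M" by measurable
  then have "(\<integral>x. \<integral>y. h x y \<partial>\<mu> \<partial>return M x) = (\<integral>y. h x y \<partial>\<mu>)" by (rule integral_return[OF x])
  then show ?thesis using lim_tv_le_integral_h[OF return_in_prob_algebra[OF x] \<mu>] by simp
qed

section \<open>Convergence to the invariant law and non-singularity\<close>

lemma convergence_AE:
  assumes "AE z in \<mu> \<Otimes>\<^sub>M \<mu>. h (fst z) (snd z) = 0"
  shows "AE x in \<mu>. (\<lambda>n. tv_dist M (P n x) \<mu>) \<longlonglongrightarrow> 0"
  using \<mu>\<mu>.AE_pair[OF assms] AE_space
proof eventually_elim
  case (elim x)
  then have x: "x \<in> space M" by simp
  have "(\<integral>y. h x y \<partial>\<mu>) = (\<integral>y. 0 \<partial>\<mu>)"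
    using elim(1) x by (intro integral_cong_AE) auto
  then have "lim_tv (return M x) \<mu> = 0"
    using lim_tv_\<mu>_le[OF x] lim_tv_nonneg[OF return_in_prob_algebra[OF x] \<mu>] by simp
  then show ?case using tv_P_\<mu>_lim[OF x] by simp
qed

lemma A2_h_less_1:
  assumes A2: "cond_A2 M K" and x: "x \<in> space M" and y: "y \<in> space M"
  shows "h x y < 1"
proof -
  obtain n where "non_singular M (P n x) (P n y)" using A2 x y by (auto simp: cond_A2_def)
  then show ?thesis
    using h_le[OF x y, of n] by (simp add: non_singular_iff_tv_dist P_prob x y)
qed

lemma A2_h_eq_0:
  assumes A2: "cond_A2 M K"
  shows "AE z in \<mu> \<Otimes>\<^sub>M \<mu>. h (fst z) (snd z) = 0"
  using h_zero_one AE_space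
proof eventually_elim
  case (elim z)
  then show ?case using A2_h_less_1[OF A2, of "fst z" "snd z"] by (auto simp: space_pair_measure)
qed

text \<open>At an arbitrary starting point only \<open>h x y < 1\<close> is available, but a strict
  pointwise inequality stays strict after integration over the probability measure \<mu>.\<close>

lemma A2_imp_P2:
  assumes A2: "cond_A2 M K"
  shows "cond_P2 M K \<mu>"
  unfolding cond_P2_def
proof (intro conjI ballI)
  show "AE x in \<mu>. (\<lambda>n. tv_dist M (P n x) \<mu>) \<longlonglongrightarrow> 0"
    by (rule convergence_AE[OF A2_h_eq_0[OF A2]])
  fix x assume x: "x \<in> space M"
  have "lim_tv (return M x) \<mu> \<le> (\<integral>y. h x y \<partial>\<mu>)" by (rule lim_tv_\<mu>_le[OF x])
  also have "\<dots> < (\<integral>y. 1 \<partial>\<mu>)"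
  proof (rule \<mu>.integral_less_AE_space)
    show "integrable \<mu> (h x)"
      using x by (intro integrable_prob_bounded[OF \<mu>, where B=1]) (auto simp: h_nonneg h_le_1)
    show "AE y in \<mu>. h x y < 1" using A2_h_less_1[OF A2 x] by (intro AE_I2) simp
  qed (simp_all add: \<mu>.emeasure_space_1[simplified])
  finally show "\<exists>l<1. (\<lambda>n. tv_dist M (P n x) \<mu>) \<longlonglongrightarrow> l"
    using tv_P_\<mu>_lim[OF x] by (auto simp: \<mu>.prob_space[simplified])
qed

text \<open>A set carrying all of \<open>p\<close> cannot be \<mu>-null, for then the distance would
  be one. So it meets every set of full \<mu>-measure.\<close>

lemma non_singular_meets_AE:
  assumes p: "p \<in> space (prob_algebra M)" and tv: "tv_dist M p \<mu> < 1"
    and Q: "AE u in \<mu>. Q u" and E: "AE u in p. u \<in> E" "E \<in> sets M"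
  obtains u where "u \<in> E" "Q u"
proof (rule ccontr)
  assume "\<not> thesis"
  then have "\<And>u. u \<in> E \<Longrightarrow> \<not> Q u" using that by blast
  with Q have "AE u in \<mu>. u \<notin> E" by (auto elim!: eventually_mono)
  then have "measure \<mu> E = 0" using E(2) by (simp add: \<mu>.prob_eq_0)
  moreover have "measure p E = 1"
    using E by (simp add: prob_space.prob_eq_1[OF prob_algebraD(1)[OF p]] prob_algebraD(2)[OF p])
  ultimately show False using tv_dist_upper[OF p \<mu> E(2)] tv by simp
qed

text \<open>Chapman-Kolmogorov with a nonnegative integrand of mean zero.\<close>

lemma measure_P_add_eq_0:
  assumes x: "x \<in> space M" and A: "A \<in> sets M" and 0: "measure (P (m + n) x) A = 0"
  shows "AE u in P m x. measure (P n u) A = 0"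
proof -
  have "(\<integral>u. measure (P n u) A \<partial>P m x) = 0"
    using measure_bind_prob[OF P_prob[OF x] measurable_P A, of m n] 0 by (simp add: P_add[OF x])
  moreover have "integrable (P m x) (\<lambda>u. measure (P n u) A)"
    by (rule integrable_prob_bounded[OF P_prob[OF x] measurable_measure_kernel[OF measurable_P A], where B=1])
       (auto intro: measure_prob_le_1 P_prob)
  ultimately show ?thesis
    using integral_nonneg_eq_0_iff_AE[of "P m x" "\<lambda>u. measure (P n u) A"] by simp
qed

text \<open>As \<open>p\<close> is not singular to \<open>\<mu>\<close>, some point outside all exceptional sets converges to \<open>\<mu>\<close>.\<close>

lemma limit_zero_of_AE_zero:
  assumes conv: "AE u in \<mu>. (\<lambda>n. tv_dist M (P n u) \<mu>) \<longlonglongrightarrow> 0"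
    and p: "p \<in> space (prob_algebra M)" and tv: "tv_dist M p \<mu> < 1"
    and A: "\<And>m. A m \<in> sets M" and 0: "\<And>m. AE u in p. measure (P m u) (A m) = 0"
  shows "(\<lambda>m. measure \<mu> (A m)) \<longlonglongrightarrow> 0"
proof -
  let ?E = "{u \<in> space M. \<forall>m. measure (P m u) (A m) = 0}"
  have [measurable]: "(\<lambda>u. measure (P m u) (A m)) \<in> borel_measurable M" for m
    by (rule measurable_measure_kernel[OF measurable_P A])
  have E: "?E \<in> sets M" by measurable
  have "AE u in p. \<forall>m. measure (P m u) (A m) = 0" using 0 by (simp add: AE_all_countable)
  then have "AE u in p. u \<in> ?E"
    using AE_space by eventually_elim (auto simp: prob_algebraD[OF p])
  then obtain u where u: "u \<in> ?E" "(\<lambda>n. tv_dist M (P n u) \<mu>) \<longlonglongrightarrow> 0"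
    using non_singular_meets_AE[OF p tv conv _ E] by blast
  show ?thesis
  proof (rule tendsto_sandwich[OF _ _ tendsto_const u(2)])
    have "measure \<mu> (A m) \<le> tv_dist M (P m u) \<mu>" for m
      using tv_dist_upper[OF P_prob \<mu> A, of u m m] u(1) by simp
    then show "\<forall>\<^sub>F m in sequentially. measure \<mu> (A m) \<le> tv_dist M (P m u) \<mu>" by simp
  qed simp
qed

lemma P2_overlap:
  assumes P2: "cond_P2 M K \<mu>" and x: "x \<in> space M"
  obtains n where "\<And>m. n \<le> m \<Longrightarrow> tv_dist M (P m x) \<mu> < 1"
proof -
  obtain l where "l < 1" "(\<lambda>n. tv_dist M (P n x) \<mu>) \<longlonglongrightarrow> l" using P2 x by (auto simp: cond_P2_def)
  then have "\<forall>\<^sub>F n in sequentially. tv_dist M (P n x) \<mu> < 1" by (intro order_tendstoD(2))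
  then show thesis using that by (auto simp: eventually_sequentially)
qed

text \<open>Permanent singularity would give separating sets \<open>A m\<close> for the times
  \<open>n + m\<close>. A typical point reached from \<open>x\<close> converges to \<mu> and never
  sees them, which drives their \<mu>-measure to zero; a typical point reached from \<open>y\<close>
  does the same for the complements. But the two measures add up to one.\<close>

lemma P2_imp_A2:
  assumes P2: "cond_P2 M K \<mu>"
  shows "cond_A2 M K"
  unfolding cond_A2_def
proof (intro ballI, rule ccontr)
  fix x y assume x: "x \<in> space M" and y: "y \<in> space M"
    and "\<not> (\<exists>n\<ge>1. non_singular M (P n x) (P n y))"
  then have sing: "\<And>n. 1 \<le> n \<Longrightarrow> \<exists>A\<in>sets M. measure (P n x) A = 0 \<and> measure (P n y) (space M - A) = 0"
    by (fastforce simp: non_singular_def measure_def)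
  have conv: "AE u in \<mu>. (\<lambda>n. tv_dist M (P n u) \<mu>) \<longlonglongrightarrow> 0" using P2 by (simp add: cond_P2_def)
  obtain n1 n2 where "\<And>m. n1 \<le> m \<Longrightarrow> tv_dist M (P m x) \<mu> < 1" "\<And>m. n2 \<le> m \<Longrightarrow> tv_dist M (P m y) \<mu> < 1"
    using P2_overlap[OF P2 x] P2_overlap[OF P2 y] by metis
  then obtain n where n: "1 \<le> n" "tv_dist M (P n x) \<mu> < 1" "tv_dist M (P n y) \<mu> < 1"
    using that[of "max 1 (max n1 n2)"] by simp
  have "\<exists>A. \<forall>m. A m \<in> sets M \<and> measure (P (n + m) x) (A m) = 0 \<and> measure (P (n + m) y) (space M - A m) = 0"
    by (rule choice) (use sing n(1) in \<open>auto simp: Bex_def\<close>)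
  then obtain A where A: "\<And>m. A m \<in> sets M" "\<And>m. measure (P (n + m) x) (A m) = 0"
    "\<And>m. measure (P (n + m) y) (space M - A m) = 0" by blast
  have "(\<lambda>m. measure \<mu> (A m)) \<longlonglongrightarrow> 0"
    by (rule limit_zero_of_AE_zero[OF conv P_prob[OF x] n(2) A(1)]) (rule measure_P_add_eq_0[OF x A(1) A(2)])
  moreover have "(\<lambda>m. measure \<mu> (space M - A m)) \<longlonglongrightarrow> 0"
    by (rule limit_zero_of_AE_zero[OF conv P_prob[OF y] n(3)])
       (use A(1) in \<open>auto intro: measure_P_add_eq_0[OF y _ A(3)]\<close>)
  ultimately have "(\<lambda>m. measure \<mu> (A m) + measure \<mu> (space M - A m)) \<longlonglongrightarrow> 0 + 0" by (rule tendsto_add)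
  moreover have "measure \<mu> (A m) + measure \<mu> (space M - A m) = 1" for m
    using \<mu>.prob_compl[of "A m"] A(1) by simp
  ultimately show False using LIMSEQ_unique[OF tendsto_const[of "1::real"]] by fastforce
qed

end

section \<open>The law of the chain\<close>

definition path_shift :: "nat \<Rightarrow> (nat \<Rightarrow> 'a) \<Rightarrow> nat \<Rightarrow> 'a" where "path_shift n \<omega> = (\<lambda>i. \<omega> (i + n))"

lemma measurable_shift [measurable]: "path_shift n \<in> path_space N \<rightarrow>\<^sub>M path_space N"
  unfolding path_shift_def by (intro measurable_abs_UNIV measurable_component_singleton) simp

lemma vimage_Int_eq_Collect: "(\<And>x. x \<in> S \<Longrightarrow> f x \<in> E \<longleftrightarrow> Q x) \<Longrightarrow> f -` E \<inter> S = {x \<in> S. Q x}"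
  by auto

lemma shift_shift: "path_shift m (path_shift n \<omega>) = path_shift (m + n) \<omega>"
  by (simp add: path_shift_def add.assoc)

lemma shift_0 [simp]: "path_shift 0 = (\<lambda>\<omega>. \<omega>)"
  by (simp add: path_shift_def[abs_def])

context markov_kernel
begin

text \<open>The probability that the first \<open>n + 1\<close> states lie in \<open>A 0, \<dots>, A n\<close>, weighted by \<open>g\<close> at
  the last of them; the recursion splits off the first step.\<close>

primrec path_weight :: "nat \<Rightarrow> (nat \<Rightarrow> 'a set) \<Rightarrow> ('a \<Rightarrow> ennreal) \<Rightarrow> 'a \<Rightarrow> ennreal" where
  "path_weight 0 A g x = indicator (A 0) x * g x"
| "path_weight (Suc n) A g x = indicator (A 0) x * (\<integral>\<^sup>+y. path_weight n (\<lambda>i. A (Suc i)) g y \<partial>K x)"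

lemma measurable_nn_integral_kernel:
  "g \<in> borel_measurable M \<Longrightarrow> (\<lambda>x. \<integral>\<^sup>+y. g y \<partial>K x) \<in> borel_measurable M"
  using measurable_compose[OF measurable_prob_algebraD[OF kernel] nn_integral_measurable_subprob_algebra] .

lemma measurable_path_weight:
  "(\<And>i. A i \<in> sets M) \<Longrightarrow> g \<in> borel_measurable M \<Longrightarrow> path_weight n A g \<in> borel_measurable M"
proof (induction n arbitrary: A)
  case 0
  then show ?case by (simp add: path_weight.simps(1)[abs_def])
next
  case (Suc n)
  have "path_weight n (\<lambda>i. A (Suc i)) g \<in> borel_measurable M"
    using Suc.prems by (intro Suc.IH) auto
  then show ?case
    unfolding path_weight.simps(2)[abs_def]
    using Suc.prems by (intro borel_measurable_times_ennreal measurable_nn_integral_kernel) auto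
qed

text \<open>\<open>path_weight\<close> is built from the front, whereas the Ionescu-Tulcea
  construction extends a path at its end. This identity mediates by absorbing the last step into the
  weight function.\<close>

lemma path_weight_last:
  assumes "x \<in> space M"
  shows "path_weight (Suc n) A g x = path_weight n A (\<lambda>y. \<integral>\<^sup>+z. indicator (A (Suc n)) z * g z \<partial>K y) x"
  using assms
proof (induction n arbitrary: A x)
  case (Suc n)
  have "path_weight (Suc (Suc n)) A g x
      = indicator (A 0) x * (\<integral>\<^sup>+y. path_weight (Suc n) (\<lambda>i. A (Suc i)) g y \<partial>K x)"
    by (rule path_weight.simps(2))
  also have "\<dots> = indicator (A 0) x *
      (\<integral>\<^sup>+y. path_weight n (\<lambda>i. A (Suc i)) (\<lambda>y. \<integral>\<^sup>+z. indicator (A (Suc (Suc n))) z * g z \<partial>K y) y \<partial>K x)"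
    using prob_algebraD(3)[OF measurable_space[OF kernel Suc.prems]]
    by (intro arg_cong2[where f="(*)"] refl nn_integral_cong Suc.IH) simp
  also have "\<dots> = path_weight (Suc n) A (\<lambda>y. \<integral>\<^sup>+z. indicator (A (Suc (Suc n))) z * g z \<partial>K y) x"
    by (rule path_weight.simps(2)[symmetric])
  finally show ?case .
qed simp

lemma chain_law_cylinder:
  assumes x: "x \<in> space M" and A: "\<And>i. A i \<in> sets M"
  shows "emeasure (chain_law M K x) {\<omega> \<in> space (path_space M). \<forall>i\<le>n. \<omega> i \<in> A i} = path_weight n A (\<lambda>_. 1) x"
proof -
  interpret IT: Ionescu_Tulcea "chain_step M K x" "\<lambda>_. M"
    by (rule Ionescu_Tulcea_chain_step[OF kernel x])
  \<comment> \<open>\<open>C n\<close> is the law of the states at times below \<open>n\<close>, so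
    a cylinder involving times up to \<open>n\<close> lives on \<open>C (Suc n)\<close>.\<close>
  define C where "C n = IT.C 0 n (\<lambda>_. undefined)" for n
  have und: "(\<lambda>_. undefined) \<in> space (Pi\<^sub>M {0..<0::nat} (\<lambda>_. M))" by (simp add: space_PiM)
  have sets_C: "sets (C n) = sets (Pi\<^sub>M {0..<n} (\<lambda>_. M))" for n
    using IT.sets_C[OF und, of n] by (simp add: C_def)
  have space_C: "space (C n) = space (Pi\<^sub>M {0..<n} (\<lambda>_. M))" for n
    by (rule sets_eq_imp_space_eq[OF sets_C])
  have C_Suc: "(\<integral>\<^sup>+\<omega>. H \<omega> \<partial>C (Suc n)) = (\<integral>\<^sup>+\<omega>. \<integral>\<^sup>+z. H (fun_upd \<omega> n z) \<partial>chain_step M K x n \<omega> \<partial>C n)"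
    if H: "H \<in> borel_measurable (Pi\<^sub>M {0..<Suc n} (\<lambda>_. M))" for n H
  proof -
    have "(\<integral>\<^sup>+\<omega>. H \<omega> \<partial>C (Suc n)) = (\<integral>\<^sup>+\<omega>. \<integral>\<^sup>+\<omega>'. H \<omega>' \<partial>IT.eP n \<omega> \<partial>C n)"
      unfolding C_def IT.C.simps add_0
      using IT.measurable_eP[of n] sets_C[of n, unfolded C_def]
      by (intro nn_integral_bind[OF H]) (simp cong: measurable_cong_sets)
    also have "\<dots> = (\<integral>\<^sup>+\<omega>. \<integral>\<^sup>+z. H (fun_upd \<omega> n z) \<partial>chain_step M K x n \<omega> \<partial>C n)"
      by (intro nn_integral_cong IT.nn_integral_eP H) (simp add: space_C)
    finally show ?thesis .
  qed
  have C0: "C 0 = return (Pi\<^sub>M {0..<0} (\<lambda>_. M)) (\<lambda>_. undefined)" by (simp add: C_def)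
  \<comment> \<open>The weight \<open>g\<close> stays arbitrary because the induction step replaces
    it by its one-step mean restricted to \<open>A (Suc n)\<close>.\<close>
  have weight: "(\<integral>\<^sup>+\<omega>. (\<Prod>i\<le>n. indicator (A i) (\<omega> i)) * g (\<omega> n) \<partial>C (Suc n)) = path_weight n A g x"
    if g: "g \<in> borel_measurable M" for g :: "'a \<Rightarrow> ennreal" and n
    using g
  proof (induction n arbitrary: g)
    case 0
    have meas: "(\<lambda>\<omega>. (\<Prod>i\<le>0. indicator (A i) (\<omega> i)) * g (\<omega> 0)) \<in> borel_measurable (Pi\<^sub>M {0..<Suc 0} (\<lambda>_. M))"
      using 0 A by measurable
    have "(\<integral>\<^sup>+\<omega>. (\<Prod>i\<le>0. indicator (A i) (\<omega> i)) * g (\<omega> 0) \<partial>C (Suc 0))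
        = (\<integral>\<^sup>+\<omega>. indicator (A 0) x * g x \<partial>C 0)"
      unfolding C_Suc[OF meas] using 0 A x
      by (intro nn_integral_cong) (simp add: chain_step_def nn_integral_return)
    also have "\<dots> = indicator (A 0) x * g x"
      unfolding C0 using und by (subst nn_integral_return) auto
    finally show ?case by simp
  next
    case (Suc n)
    note [measurable] = Suc.prems A
    have meas: "(\<lambda>\<omega>. (\<Prod>i\<le>Suc n. indicator (A i) (\<omega> i)) * g (\<omega> (Suc n))) \<in> borel_measurable (Pi\<^sub>M {0..<Suc (Suc n)} (\<lambda>_. M))"
      by (intro borel_measurable_times_ennreal borel_measurable_prod_ennreal measurable_compose[OF _ Suc.prems]
            measurable_compose[OF _ borel_measurable_indicator[OF A]] measurable_component_singleton) auto
    have "(\<integral>\<^sup>+\<omega>. (\<Prod>i\<le>Suc n. indicator (A i) (\<omega> i)) * g (\<omega> (Suc n)) \<partial>C (Suc (Suc n)))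
        = (\<integral>\<^sup>+\<omega>. (\<Prod>i\<le>n. indicator (A i) (\<omega> i)) * (\<integral>\<^sup>+z. indicator (A (Suc n)) z * g z \<partial>K (\<omega> n)) \<partial>C (Suc n))"
      unfolding C_Suc[OF meas]
    proof (intro nn_integral_cong)
      fix \<omega> assume "\<omega> \<in> space (C (Suc n))"
      then have "\<omega> n \<in> space M" by (auto simp: space_C space_PiM)
      then have K: "K (\<omega> n) \<in> space (prob_algebra M)" by (rule measurable_space[OF kernel])
      have "(\<integral>\<^sup>+z. (\<Prod>i\<le>Suc n. indicator (A i) ((fun_upd \<omega> (Suc n) z) i)) * g ((fun_upd \<omega> (Suc n) z) (Suc n)) \<partial>chain_step M K x (Suc n) \<omega>)
          = (\<integral>\<^sup>+z. (\<Prod>i\<le>n. indicator (A i) (\<omega> i)) * (indicator (A (Suc n)) z * g z) \<partial>K (\<omega> n))"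
        by (simp add: chain_step_def mult.assoc)
      also have "\<dots> = (\<Prod>i\<le>n. indicator (A i) (\<omega> i)) * (\<integral>\<^sup>+z. indicator (A (Suc n)) z * g z \<partial>K (\<omega> n))"
        by (rule nn_integral_cmult) (simp add: measurable_prob_algebra_cong[OF K])
      finally show "(\<integral>\<^sup>+z. (\<Prod>i\<le>Suc n. indicator (A i) ((fun_upd \<omega> (Suc n) z) i)) * g ((fun_upd \<omega> (Suc n) z) (Suc n)) \<partial>chain_step M K x (Suc n) \<omega>)
          = (\<Prod>i\<le>n. indicator (A i) (\<omega> i)) * (\<integral>\<^sup>+z. indicator (A (Suc n)) z * g z \<partial>K (\<omega> n))" .
    qed
    also have "\<dots> = path_weight n A (\<lambda>y. \<integral>\<^sup>+z. indicator (A (Suc n)) z * g z \<partial>K y) x"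
      by (rule Suc.IH) (intro measurable_nn_integral_kernel borel_measurable_times_ennreal, auto)
    also have "\<dots> = path_weight (Suc n) A g x" by (rule path_weight_last[OF x, symmetric])
    finally show ?case .
  qed
  let ?J = "{0..<Suc n}"
  let ?E = "Pi\<^sub>E ?J A"
  have AM: "A i \<subseteq> space M" for i using sets.sets_into_space[OF A] .
  have E: "?E \<in> sets (Pi\<^sub>M ?J (\<lambda>_. M))" using A by (intro sets_PiM_I_finite) auto
  have "{\<omega> \<in> space (path_space M). \<forall>i\<le>n. \<omega> i \<in> A i} = prod_emb UNIV (\<lambda>_. M) ?J ?E"
    by (auto simp: prod_emb_def space_PiM PiE_iff less_Suc_eq_le)
  then have "emeasure (chain_law M K x) {\<omega> \<in> space (path_space M). \<forall>i\<le>n. \<omega> i \<in> A i} = emeasure (IT.CI ?J) ?E"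
    using IT.lim[OF _ E] by (simp add: chain_law_def)
  also have "\<dots> = emeasure (C (Suc n)) ?E"
    using IT.emeasure_CI[OF subset_refl E] AM prod_emb_id[of ?E ?J "\<lambda>_. M"]
    by (simp add: C_def PiE_mono)
  also have "\<dots> = (\<integral>\<^sup>+\<omega>. indicator ?E \<omega> \<partial>C (Suc n))"
    using E by (simp add: sets_C)
  also have "\<dots> = (\<integral>\<^sup>+\<omega>. (\<Prod>i\<le>n. indicator (A i) (\<omega> i)) * 1 \<partial>C (Suc n))"
  proof (rule nn_integral_cong)
    fix \<omega> assume "\<omega> \<in> space (C (Suc n))"
    then have "\<omega> \<in> ?E \<longleftrightarrow> (\<forall>i\<le>n. \<omega> i \<in> A i)"
      by (auto simp: space_C space_PiM PiE_iff less_Suc_eq_le)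
    moreover have "(\<Prod>i\<le>n. indicator (A i) (\<omega> i) :: ennreal) = (if \<forall>i\<le>n. \<omega> i \<in> A i then 1 else 0)"
      by (auto simp: prod_zero_iff indicator_def)
    ultimately show "indicator ?E \<omega> = (\<Prod>i\<le>n. indicator (A i) (\<omega> i)) * (1::ennreal)"
      by (simp add: indicator_def)
  qed
  also have "\<dots> = path_weight n A (\<lambda>_. 1) x" by (rule weight) simp
  finally show ?thesis .
qed

lemma sets_chain_law [measurable_cong]: "x \<in> space M \<Longrightarrow> sets (chain_law M K x) = sets (path_space M)"
  and prob_space_chain_law: "x \<in> space M \<Longrightarrow> prob_space (chain_law M K x)"
proof -
  assume x: "x \<in> space M"
  interpret IT: Ionescu_Tulcea "chain_step M K x" "\<lambda>_. M"
    by (rule Ionescu_Tulcea_chain_step[OF kernel x])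
  show sets: "sets (chain_law M K x) = sets (path_space M)" by (simp add: chain_law_def)
  have "emeasure (chain_law M K x) {\<omega> \<in> space (path_space M). \<forall>i\<le>0. \<omega> i \<in> space M} = 1"
    using chain_law_cylinder[OF x, of "\<lambda>_. space M" 0] x by simp
  moreover have "{\<omega> \<in> space (path_space M). \<forall>i\<le>0. \<omega> i \<in> space M} = space (chain_law M K x)"
    using sets_eq_imp_space_eq[OF sets] by (auto simp: space_PiM)
  ultimately show "prob_space (chain_law M K x)" by (intro prob_spaceI) simp
qed

lemma chain_law_prob: "x \<in> space M \<Longrightarrow> chain_law M K x \<in> space (prob_algebra (path_space M))"
  by (simp add: space_prob_algebra sets_chain_law prob_space_chain_law)

lemma prod_emb_eq_cylinder:
  fixes J :: "nat set"
  assumes "finite J" "\<And>i. i \<in> J \<Longrightarrow> X i \<in> sets M"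
  shows "\<exists>n A. (\<forall>i. A i \<in> sets M) \<and>
    prod_emb UNIV (\<lambda>_. M) J (Pi\<^sub>E J X) = {\<omega> \<in> space (path_space M). \<forall>i\<le>n. \<omega> i \<in> A i}"
proof -
  define A where "A i = (if i \<in> J then X i else space M)" for i
  obtain n where n: "\<And>i. i \<in> J \<Longrightarrow> i \<le> n" using assms(1) by (meson finite_nat_set_iff_bounded_le)
  show ?thesis
  proof (intro exI conjI allI)
    show "A i \<in> sets M" for i using assms(2) by (simp add: A_def)
    show "prod_emb UNIV (\<lambda>_. M) J (Pi\<^sub>E J X) = {\<omega> \<in> space (path_space M). \<forall>i\<le>n. \<omega> i \<in> A i}"
      using n by (auto simp: A_def prod_emb_def space_PiM PiE_iff)
  qed
qed

text \<open>Finite-dimensional cylinders form an intersection-stable generator, so it suffices that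
  their probabilities depend measurably on the starting point.\<close>

lemma measurable_chain_law: "chain_law M K \<in> M \<rightarrow>\<^sub>M prob_algebra (path_space M)"
proof (rule measurable_prob_algebra_generated[OF sets_PiM Int_stable_prod_algebra prod_algebra_sets_into_space])
  fix A assume "A \<in> prod_algebra (UNIV :: nat set) (\<lambda>_. M)"
  then obtain J X where A: "A = prod_emb UNIV (\<lambda>_. M) J (Pi\<^sub>E J X)" "finite J" "\<And>i::nat. i \<in> J \<Longrightarrow> X i \<in> sets M"
    by (rule prod_algebraE) (rule that)
  obtain n B where B: "\<And>i. B i \<in> sets M" "A = {\<omega> \<in> space (path_space M). \<forall>i\<le>n. \<omega> i \<in> B i}"
    using prod_emb_eq_cylinder[OF A(2), of X] A(1,3) by auto
  have "(\<lambda>x. emeasure (chain_law M K x) A) \<in> borel_measurable M \<longleftrightarrow> path_weight n B (\<lambda>_. 1) \<in> borel_measurable M"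
    unfolding B(2) by (rule measurable_cong) (rule chain_law_cylinder[OF _ B(1)])
  then show "(\<lambda>x. emeasure (chain_law M K x) A) \<in> borel_measurable M"
    using measurable_path_weight[OF B(1)] by simp
qed (simp_all add: sets_chain_law prob_space_chain_law)

lemma chain_law_shift_1:
  assumes x: "x \<in> space M"
  shows "distr (chain_law M K x) (path_space M) (path_shift 1) = K x \<bind> chain_law M K"
proof (rule measure_eqI_PiM_infinite)
  note [measurable_cong] = sets_chain_law[OF x]
  have Kx: "K x \<in> space (prob_algebra M)" by (rule measurable_space[OF kernel x])
  show "sets (distr (chain_law M K x) (path_space M) (path_shift 1)) = sets (path_space M)" by simp
  show "sets (K x \<bind> chain_law M K) = sets (path_space M)"
    by (rule sets_bind'[OF Kx measurable_chain_law])
  show "finite_measure (distr (chain_law M K x) (path_space M) (path_shift 1))"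
    using prob_space_chain_law[OF x]
    by (intro prob_space.finite_measure prob_space.prob_space_distr) simp_all
  fix X :: "nat \<Rightarrow> 'a set" and J :: "nat set" assume J: "finite J" "\<And>i. i \<in> J \<Longrightarrow> X i \<in> sets M"
  obtain n A where A: "\<And>i. A i \<in> sets M"
    "prod_emb UNIV (\<lambda>_. M) J (Pi\<^sub>E J X) = {\<omega> \<in> space (path_space M). \<forall>i\<le>(n::nat). \<omega> i \<in> A i}"
    using prod_emb_eq_cylinder[OF J(1), of X] J(2) by auto
  \<comment> \<open>Prepending the whole space leaves the initial state free, so the preimage of a
    cylinder under the shift is a cylinder with one more coordinate.\<close>
  let ?E = "{\<omega> \<in> space (path_space M). \<forall>i\<le>n. \<omega> i \<in> A i}" and ?A = "case_nat (space M) A"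
  have E: "?E \<in> sets (path_space M)" using A(1) by measurable
  have A': "?A i \<in> sets M" for i using A(1) by (cases i) auto
  have "path_shift 1 \<omega> \<in> ?E \<longleftrightarrow> (\<forall>i\<le>Suc n. \<omega> i \<in> ?A i)" if \<omega>: "\<omega> \<in> space (path_space M)" for \<omega>
  proof -
    have Q: "(\<forall>i\<le>Suc n. Q i) \<longleftrightarrow> Q 0 \<and> (\<forall>i\<le>n. Q (Suc i))" for Q
      by (metis Suc_le_mono not0_implies_Suc zero_le)
    have "\<omega> i \<in> space M" for i using \<omega> by (simp add: space_PiM PiE_iff)
    then show ?thesis
      unfolding Q[of "\<lambda>i. \<omega> i \<in> ?A i"] by (simp add: path_shift_def space_PiM PiE_iff)
  qed
  then have vim: "path_shift 1 -` ?E \<inter> space (path_space M) = {\<omega> \<in> space (path_space M). \<forall>i\<le>Suc n. \<omega> i \<in> ?A i}"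
    by (rule vimage_Int_eq_Collect)
  have "emeasure (distr (chain_law M K x) (path_space M) (path_shift 1)) ?E
      = emeasure (chain_law M K x) (path_shift 1 -` ?E \<inter> space (chain_law M K x))"
    by (rule emeasure_distr[OF _ E]) measurable
  also have "\<dots> = path_weight (Suc n) ?A (\<lambda>_. 1) x"
    unfolding sets_eq_imp_space_eq[OF sets_chain_law[OF x]] vim
    by (rule chain_law_cylinder[OF x A'])
  also have "\<dots> = (\<integral>\<^sup>+y. path_weight n A (\<lambda>_. 1) y \<partial>K x)" using x by simp
  also have "\<dots> = (\<integral>\<^sup>+y. emeasure (chain_law M K y) ?E \<partial>K x)"
    by (intro nn_integral_cong chain_law_cylinder[symmetric] A) (simp add: prob_algebraD[OF Kx])
  also have "\<dots> = emeasure (K x \<bind> chain_law M K) ?E"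
    by (rule emeasure_bind_prob_algebra[OF Kx measurable_chain_law E, symmetric])
  finally show "emeasure (distr (chain_law M K x) (path_space M) (path_shift 1)) (prod_emb UNIV (\<lambda>_. M) J (Pi\<^sub>E J X))
      = emeasure (K x \<bind> chain_law M K) (prod_emb UNIV (\<lambda>_. M) J (Pi\<^sub>E J X))"
    by (simp only: A(2))
qed

lemma distr_bind_prob:
  assumes "p \<in> space (prob_algebra L)" "k \<in> L \<rightarrow>\<^sub>M prob_algebra N" "f \<in> N \<rightarrow>\<^sub>M R"
  shows "distr (p \<bind> k) R f = p \<bind> (\<lambda>x. distr (k x) R f)"
proof (rule distr_bind[OF _ _ assms(3)])
  show "k \<in> p \<rightarrow>\<^sub>M subprob_algebra N"
    using measurable_prob_algebraD[OF assms(2)] by (simp add: measurable_prob_algebra_cong[OF assms(1)])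
  show "space p \<noteq> {}" by (rule prob_space.not_empty[OF prob_algebraD(1)[OF assms(1)]])
qed

text \<open>The Markov property at a fixed time. It later bounds the distance of two path laws after
  time \<open>n\<close> by the distance of the states at time \<open>n\<close>.\<close>

lemma chain_law_shift:
  assumes x: "x \<in> space M"
  shows "distr (chain_law M K x) (path_space M) (path_shift n) = P n x \<bind> chain_law M K"
proof (induction n)
  case 0
  have "distr (chain_law M K x) (path_space M) (path_shift 0) = chain_law M K x"
    using distr_id2[of "path_space M" "chain_law M K x"] sets_chain_law[OF x] by (simp cong: distr_cong)
  then show ?case
    using bind_return[OF measurable_prob_algebraD[OF measurable_chain_law] x] by simp
next
  case (Suc n)
  note [measurable_cong] = sets_chain_law[OF x]
  have "distr (chain_law M K x) (path_space M) (path_shift (Suc n))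
      = distr (distr (chain_law M K x) (path_space M) (path_shift n)) (path_space M) (path_shift 1)"
    by (subst distr_distr) (simp_all add: comp_def shift_shift)
  also have "\<dots> = P n x \<bind> (\<lambda>y. distr (chain_law M K y) (path_space M) (path_shift 1))"
    unfolding Suc by (rule distr_bind_prob[OF P_prob[OF x] measurable_chain_law measurable_shift])
  also have "\<dots> = P n x \<bind> (\<lambda>y. K y \<bind> chain_law M K)"
    by (rule bind_cong[OF refl]) (simp add: chain_law_shift_1[unfolded One_nat_def] prob_algebraD[OF P_prob[OF x]])
  also have "\<dots> = P (Suc n) x \<bind> chain_law M K"
    using bind_P_assoc[OF P_prob[OF x] kernel measurable_chain_law, of n] by simp
  finally show ?case .
qed

lemma chain_law_marginal:
  assumes x: "x \<in> space M"
  shows "distr (chain_law M K x) M (\<lambda>\<omega>. \<omega> n) = P n x"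
proof -
  note [measurable_cong] = sets_chain_law[OF x]
  have 0: "distr (chain_law M K y) M (\<lambda>\<omega>. \<omega> 0) = return M y" if y: "y \<in> space M" for y
  proof (rule measure_eqI)
    note [measurable_cong] = sets_chain_law[OF y]
    fix B assume "B \<in> sets (distr (chain_law M K y) M (\<lambda>\<omega>. \<omega> 0))"
    then have B: "B \<in> sets M" by simp
    have "(\<lambda>\<omega>. \<omega> 0) -` B \<inter> space (chain_law M K y) = {\<omega> \<in> space (path_space M). \<forall>i\<le>0. \<omega> i \<in> B}"
      using sets_eq_imp_space_eq[OF sets_chain_law[OF y]] by auto
    then show "emeasure (distr (chain_law M K y) M (\<lambda>\<omega>. \<omega> 0)) B = emeasure (return M y) B"
      using chain_law_cylinder[OF y, of "\<lambda>_. B" 0] B by (simp add: emeasure_distr)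
  qed simp
  have "distr (chain_law M K x) M (\<lambda>\<omega>. \<omega> n)
      = distr (distr (chain_law M K x) (path_space M) (path_shift n)) M (\<lambda>\<omega>. \<omega> 0)"
    by (subst distr_distr) (simp_all add: comp_def path_shift_def)
  also have "\<dots> = P n x \<bind> (\<lambda>y. distr (chain_law M K y) M (\<lambda>\<omega>. \<omega> 0))"
    unfolding chain_law_shift[OF x] by (rule distr_bind_prob[OF P_prob[OF x] measurable_chain_law]) simp
  also have "\<dots> = P n x \<bind> return M"
    by (rule bind_cong[OF refl]) (simp add: 0 prob_algebraD[OF P_prob[OF x]])
  also have "\<dots> = P n x" by (rule bind_return'') (simp add: prob_algebraD[OF P_prob[OF x]])
  finally show ?thesis .
qed

end

section \<open>Couplings\<close>

lemma couplings_subset_ac_couplings: "couplings N p q \<subseteq> ac_couplings N p q"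
  by (auto simp: couplings_def ac_couplings_def absolutely_continuous_def)

text \<open>If \<open>A\<close> separated the two laws, absolute continuity of the marginals would
  make the first coordinate avoid \<open>A\<close> and the second lie in \<open>A\<close> almost
  surely, which no point of the diagonal does.\<close>

lemma ac_coupling_non_singular:
  assumes z: "\<zeta> \<in> ac_couplings M p q" and pos: "0 < emeasure \<zeta> (diagonal M)"
    and p: "p \<in> space (prob_algebra M)" and q: "q \<in> space (prob_algebra M)"
  shows "non_singular M p q"
  unfolding non_singular_def
proof
  assume "\<exists>A\<in>sets M. emeasure p A = 0 \<and> emeasure q (space M - A) = 0"
  then obtain A where A: "A \<in> sets M" "emeasure p A = 0" "emeasure q (space M - A) = 0" by blast
  have [measurable_cong]: "sets \<zeta> = sets (M \<Otimes>\<^sub>M M)" using z by (simp add: ac_couplings_def)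
  have sp: "space \<zeta> = space M \<times> space M"
    using sets_eq_imp_space_eq[OF \<open>sets \<zeta> = _\<close>] by (simp add: space_pair_measure)
  have "A \<in> null_sets p" "space M - A \<in> null_sets q"
    using A by (auto simp: null_sets_def prob_algebraD[OF p] prob_algebraD[OF q])
  then have "A \<in> null_sets (distr \<zeta> M fst)" "space M - A \<in> null_sets (distr \<zeta> M snd)"
    using z by (auto simp: ac_couplings_def absolutely_continuous_def)
  then have "fst -` A \<inter> space \<zeta> \<in> null_sets \<zeta>" "snd -` (space M - A) \<inter> space \<zeta> \<in> null_sets \<zeta>"
    by (simp_all add: null_sets_distr_iff)
  then have "fst -` A \<inter> space \<zeta> \<union> snd -` (space M - A) \<inter> space \<zeta> \<in> null_sets \<zeta>" by (rule null_sets.Un)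
  moreover have "diagonal M \<subseteq> fst -` A \<inter> space \<zeta> \<union> snd -` (space M - A) \<inter> space \<zeta>"
    by (auto simp: diagonal_def sp)
  ultimately have "emeasure \<zeta> (diagonal M) = 0"
    using emeasure_mono[of "diagonal M" "fst -` A \<inter> space \<zeta> \<union> snd -` (space M - A) \<inter> space \<zeta>" \<zeta>]
    by (auto simp: null_sets_def)
  with pos show False by simp
qed

text \<open>The missing mass is filled up by a multiple of the product of the two marginal defects.\<close>

lemma coupling_completion:
  assumes p: "p \<in> space (prob_algebra S)" and q: "q \<in> space (prob_algebra S)"
    and G: "sets G = sets (S \<Otimes>\<^sub>M S)"
    and G1: "\<And>A. A \<in> sets S \<Longrightarrow> emeasure (distr G S fst) A \<le> emeasure p A"
    and G2: "\<And>A. A \<in> sets S \<Longrightarrow> emeasure (distr G S snd) A \<le> emeasure q A"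
  obtains \<Gamma> where "\<Gamma> \<in> couplings S p q" "\<And>C. C \<in> sets (S \<Otimes>\<^sub>M S) \<Longrightarrow> emeasure G C \<le> emeasure \<Gamma> C"
proof -
  interpret p: prob_space p by (rule prob_algebraD[OF p])
  interpret q: prob_space q by (rule prob_algebraD[OF q])
  note [measurable_cong] = G prob_algebraD(2)[OF p] prob_algebraD(2)[OF q]
  note [simp] = prob_algebraD(2,3)[OF p] prob_algebraD(2,3)[OF q]
  have spG: "space G = space S \<times> space S"
    using sets_eq_imp_space_eq[OF G] by (simp add: space_pair_measure)
  let ?G1 = "distr G S fst" and ?G2 = "distr G S snd"
  have p1: "emeasure p (space S) = 1" and q1: "emeasure q (space S) = 1"
    using p.emeasure_space_1 q.emeasure_space_1 by simp_all
  have massG: "emeasure ?G1 (space S) = emeasure G (space G)" "emeasure ?G2 (space S) = emeasure G (space G)"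
    by (auto simp: emeasure_distr spG intro!: arg_cong[where f="emeasure G"])
  have G_le_1: "emeasure G (space G) \<le> 1" using G1[of "space S"] massG p1 by simp
  have fin1: "finite_measure ?G1" by (rule finite_measureI) (use massG G_le_1 in \<open>auto simp: top_unique\<close>)
  have fin2: "finite_measure ?G2" by (rule finite_measureI) (use massG G_le_1 in \<open>auto simp: top_unique\<close>)
  define \<alpha> where "\<alpha> = diff_measure p ?G1"
  define \<beta> where "\<beta> = diff_measure q ?G2"
  define m where "m = 1 - emeasure G (space G)"
  have [simp, measurable_cong]: "sets \<alpha> = sets S" "sets \<beta> = sets S"
    by (simp_all add: \<alpha>_def \<beta>_def)
  have [simp]: "space \<alpha> = space S" "space \<beta> = space S"
    by (simp_all add: \<alpha>_def \<beta>_def)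
  have \<alpha>: "emeasure \<alpha> A = emeasure p A - emeasure ?G1 A" if "A \<in> sets S" for A
    unfolding \<alpha>_def by (rule emeasure_diff_measure) (use that fin1 G1 in \<open>auto intro: p.finite_measure_axioms\<close>)
  have \<beta>: "emeasure \<beta> A = emeasure q A - emeasure ?G2 A" if "A \<in> sets S" for A
    unfolding \<beta>_def by (rule emeasure_diff_measure) (use that fin2 G2 in \<open>auto intro: q.finite_measure_axioms\<close>)
  have m: "emeasure \<alpha> (space S) = m" "emeasure \<beta> (space S) = m"
    by (simp_all add: \<alpha> \<beta> m_def massG p1 q1)
  have m_le: "m \<le> 1" by (simp add: m_def)
  interpret \<alpha>: finite_measure \<alpha> by (rule finite_measureI) (use m m_le in \<open>auto simp: top_unique\<close>)
  interpret \<beta>: finite_measure \<beta> by (rule finite_measureI) (use m m_le in \<open>auto simp: top_unique\<close>)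
  have cancel: "(1 / m) * (a * m) = a" if "a \<le> m" for a
  proof (cases "m = 0")
    case True
    then show ?thesis using that by simp
  next
    case False
    moreover have "m \<noteq> \<top>" using m_le by (auto simp: top_unique)
    ultimately show ?thesis
      by (subst mult.commute) (simp add: ennreal_times_divide mult_divide_eq_ennreal)
  qed
  have \<alpha>_le: "emeasure \<alpha> A \<le> m" and \<beta>_le: "emeasure \<beta> A \<le> m" for A
    using emeasure_space[of \<alpha> A] emeasure_space[of \<beta> A] m by simp_all
  let ?R = "scale_measure (1 / m) (\<alpha> \<Otimes>\<^sub>M \<beta>)"
  define \<Gamma> where "\<Gamma> = add_measure G ?R"
  have setsR: "sets ?R = sets G" using G by (simp cong: sets_pair_measure_cong)
  have sets\<Gamma> [measurable_cong]: "sets \<Gamma> = sets (S \<Otimes>\<^sub>M S)" using G by (simp add: \<Gamma>_def)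
  have sp\<Gamma>: "space \<Gamma> = space S \<times> space S"
    using sets_eq_imp_space_eq[OF sets\<Gamma>] by (simp add: space_pair_measure)
  have \<Gamma>: "emeasure \<Gamma> C = emeasure G C + (1 / m) * emeasure (\<alpha> \<Otimes>\<^sub>M \<beta>) C" if "C \<in> sets (S \<Otimes>\<^sub>M S)" for C
    unfolding \<Gamma>_def using emeasure_add_measure[OF setsR, of C] that G by simp
  have m1: "distr \<Gamma> S fst = p"
  proof (rule measure_eqI)
    fix A assume "A \<in> sets (distr \<Gamma> S fst)"
    then have A: "A \<in> sets S" by simp
    have eq: "fst -` A \<inter> space \<Gamma> = A \<times> space S" "fst -` A \<inter> space G = A \<times> space S"
      using sets.sets_into_space[OF A] by (auto simp: sp\<Gamma> spG)
    have "emeasure (distr \<Gamma> S fst) A = emeasure G (A \<times> space S) + (1 / m) * (emeasure \<alpha> A * m)"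
      using A by (simp add: emeasure_distr eq \<Gamma> \<beta>.emeasure_pair_measure_Times m)
    also have "\<dots> = emeasure ?G1 A + (emeasure p A - emeasure ?G1 A)"
      using A \<alpha>_le[of A] by (simp add: cancel \<alpha> emeasure_distr eq)
    also have "\<dots> = emeasure p A"
      using G1[OF A] finite_measure.emeasure_finite[OF fin1, of A] by (simp add: add_diff_eq_ennreal ennreal_add_diff_cancel_left)
    finally show "emeasure (distr \<Gamma> S fst) A = emeasure p A" .
  qed simp
  have m2: "distr \<Gamma> S snd = q"
  proof (rule measure_eqI)
    fix A assume "A \<in> sets (distr \<Gamma> S snd)"
    then have A: "A \<in> sets S" by simp
    have eq: "snd -` A \<inter> space \<Gamma> = space S \<times> A" "snd -` A \<inter> space G = space S \<times> A"
      using sets.sets_into_space[OF A] by (auto simp: sp\<Gamma> spG)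
    have "emeasure (distr \<Gamma> S snd) A = emeasure G (space S \<times> A) + (1 / m) * (emeasure \<beta> A * m)"
      using A by (simp add: emeasure_distr eq \<Gamma> \<beta>.emeasure_pair_measure_Times m mult.commute)
    also have "\<dots> = emeasure ?G2 A + (emeasure q A - emeasure ?G2 A)"
      using A \<beta>_le[of A] by (simp add: cancel \<beta> emeasure_distr eq)
    also have "\<dots> = emeasure q A"
      using G2[OF A] finite_measure.emeasure_finite[OF fin2, of A] by (simp add: add_diff_eq_ennreal ennreal_add_diff_cancel_left)
    finally show "emeasure (distr \<Gamma> S snd) A = emeasure q A" .
  qed simp
  have "prob_space \<Gamma>" by (rule prob_space_distrD[of fst \<Gamma> S]) (simp_all add: m1 p.prob_space_axioms)
  then have "\<Gamma> \<in> couplings S p q" using m1 m2 sets\<Gamma> by (simp add: couplings_def)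
  then show thesis by (rule that) (simp add: \<Gamma>)
qed

text \<open>The common density is the minimum of \<open>P\<close> and \<open>Q\<close>, written
  relative to either measure; \<open>1 - a\<close> is the proportion of \<open>P\<close> left over.
  Expressing the left-over mass through one set \<open>A\<close> allows a bound on differences of
  measures to be applied to it.\<close>

lemma common_part:
  fixes P Q :: "'a measure"
  assumes P: "finite_measure P" "sets P = sets M" and Q: "finite_measure Q" "sets Q = sets M"
  obtains a b :: "'a \<Rightarrow> real" and A where "a \<in> borel_measurable M" "b \<in> borel_measurable M"
    "\<And>x. 0 \<le> a x" "\<And>x. a x \<le> 1" "\<And>x. 0 \<le> b x" "\<And>x. b x \<le> 1"
    "density P (\<lambda>x. ennreal (a x)) = density Q (\<lambda>x. ennreal (b x))"
    "A \<in> sets M" "(\<integral>x. 1 - a x \<partial>P) = measure P A - measure Q A"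
proof -
  obtain L f g where *: "finite_measure L" "sets L = sets M"
    "f \<in> borel_measurable M" "g \<in> borel_measurable M" "\<And>x. 0 \<le> f x" "\<And>x. 0 \<le> g x"
    "P = density L (\<lambda>x. ennreal (f x))" "Q = density L (\<lambda>x. ennreal (g x))"
    by (rule dominating_density[OF P Q]) blast
  have [measurable_cong]: "sets L = sets M" by fact
  have sp: "space L = space M" using *(2) by (rule sets_eq_imp_space_eq)
  note [measurable] = *(3,4)
  define a where "a x = (if g x < f x then g x / f x else 1)" for x
  define b where "b x = (if f x < g x then f x / g x else 1)" for x
  have [measurable]: "a \<in> borel_measurable M" "b \<in> borel_measurable M"
    unfolding a_def b_def by measurable
  have a: "0 \<le> a x" "a x \<le> 1" and b: "0 \<le> b x" "b x \<le> 1" for x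
    using *(5,6)[of x] by (auto simp: a_def b_def divide_simps)
  have fa: "f x * a x = min (f x) (g x)" and gb: "g x * b x = min (f x) (g x)" for x
    using *(5,6)[of x] by (auto simp: a_def b_def)
  let ?A = "{x \<in> space M. g x < f x}"
  have A: "?A \<in> sets M" by measurable
  have finP: "finite_measure (density L (\<lambda>x. ennreal (f x)))" and finQ: "finite_measure (density L (\<lambda>x. ennreal (g x)))"
    using P(1) Q(1) by (simp_all add: *(7,8))
  show thesis
  proof (rule that[OF _ _ a b _ A])
    have dens: "density (density L (\<lambda>x. ennreal (f x))) (\<lambda>x. ennreal (c x)) = density L (\<lambda>x. ennreal (f x * c x))"
      if "f \<in> borel_measurable M" "c \<in> borel_measurable M" "\<And>x. 0 \<le> f x" "\<And>x. 0 \<le> c x" for f c :: "'a \<Rightarrow> real"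
      using that *(2) by (subst density_density_eq) (auto simp: ennreal_mult cong: measurable_cong_sets)
    show "density P (\<lambda>x. ennreal (a x)) = density Q (\<lambda>x. ennreal (b x))"
      unfolding *(7,8) using *(3-6) a b by (simp add: dens fa gb)
    have "(\<integral>x. 1 - a x \<partial>P) = (\<integral>x. f x *\<^sub>R (1 - a x) \<partial>L)"
      unfolding *(7) by (rule integral_density) (simp_all add: *(5))
    also have "\<dots> = (\<integral>x. indicator ?A x * (f x - g x) \<partial>L)"
      by (rule Bochner_Integration.integral_cong) (auto simp: sp a_def field_simps leD[OF *(6)] split: split_indicator)
    also have "\<dots> = measure P ?A - measure Q ?A"
      using measure_diff_density(2)[OF *(2,3,5) finP *(4,6) finQ A] by (simp add: *(7,8))
    finally show "(\<integral>x. 1 - a x \<partial>P) = measure P ?A - measure Q ?A" .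
  qed measurable
qed

text \<open>The common part is placed on the diagonal. Its mass is positive because the distance is
  below one, and \<open>coupling_completion\<close> supplies the rest.\<close>

lemma coupling_of_non_singular:
  assumes p: "p \<in> space (prob_algebra M)" and q: "q \<in> space (prob_algebra M)"
    and ns: "non_singular M p q" and diag: "diagonal M \<in> sets (M \<Otimes>\<^sub>M M)"
  shows "\<exists>\<zeta>\<in>couplings M p q. 0 < emeasure \<zeta> (diagonal M)"
proof -
  interpret p: prob_space p by (rule prob_algebraD[OF p])
  interpret q: prob_space q by (rule prob_algebraD[OF q])
  note [measurable_cong] = prob_algebraD(2)[OF p] prob_algebraD(2)[OF q]
  note [simp] = prob_algebraD(2,3)[OF p] prob_algebraD(2,3)[OF q]
  obtain a b :: "'a \<Rightarrow> real" and A where ab [measurable]: "a \<in> borel_measurable M" "b \<in> borel_measurable M"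
    and a: "\<And>x. 0 \<le> a x" "\<And>x. a x \<le> 1" and b: "\<And>x. 0 \<le> b x" "\<And>x. b x \<le> 1"
    and eq: "density p (\<lambda>x. ennreal (a x)) = density q (\<lambda>x. ennreal (b x))"
    and A: "A \<in> sets M" "(\<integral>x. 1 - a x \<partial>p) = measure p A - measure q A"
    by (rule common_part[of p M q]) (simp_all add: p.finite_measure_axioms q.finite_measure_axioms)
  let ?\<nu> = "density p (\<lambda>x. ennreal (a x))"
  have le: "emeasure (density r (\<lambda>x. ennreal (c x))) B \<le> emeasure r B"
    if "sets r = sets M" "c \<in> borel_measurable M" "\<And>x. c x \<le> 1" "B \<in> sets M" for r c and B :: "'a set"
  proof -
    have "emeasure (density r (\<lambda>x. ennreal (c x))) B = (\<integral>\<^sup>+x. ennreal (c x) * indicator B x \<partial>r)"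
      using that by (intro emeasure_density) (auto cong: measurable_cong_sets)
    also have "\<dots> \<le> (\<integral>\<^sup>+x. indicator B x \<partial>r)"
      using that(3) by (intro nn_integral_mono) (auto split: split_indicator simp: ennreal_le_1)
    finally show ?thesis using that by simp
  qed
  have Ia: "integrable p a" by (rule integrable_prob_bounded[OF p ab(1), where B=1]) (use a in auto)
  have "1 - (\<integral>x. a x \<partial>p) < 1"
    using A(2) tv_dist_upper[OF p q A(1)] ns Ia by (simp add: non_singular_iff_tv_dist p q p.prob_space[simplified])
  then have "0 < (\<integral>x. a x \<partial>p)" by simp
  moreover have "emeasure ?\<nu> (space M) = (\<integral>\<^sup>+x. ennreal (a x) * indicator (space M) x \<partial>p)"
    by (rule emeasure_density) auto
  moreover have "\<dots> = (\<integral>\<^sup>+x. ennreal (a x) \<partial>p)" by (intro nn_integral_cong) auto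
  moreover have "\<dots> = ennreal (\<integral>x. a x \<partial>p)" using a Ia by (intro nn_integral_eq_integral) auto
  ultimately have pos: "0 < emeasure ?\<nu> (space M)" by simp
  define G where "G = distr ?\<nu> (M \<Otimes>\<^sub>M M) (\<lambda>x. (x, x))"
  have distrs: "distr G M fst = ?\<nu>" "distr G M snd = ?\<nu>"
    unfolding G_def by (subst distr_distr; force simp: comp_def intro!: measure_eqI simp: emeasure_distr)+
  obtain \<Gamma> where \<Gamma>: "\<Gamma> \<in> couplings M p q" "\<And>C. C \<in> sets (M \<Otimes>\<^sub>M M) \<Longrightarrow> emeasure G C \<le> emeasure \<Gamma> C"
  proof (rule coupling_completion[OF p q, of G])
    show "sets G = sets (M \<Otimes>\<^sub>M M)" by (simp add: G_def)
    show "emeasure (distr G M fst) B \<le> emeasure p B" if "B \<in> sets M" for B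
      unfolding distrs using a that by (intro le) auto
    show "emeasure (distr G M snd) B \<le> emeasure q B" if "B \<in> sets M" for B
      unfolding distrs eq using b that by (intro le) auto
  qed blast
  have "(\<lambda>x. (x, x)) -` diagonal M \<inter> space M = space M" by (auto simp: diagonal_def)
  then have "emeasure G (diagonal M) = emeasure ?\<nu> (space M)"
    using diag by (simp add: G_def emeasure_distr)
  with pos \<Gamma>(2)[OF diag] show ?thesis using \<Gamma>(1) by (intro bexI[of _ \<Gamma>]) auto
qed

section \<open>Irreducibility and periodicity\<close>

context invariant_kernel
begin

text \<open>The event is a countable union over times, so it is null exactly if no state at a
  positive time charges \<open>A\<close>. This reduces irreducibility to the kernels
  \<open>P n\<close>.\<close>

lemma reach_iff:
  assumes x: "x \<in> space M" and A: "A \<in> sets M"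
  shows "0 < emeasure (chain_law M K x) {\<omega> \<in> space (path_space M). \<exists>n\<ge>1. \<omega> n \<in> A}
    \<longleftrightarrow> (\<exists>n\<ge>1. 0 < measure (P n x) A)"
proof -
  note [measurable_cong] = sets_chain_law[OF x]
  note [measurable] = A
  have sp: "space (chain_law M K x) = space (path_space M)"
    by (rule sets_eq_imp_space_eq[OF sets_chain_law[OF x]])
  interpret prob_space "chain_law M K x" by (rule prob_space_chain_law[OF x])
  have eq: "measure (P n x) A = prob {\<omega> \<in> space (path_space M). \<omega> n \<in> A}" for n
    unfolding chain_law_marginal[OF x, symmetric]
    by (subst measure_distr) (auto simp: sp intro!: arg_cong[where f=prob])
  have null: "measure (P n x) A = 0 \<longleftrightarrow> (AE \<omega> in chain_law M K x. \<omega> n \<notin> A)" for n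
    unfolding eq by (subst prob_eq_0) (auto simp: sp intro!: AE_cong)
  let ?S = "{\<omega> \<in> space (path_space M). \<exists>n\<ge>1. \<omega> n \<in> A}"
  have "emeasure (chain_law M K x) ?S = 0 \<longleftrightarrow> prob ?S = 0" by (simp add: emeasure_eq_measure)
  also have "\<dots> \<longleftrightarrow> (AE \<omega> in chain_law M K x. \<omega> \<notin> ?S)"
  proof (rule prob_eq_0)
    have "?S = (\<Union>n\<in>{1..}. (\<lambda>\<omega>. \<omega> n) -` A \<inter> space (path_space M))" by auto
    also have "\<dots> \<in> sets (path_space M)" using A by (intro sets.countable_UN') auto
    finally show "?S \<in> events" by (simp add: sets_chain_law[OF x])
  qed
  also have "\<dots> \<longleftrightarrow> (AE \<omega> in chain_law M K x. \<forall>n. n \<ge> 1 \<longrightarrow> \<omega> n \<notin> A)"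
  proof (rule AE_cong)
    fix \<omega> assume "\<omega> \<in> space (chain_law M K x)"
    then have "\<omega> \<in> space (path_space M)" by (simp only: sp)
    then show "\<omega> \<notin> ?S \<longleftrightarrow> (\<forall>n. n \<ge> 1 \<longrightarrow> \<omega> n \<notin> A)" by blast
  qed
  also have "\<dots> \<longleftrightarrow> (\<forall>n\<ge>1. measure (P n x) A = 0)"
  proof -
    have "(AE \<omega> in chain_law M K x. 1 \<le> n \<longrightarrow> \<omega> n \<notin> A) \<longleftrightarrow> (1 \<le> n \<longrightarrow> measure (P n x) A = 0)" for n
      using null[of n] by (cases "1 \<le> n") (simp_all only: simp_thms eventually_True)
    then show ?thesis unfolding AE_all_countable by (simp only: simp_thms)
  qed
  finally show ?thesis unfolding zero_less_iff_neq_zero zero_less_measure_iff by (simp only: not_all not_imp)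
qed

lemma irreducible_kernel_iff:
  "irreducible_kernel M K \<longleftrightarrow>
    (\<exists>\<phi>. sigma_finite_measure \<phi> \<and> sets \<phi> = sets M \<and> emeasure \<phi> (space M) > 0 \<and>
      (\<forall>A\<in>sets M. emeasure \<phi> A > 0 \<longrightarrow> (\<forall>x\<in>space M. \<exists>n\<ge>1. 0 < measure (P n x) A)))"
  unfolding irreducible_kernel_def by (simp only: reach_iff cong: conj_cong ball_cong)

text \<open>Classes are numbered from one and residues from zero, hence \<open>i - 1\<close> inside
  the remainder and \<open>+ 1\<close> outside.\<close>

lemma periodic_P:
  assumes E: "\<And>i. i \<in> {1..d} \<Longrightarrow> E i \<in> sets M" and d: "d \<ge> 1"
    and step: "\<And>i x. i \<in> {1..d} \<Longrightarrow> x \<in> E i \<Longrightarrow> emeasure (K x) (E (i mod d + 1)) = 1"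
    and i: "i \<in> {1..d}" and x: "x \<in> E i"
  shows "measure (P n x) (E ((i - 1 + n) mod d + 1)) = 1"
proof (induction n)
  case 0
  have "(i - 1) mod d + 1 = i" using i by auto
  then show ?case using x E[OF i] by (simp add: measure_return)
next
  case (Suc n)
  have xM: "x \<in> space M" using x sets.sets_into_space[OF E[OF i]] by auto
  let ?j = "(i - 1 + n) mod d + 1"
  have j: "?j \<in> {1..d}" using d by (auto simp: Suc_le_eq)
  have next_j: "(i - 1 + Suc n) mod d + 1 = ?j mod d + 1" by (simp add: mod_Suc_eq)
  interpret prob_space "P n x" by (rule prob_algebraD[OF P_prob[OF xM]])
  have "?j mod d + 1 \<in> {1..d}" using d by (auto simp: Suc_le_eq)
  note E' = E[OF this]
  have "AE u in P n x. u \<in> E ?j"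
    using Suc E[OF j] by (simp add: prob_eq_1 prob_algebraD[OF P_prob[OF xM]])
  then have "AE u in P n x. measure (K u) (E (?j mod d + 1)) = 1"
    by eventually_elim (use step[OF j] in \<open>simp add: measure_def\<close>)
  then have "(\<integral>u. measure (K u) (E (?j mod d + 1)) \<partial>P n x) = (\<integral>u. 1 \<partial>P n x)"
    using measurable_measure_kernel[OF kernel E']
    by (intro integral_cong_AE) (auto simp: measurable_prob_algebra_cong[OF P_prob[OF xM]])
  then show ?case
    unfolding next_j using measure_bind_prob[OF P_prob[OF xM] kernel E', of n] by (simp add: prob_space)
qed

text \<open>Chains started in the first and in the second class remain one class apart forever, so
  their laws sit on disjoint sets at every time.\<close>

lemma A2_imp_aperiodic:
  assumes A2: "cond_A2 M K"
  shows "aperiodic M K \<mu>"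
  unfolding aperiodic_def
proof (intro allI impI notI)
  fix d :: nat assume d: "2 \<le> d" and "periodic M K \<mu> d"
  then obtain E where E0: "\<forall>i\<in>{1..d}. E i \<in> sets M" and disj: "disjoint_family_on E {1..d}"
    and pos: "0 < emeasure \<mu> (E 1)"
    and step0: "\<forall>i\<in>{1..d}. \<forall>x\<in>E i. emeasure (K x) (E (i mod d + 1)) = 1"
    unfolding periodic_def by blast
  note E = bspec[OF E0] and step = bspec[OF bspec[OF step0]]
  have I: "1 \<in> {1..d}" "2 \<in> {1..d}" using d by auto
  have "E 1 \<noteq> {}" using pos by auto
  then obtain x where x: "x \<in> E 1" by blast
  have "emeasure (K x) (E 2) = 1" using step[OF I(1) x] d by (simp add: numeral_2_eq_2)
  then have "E 2 \<noteq> {}" by auto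
  then obtain y where y: "y \<in> E 2" by blast
  have xM: "x \<in> space M" and yM: "y \<in> space M" using x y E I sets.sets_into_space by blast+
  obtain n where ns: "non_singular M (P n x) (P n y)" using A2 xM yM by (auto simp: cond_A2_def)
  define a b where "a = n mod d + 1" and "b = Suc n mod d + 1"
  have ab: "a \<in> {1..d}" "b \<in> {1..d}"
    using d by (simp_all add: a_def b_def Suc_le_eq)
  have "a \<noteq> b" using d by (simp add: a_def b_def mod_Suc)
  note ab = ab this
  have "measure (P n x) (E a) = 1" "measure (P n y) (E b) = 1"
    using periodic_P[OF E _ step I(1) x, of n] periodic_P[OF E _ step I(2) y, of n] d by (simp_all add: a_def b_def)
  moreover have "measure (P n x) (E a) + measure (P n x) (E b) = measure (P n x) (E a \<union> E b)"
    using disj ab E P_prob[OF xM, of n]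
    by (intro finite_measure.finite_measure_Union[symmetric] prob_space.finite_measure)
       (auto simp: disjoint_family_on_def prob_algebraD)
  ultimately have "measure (P n y) (E b) - measure (P n x) (E b) \<ge> 1"
    using measure_prob_le_1[OF P_prob[OF xM, of n], of "E a \<union> E b"] by linarith
  then have "1 \<le> tv_dist M (P n x) (P n y)"
    using tv_dist_upper[OF P_prob[OF xM, of n] P_prob[OF yM, of n] E[OF ab(2)]] by linarith
  then show False using ns by (simp add: non_singular_iff_tv_dist P_prob xM yM)
qed

text \<open>The invariant law itself serves as irreducibility measure: a set never reached from
  \<open>x\<close> is never reached from a typical successor either, and the laws started there
  converge to \<mu>.\<close>

lemma A2_imp_irreducible:
  assumes A2: "cond_A2 M K"
  shows "irreducible_kernel M K"
  unfolding irreducible_kernel_iff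
proof (intro exI[of _ \<mu>] conjI ballI impI)
  show "sigma_finite_measure \<mu>" by unfold_locales
  show "sets \<mu> = sets M" by simp
  show "0 < emeasure \<mu> (space M)" using \<mu>.emeasure_space_1 by simp
  fix A x assume A: "A \<in> sets M" and pos: "0 < emeasure \<mu> A" and x: "x \<in> space M"
  have P2: "cond_P2 M K \<mu>" by (rule A2_imp_P2[OF A2])
  show "\<exists>n\<ge>1. 0 < measure (P n x) A"
  proof (rule ccontr)
    assume "\<not> ?thesis"
    then have 0: "\<And>n. 1 \<le> n \<Longrightarrow> measure (P n x) A = 0" by (metis less_le measure_nonneg)
    obtain n0 where "\<And>m. n0 \<le> m \<Longrightarrow> tv_dist M (P m x) \<mu> < 1" using P2_overlap[OF P2 x] by blast
    \<comment> \<open>One extra step makes the time positive, as reachability excludes time zero and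
      the argument also looks zero steps ahead.\<close>
    then have n: "tv_dist M (P (Suc n0) x) \<mu> < 1" by (simp del: n_step.simps)
    have "(\<lambda>m::nat. measure \<mu> A) \<longlonglongrightarrow> 0"
      using P2 A x
      by (intro limit_zero_of_AE_zero[OF _ P_prob[OF x] n] measure_P_add_eq_0[OF x A] 0)
         (auto simp: cond_P2_def)
    then have "measure \<mu> A = 0" by (simp add: LIMSEQ_const_iff)
    with pos show False by (simp add: \<mu>.emeasure_eq_measure)
  qed
qed

lemma integral_P_measure: "A \<in> sets M \<Longrightarrow> (\<integral>x. measure (P n x) A \<partial>\<mu>) = measure \<mu> A"
  using measure_bind_prob[OF \<mu> measurable_P, of A n] by (simp add: \<mu>_bind_P)

lemma integrable_P_measure: "A \<in> sets M \<Longrightarrow> integrable \<mu> (\<lambda>x. measure (P n x) A)"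
  by (intro integrable_prob_bounded[OF \<mu>, where B=1] measurable_measure_kernel[OF measurable_P])
     (auto intro: measure_prob_le_1 P_prob)

section \<open>Reachability and overlap under irreducibility\<close>

text \<open>By invariance the mean of \<open>measure (P n x) B - indicator B x\<close> is zero. It
  vanishes on an absorbing \<open>B\<close> and is nonnegative elsewhere, so there is almost no flow
  into \<open>B\<close> from outside.\<close>

lemma absorbing_complement:
  assumes B: "B \<in> sets M" and abs: "\<And>x. x \<in> B \<Longrightarrow> measure (P n x) B = 1"
  shows "AE x in \<mu>. x \<notin> B \<longrightarrow> measure (P n x) B = 0"
proof -
  let ?D = "\<lambda>x. measure (P n x) B - indicator B x"
  have I: "integrable \<mu> (indicat_real B)" using B by (simp add: \<mu>.emeasure_eq_measure)
  have "(\<integral>x. ?D x \<partial>\<mu>) = 0"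
    using I integrable_P_measure[OF B] B by (simp add: integral_P_measure)
  moreover have "AE x in \<mu>. 0 \<le> ?D x" using abs by (auto split: split_indicator)
  moreover have "integrable \<mu> ?D" using I integrable_P_measure[OF B] by simp
  ultimately have "AE x in \<mu>. ?D x = 0" using integral_nonneg_eq_0_iff_AE by blast
  then show ?thesis by eventually_elim (auto split: split_indicator)
qed

text \<open>Replaces the unknown measure \<open>\<phi>\<close> by \<mu>. The points from which
  \<open>A\<close> is never reached form an absorbing set \<open>B\<close>. If \<open>\<phi>\<close>
  charges the complement of \<open>B\<close>, that complement is reached even from \<open>B\<close>,
  a contradiction. Otherwise \<open>\<phi>\<close> charges \<open>B\<close>, every point can enter
  \<open>B\<close>, so \<open>B\<close> has full \<mu>-measure and invariance makes \<open>A\<close>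
  null.\<close>

lemma \<mu>_reach:
  assumes irr: "irreducible_kernel M K" and A: "A \<in> sets M" and pos: "0 < measure \<mu> A" and x: "x \<in> space M"
  shows "\<exists>n\<ge>1. 0 < measure (P n x) A"
proof (rule ccontr)
  assume "\<not> ?thesis"
  then have 0: "\<And>n. 1 \<le> n \<Longrightarrow> measure (P n x) A = 0" by (metis less_le measure_nonneg)
  obtain \<phi> where \<phi>: "sets \<phi> = sets M" "0 < emeasure \<phi> (space M)"
    and reach: "\<And>A x. A \<in> sets M \<Longrightarrow> 0 < emeasure \<phi> A \<Longrightarrow> x \<in> space M \<Longrightarrow> \<exists>n\<ge>1. 0 < measure (P n x) A"
    using irr unfolding irreducible_kernel_iff by blast
  define B where "B = {x \<in> space M. \<forall>n. n \<ge> 1 \<longrightarrow> measure (P n x) A = 0}"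
  have [measurable]: "(\<lambda>u. measure (P m u) A) \<in> borel_measurable M" for m
    by (rule measurable_measure_kernel[OF measurable_P A])
  have B: "B \<in> sets M" unfolding B_def by measurable
  have abs: "measure (P n x) B = 1" if "x \<in> B" for n x
  proof -
    have x: "x \<in> space M" and 0: "\<And>n. 1 \<le> n \<Longrightarrow> measure (P n x) A = 0" using that by (auto simp: B_def)
    interpret prob_space "P n x" by (rule prob_algebraD[OF P_prob[OF x]])
    have "AE u in P n x. \<forall>m. m \<ge> 1 \<longrightarrow> measure (P m u) A = 0"
      unfolding AE_all_countable
    proof
      fix m show "AE u in P n x. 1 \<le> m \<longrightarrow> measure (P m u) A = 0"
        using measure_P_add_eq_0[OF x A, of n m] 0[of "n + m"] by (cases "1 \<le> m") auto
    qed
    then have "AE u in P n x. u \<in> B"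
      using AE_space by eventually_elim (simp add: B_def prob_algebraD[OF P_prob[OF x]])
    then show ?thesis using B by (simp add: prob_eq_1 prob_algebraD[OF P_prob[OF x]])
  qed
  have xB: "x \<in> B" using x 0 by (simp add: B_def)
  show False
  proof (cases "0 < emeasure \<phi> (space M - B)")
    case True
    obtain n where "0 < measure (P n x) (space M - B)" using reach[OF _ True x] B by auto
    moreover have "measure (P n x) (space M - B) = 1 - measure (P n x) B"
      using prob_space.prob_compl[OF prob_algebraD(1)[OF P_prob[OF x]], of B n] B
      by (simp add: prob_algebraD[OF P_prob[OF x]])
    ultimately show False using abs[OF xB] by simp
  next
    case False
    have "emeasure \<phi> (space M) = emeasure \<phi> B + emeasure \<phi> (space M - B)"
      using B sets.sets_into_space[OF B] \<phi>(1) by (subst plus_emeasure) (auto intro!: arg_cong[where f="emeasure \<phi>"])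
    with False \<phi>(2) have posB: "0 < emeasure \<phi> B" by simp
    have "AE y in \<mu>. \<forall>n. y \<notin> B \<longrightarrow> measure (P n y) B = 0"
      unfolding AE_all_countable using absorbing_complement[OF B abs] by blast
    then have "AE y in \<mu>. y \<in> B"
      using AE_space
    proof eventually_elim
      case (elim y)
      then show ?case using reach[OF B posB, of y] by auto
    qed
    then have "AE y in \<mu>. measure (P 1 y) A = 0" by eventually_elim (simp add: B_def del: n_step.simps One_nat_def)
    then have "(\<integral>y. measure (P 1 y) A \<partial>\<mu>) = 0" by (rule integral_eq_zero_AE)
    with pos show False by (simp only: integral_P_measure[OF A])
  qed
qed

text \<open>If every \<open>P n x\<close> were singular to \<mu>, a countable union of \<mu>-null
  sets would carry all of them, and its complement, which has full \<mu>-measure, would never be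
  reached.\<close>

lemma irreducible_overlap:
  assumes irr: "irreducible_kernel M K" and x: "x \<in> space M"
  shows "\<exists>n. tv_dist M (P n x) \<mu> < 1"
proof (rule ccontr)
  assume "\<not> ?thesis"
  then have "\<not> non_singular M \<mu> (P n x)" for n
    using non_singular_iff_tv_dist[OF \<mu> P_prob[OF x]] tv_dist_commute[OF \<mu> P_prob[OF x]] by simp
  then have "\<forall>n. \<exists>A. A \<in> sets M \<and> emeasure \<mu> A = 0 \<and> emeasure (P n x) (space M - A) = 0"
    unfolding non_singular_def by blast
  then obtain A where A: "\<And>n. A n \<in> sets M" "\<And>n. emeasure \<mu> (A n) = 0" "\<And>n. emeasure (P n x) (space M - A n) = 0"
    by metis
  let ?A = "\<Union>n. A n"
  have A': "?A \<in> sets M" using A(1) by auto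
  have "?A \<in> null_sets \<mu>" using A by (intro null_sets_UN) (auto simp: null_sets_def)
  then have "measure \<mu> ?A = 0" by (simp add: null_sets_def measure_def)
  then have "measure \<mu> (space M - ?A) = 1" using \<mu>.prob_compl[of ?A] A' by simp
  then obtain n where "0 < measure (P n x) (space M - ?A)"
    using \<mu>_reach[OF irr _ _ x, of "space M - ?A"] A' by auto
  moreover have "emeasure (P n x) (space M - ?A) \<le> emeasure (P n x) (space M - A n)"
    using A(1)[of n] by (intro emeasure_mono) (auto simp: prob_algebraD[OF P_prob[OF x]])
  ultimately show False using A(3)[of n] by (simp add: measure_def)
qed

lemma AE_meets:
  assumes Q: "AE y in \<mu>. Q y" and D: "D \<in> sets M" "measure \<mu> D \<noteq> 0"
  obtains y where "y \<in> D" "Q y"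
proof (rule ccontr)
  assume "\<not> thesis"
  with Q that have "AE y in \<mu>. y \<notin> D" by (auto elim!: eventually_mono)
  then have "measure \<mu> D = 0" using D(1) by (simp add: \<mu>.prob_eq_0)
  with D(2) show False by simp
qed

lemma h_refl: "x \<in> space M \<Longrightarrow> h x x = 0"
  using h_lim[of x x] cSUP_const[of "sets M" "0::real"] sets.top[of M]
  by (auto simp: tv_dist_def LIMSEQ_const_iff)

text \<open>Pairwise separating sets combine to disjoint carriers \<open>S x\<close> of the laws.
  Closeness to \<mu> gives each carrier \<mu>-measure at least \<open>e\<close>, and these add up to
  at most one.\<close>

lemma card_mutually_singular:
  assumes X: "finite X" "X \<subseteq> space M" and e: "\<And>x. x \<in> X \<Longrightarrow> tv_dist M (P n x) \<mu> \<le> 1 - e"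
    and sing: "\<And>x y. x \<in> X \<Longrightarrow> y \<in> X \<Longrightarrow> x \<noteq> y \<Longrightarrow> tv_dist M (P n x) (P n y) = 1"
  shows "real (card X) * e \<le> 1"
proof -
  have "\<exists>A. A \<in> sets M \<and> measure (P n x) A - measure (P n y) A = 1"
    if "x \<in> X" "y \<in> X" "x \<noteq> y" for x y
    using tv_dist_attained[OF P_prob P_prob, of x y n n] sing[OF that] that X(2) by (metis subsetD)
  then have "\<forall>x y. \<exists>A. x \<in> X \<longrightarrow> y \<in> X \<longrightarrow> x \<noteq> y \<longrightarrow> A \<in> sets M \<and> measure (P n x) A - measure (P n y) A = 1"
    by blast
  then obtain A where A: "\<And>x y. x \<in> X \<Longrightarrow> y \<in> X \<Longrightarrow> x \<noteq> y \<Longrightarrow> A x y \<in> sets M"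
    "\<And>x y. x \<in> X \<Longrightarrow> y \<in> X \<Longrightarrow> x \<noteq> y \<Longrightarrow> measure (P n x) (A x y) - measure (P n y) (A x y) = 1"
    by metis
  define S where "S x = space M - (\<Union>y\<in>X - {x}. (space M - A x y) \<union> A y x)" for x
  have S: "S x \<in> sets M" if "x \<in> X" for x
    unfolding S_def using X(1) A(1) that by (intro sets.Diff sets.finite_UN) auto
  have disj: "disjoint_family_on S X"
    unfolding disjoint_family_on_def S_def by blast
  have S1: "measure (P n x) (S x) = 1" if x: "x \<in> X" for x
  proof -
    have xM: "x \<in> space M" using x X(2) by auto
    interpret prob_space "P n x" by (rule prob_algebraD[OF P_prob[OF xM]])
    note [simp] = prob_algebraD(2,3)[OF P_prob[OF xM]]
    have "(space M - A x y) \<union> A y x \<in> null_sets (P n x)" if y: "y \<in> X - {x}" for y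
    proof -
      have yM: "y \<in> space M" using y X(2) by auto
      have "prob (A x y) - measure (P n y) (A x y) = 1" "measure (P n y) (A y x) - prob (A y x) = 1"
        using A(2)[of x y] A(2)[of y x] x y by auto
      then have "prob (A x y) = 1" "prob (A y x) = 0"
        using prob_le_1[of "A x y"] measure_nonneg[of "P n y" "A x y"]
          measure_prob_le_1[OF P_prob[OF yM], of n "A y x"] measure_nonneg[of "P n x" "A y x"]
        by linarith+
      then have "space M - A x y \<in> null_sets (P n x)" "A y x \<in> null_sets (P n x)"
        using A(1)[of x y] A(1)[of y x] x y prob_compl[of "A x y"]
        by (auto simp: null_sets_def emeasure_eq_measure)
      then show ?thesis by (rule null_sets.Un)
    qed
    then have "(\<Union>y\<in>X - {x}. (space M - A x y) \<union> A y x) \<in> null_sets (P n x)"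
      using X(1) by (intro null_sets_UN' countable_finite) auto
    then show ?thesis
      unfolding S_def using prob_compl[of "\<Union>y\<in>X - {x}. (space M - A x y) \<union> A y x"]
      by (auto simp: null_sets_def measure_def)
  qed
  have "e \<le> measure \<mu> (S x)" if x: "x \<in> X" for x
    using tv_dist_upper[OF P_prob \<mu> S[OF x], of x n] e[OF x] S1[OF x] X(2) x by auto
  then have "(\<Sum>x\<in>X. e) \<le> (\<Sum>x\<in>X. measure \<mu> (S x))" by (rule sum_mono)
  also have "\<dots> = measure \<mu> (\<Union>x\<in>X. S x)"
    using S disj X(1) by (intro \<mu>.finite_measure_finite_Union[symmetric]) auto
  also have "\<dots> \<le> 1" by simp
  finally show ?thesis by simp
qed

text \<open>The sets \<open>D n j\<close> exhaust the space by \<open>irreducible_overlap\<close>,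
  so one of them has positive measure. Points at mutual limit distance one can be picked from it one
  after another, each outside the null sets of its predecessors.\<close>

lemma not_AE_h_eq_1:
  assumes irr: "irreducible_kernel M K"
  shows "\<not> (AE z in \<mu> \<Otimes>\<^sub>M \<mu>. h (fst z) (snd z) = 1)"
proof
  assume h1: "AE z in \<mu> \<Otimes>\<^sub>M \<mu>. h (fst z) (snd z) = 1"
  define D where "D n j = {x \<in> space M. tv_dist M (P n x) \<mu> \<le> 1 - 1 / real (Suc j)}" for n j
  have "(\<lambda>_. \<mu>) \<in> M \<rightarrow>\<^sub>M prob_algebra M" using \<mu> by simp
  then have [measurable]: "(\<lambda>x. tv_dist M (P n x) \<mu>) \<in> borel_measurable M" for n
    by (rule measurable_tv_dist[OF generated measurable_P])
  have D: "D n j \<in> sets M" for n j unfolding D_def by measurable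
  have "space M \<subseteq> (\<Union>n. \<Union>j. D n j)"
  proof
    fix x assume x: "x \<in> space M"
    obtain n where "tv_dist M (P n x) \<mu> < 1" using irreducible_overlap[OF irr x] by blast
    then obtain j where "1 / real (Suc j) < 1 - tv_dist M (P n x) \<mu>"
      using nat_approx_posE[of "1 - tv_dist M (P n x) \<mu>"] by auto
    then have "x \<in> D n j" using x by (simp add: D_def)
    then show "x \<in> (\<Union>n. \<Union>j. D n j)" by blast
  qed
  moreover have "\<not> space M \<subseteq> (\<Union>n. \<Union>j. D n j)" if "\<And>n j. measure \<mu> (D n j) = 0"
  proof
    assume sub: "space M \<subseteq> (\<Union>n. \<Union>j. D n j)"
    have "(\<Union>n. \<Union>j. D n j) \<in> null_sets \<mu>"
      using that D by (intro null_sets_UN) (auto simp: null_sets_def \<mu>.emeasure_eq_measure)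
    then have "emeasure \<mu> (space M) = 0"
      using emeasure_mono[OF sub, of \<mu>] D by (auto simp: null_sets_def)
    then show False using \<mu>.emeasure_space_1 by simp
  qed
  ultimately obtain n j where Dpos: "measure \<mu> (D n j) \<noteq> 0" by blast
  have nested: "AE x in \<mu>. AE y in \<mu>. h x y = 1" using \<mu>\<mu>.AE_pair[OF h1] by simp
  \<comment> \<open>Each chosen point must itself be at distance one from almost every point,
    otherwise the selection could not be continued.\<close>
  have "\<exists>X. finite X \<and> card X = N \<and> X \<subseteq> D n j \<and> (\<forall>x\<in>X. AE y in \<mu>. h x y = 1) \<and>
      (\<forall>x\<in>X. \<forall>y\<in>X. x \<noteq> y \<longrightarrow> h x y = 1)" for N
  proof (induction N)
    case 0
    show ?case by (rule exI[of _ "{}"]) simp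
  next
    case (Suc N)
    then obtain X where X: "finite X" "card X = N" "X \<subseteq> D n j" "\<forall>x\<in>X. AE y in \<mu>. h x y = 1"
      "\<forall>x\<in>X. \<forall>y\<in>X. x \<noteq> y \<longrightarrow> h x y = 1" by (elim exE conjE) (rule that)
    have "AE y in \<mu>. \<forall>x\<in>X. h x y = 1" using X(1,4) by (simp add: AE_ball_countable countable_finite)
    with nested have "AE y in \<mu>. (AE z in \<mu>. h y z = 1) \<and> (\<forall>x\<in>X. h x y = 1)" by eventually_elim simp
    then obtain y where y: "y \<in> D n j" "AE z in \<mu>. h y z = 1" "\<forall>x\<in>X. h x y = 1"
      using AE_meets[OF _ D Dpos] by blast
    have sp: "X \<subseteq> space M" "y \<in> space M" using X(3) y(1) by (auto simp: D_def)
    have "y \<notin> X" using y(3) h_refl[OF sp(2)] by auto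
    moreover have "\<forall>x\<in>X. h y x = 1" using y(3) sp h_commute by (metis subsetD)
    ultimately show ?case
      using X y by (intro exI[of _ "insert y X"]) auto
  qed
  \<comment> \<open>Every law shares at least \<open>1 / Suc j\<close> with \<mu>, so
    \<open>j + 2\<close> mutually singular ones would need more than the total mass.\<close>
  from this[of "Suc (Suc j)"] obtain X where X: "finite X" "card X = Suc (Suc j)" "X \<subseteq> D n j"
    "\<forall>x\<in>X. \<forall>y\<in>X. x \<noteq> y \<longrightarrow> h x y = 1" by (elim exE conjE) (rule that)
  have sp: "X \<subseteq> space M" using X(3) by (auto simp: D_def)
  have "real (card X) * (1 / real (Suc j)) \<le> 1"
  proof (rule card_mutually_singular[OF X(1) sp])
    show "tv_dist M (P n x) \<mu> \<le> 1 - 1 / real (Suc j)" if "x \<in> X" for x using that X(3) by (auto simp: D_def)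
    show "tv_dist M (P n x) (P n y) = 1" if "x \<in> X" "y \<in> X" "x \<noteq> y" for x y
      using h_le[of x y n] tv_dist_le_1[OF P_prob P_prob, of x y n n] X(4) that sp by fastforce
  qed
  then show False by (simp add: X(2) divide_simps)
qed

section \<open>Cyclic classes of merging points\<close>

context
  fixes x0
  assumes x0: "x0 \<in> space M"
begin

text \<open>The points whose chain eventually couples with the chain from \<open>x0\<close> observed \<open>n\<close> steps later.\<close>

definition merge_class :: "nat \<Rightarrow> 'a set" where
  "merge_class n = {y \<in> space M. lim_tv (P n x0) (return M y) = 0}"

lemma sets_merge_class [measurable]: "merge_class n \<in> sets M"
proof -
  have "(\<lambda>_. P n x0) \<in> M \<rightarrow>\<^sub>M prob_algebra M" using P_prob[OF x0] by simp
  then have [measurable]: "(\<lambda>y. lim_tv (P n x0) (return M y)) \<in> borel_measurable M"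
    by (rule measurable_lim_tv) measurable
  show ?thesis unfolding merge_class_def by measurable
qed

lemma merge_class_eqI:
  assumes "lim_tv (P m x0) (P n x0) = 0"
  shows "merge_class m = merge_class n"
proof -
  have "merge_class i \<subseteq> merge_class j" if 0: "lim_tv (P j x0) (P i x0) = 0" for i j
  proof
    fix y assume "y \<in> merge_class i"
    then have y: "y \<in> space M" "lim_tv (P i x0) (return M y) = 0" by (auto simp: merge_class_def)
    note in_alg = P_prob[OF x0] return_in_prob_algebra[OF y(1)]
    have "lim_tv (P j x0) (return M y) \<le> 0"
      using lim_tv_triangle[OF in_alg(1) in_alg(1) in_alg(2), of j i] 0 y(2) by simp
    then show "y \<in> merge_class j"
      using lim_tv_nonneg[OF in_alg(1) in_alg(2), of j] y(1) by (simp add: merge_class_def)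
  qed
  then show ?thesis using assms lim_tv_commute[OF P_prob[OF x0] P_prob[OF x0], of m n] by auto
qed

lemma merge_class_meet:
  assumes "y \<in> merge_class m" "y \<in> merge_class n"
  shows "lim_tv (P m x0) (P n x0) = 0"
proof -
  have y: "return M y \<in> space (prob_algebra M)" using assms(1) return_in_prob_algebra by (auto simp: merge_class_def)
  note Px0 = P_prob[OF x0]
  have "lim_tv (P m x0) (P n x0) \<le> 0"
    using lim_tv_triangle[OF Px0 y Px0, of m n] lim_tv_commute[OF Px0 y, of n] assms by (simp add: merge_class_def)
  then show ?thesis using lim_tv_nonneg[OF Px0 Px0, of m n] by simp
qed

text \<open>That \<open>K y\<close> as a whole merges with \<open>P (Suc n) x0\<close> does not yet
  say that almost every state drawn from it does. A typical companion \<open>y'\<close> in the same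
  class provides this: \<open>h y y' = 0\<close>, and by \<open>h_const\<close> almost all pairs of
  successors are again at distance zero. Positive measure of the class is what guarantees a
  companion.\<close>

lemma merge_class_step:
  assumes pos: "0 < measure \<mu> (merge_class n)"
  shows "AE y in \<mu>. y \<in> merge_class n \<longrightarrow> measure (K y) (merge_class (Suc n)) = 1"
  using \<mu>\<mu>.AE_pair[OF h_const]
proof eventually_elim
  case (elim y)
  show ?case
  proof
    assume yC: "y \<in> merge_class n"
    then have y: "y \<in> space M" by (simp add: merge_class_def)
    obtain y' where y'C: "y' \<in> merge_class n"
      and y': "\<forall>k. AE u in P k y. AE v in P k y'. h u v = h y y'"
      using AE_meets[OF elim sets_merge_class] pos by (metis fst_conv snd_conv less_irrefl)
    have y'M: "y' \<in> space M" using y'C by (simp add: merge_class_def)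
    note Px0 = P_prob[OF x0]
    note Ry = return_in_prob_algebra[OF y] and Ry' = return_in_prob_algebra[OF y'M]
    have "h y y' \<le> 0"
      using lim_tv_triangle[OF Ry Px0 Ry', of n] lim_tv_commute[OF Ry Px0, of n] yC y'C
      by (simp add: h_def merge_class_def)
    then have "h y y' = 0" using h_nonneg[OF y y'M] by simp
    with y'[rule_format, of 1] have AE_uv: "AE u in K y. AE v in K y'. h u v = 0"
      unfolding P_1[OF y] P_1[OF y'M] by simp
    have Ky: "K y \<in> space (prob_algebra M)" and Ky': "K y' \<in> space (prob_algebra M)"
      using measurable_space[OF kernel] y y'M by auto
    interpret prob_space "K y" by (rule prob_algebraD[OF Ky])
    have "AE u in K y. u \<in> merge_class (Suc n)"
      using AE_uv AE_space
    proof eventually_elim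
      case (elim u)
      then have u: "u \<in> space M" by (simp add: prob_algebraD[OF Ky])
      note Ru = return_in_prob_algebra[OF u]
      have 1: "lim_tv (P (Suc n) x0) (K y') = 0"
        using lim_tv_bind[OF Px0 Ry', of n 1] y'C
        unfolding return_bind_P[OF y'M] P_1[OF y'M] P_add[OF x0] by (simp add: merge_class_def)
      have "AE v in K y'. AE w in return M u. h v w = 0"
        using elim(1) AE_space
      proof eventually_elim
        case (elim v)
        have v: "v \<in> space M" using elim(2) by (simp add: prob_algebraD[OF Ky'])
        have "(AE w in return M u. h v w = 0) \<longleftrightarrow> h v u = 0"
          by (rule AE_return[OF u]) (use v in measurable)
        then show ?case using elim(1) h_commute[OF u v] by simp
      qed
      from lim_tv_const[OF Ky' Ru this] have "lim_tv (P (Suc n) x0) (return M u) \<le> 0"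
        using lim_tv_triangle[OF Px0 Ky' Ru, of "Suc n"] 1 by simp
      then show ?case using lim_tv_nonneg[OF Px0 Ru, of "Suc n"] u by (simp add: merge_class_def)
    qed
    then show "measure (K y) (merge_class (Suc n)) = 1"
      using sets_merge_class by (simp add: prob_eq_1 prob_algebraD[OF Ky])
  qed
qed

text \<open>Almost all of one class moves into the next with probability one, so by invariance the
  measure cannot drop along the classes.\<close>

lemma measure_merge_class_mono:
  assumes pos: "0 < measure \<mu> (merge_class 0)"
  shows "measure \<mu> (merge_class 0) \<le> measure \<mu> (merge_class n)"
proof (induction n)
  case (Suc n)
  then have pos_n: "0 < measure \<mu> (merge_class n)" using pos by simp
  have "measure \<mu> (merge_class n) = (\<integral>y. indicator (merge_class n) y \<partial>\<mu>)" by simp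
  also have "\<dots> \<le> (\<integral>y. measure (P 1 y) (merge_class (Suc n)) \<partial>\<mu>)"
  proof (rule integral_mono_AE)
    show "integrable \<mu> (indicat_real (merge_class n))" by (simp add: \<mu>.emeasure_eq_measure)
    show "integrable \<mu> (\<lambda>y. measure (P 1 y) (merge_class (Suc n)))"
      by (rule integrable_P_measure[OF sets_merge_class])
    show "AE y in \<mu>. indicat_real (merge_class n) y \<le> measure (P 1 y) (merge_class (Suc n))"
      using merge_class_step[OF pos_n] AE_space
      by eventually_elim (use P_1 in \<open>auto split: split_indicator\<close>)
  qed
  also have "\<dots> = measure \<mu> (merge_class (Suc n))" by (rule integral_P_measure[OF sets_merge_class])
  finally show ?case using Suc by simp
qed simp

text \<open>Infinitely many classes of measure bounded away from zero cannot be disjoint. Two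
  classes that meet are equal, since merging is transitive, and this closes the cycle.\<close>

lemma aperiodic_irreducible_merge:
  assumes irr: "irreducible_kernel M K" and aper: "aperiodic M K \<mu>"
    and pos0: "0 < measure \<mu> (merge_class 0)"
  shows "\<exists>n. AE y in \<mu>. y \<in> merge_class n"
proof -
  let ?C = merge_class
  define R where "R m n \<longleftrightarrow> lim_tv (P m x0) (P n x0) = 0" for m n
  have pos: "0 < measure \<mu> (?C n)" for n
    using measure_merge_class_mono[OF pos0, of n] pos0 by simp
  have "\<exists>m n. m < n \<and> ?C m \<inter> ?C n \<noteq> {}"
  proof (rule ccontr)
    assume "\<not> ?thesis"
    then have disj: "disjoint_family_on ?C UNIV"
      unfolding disjoint_family_on_def by (metis Int_commute linorder_neqE_nat)
    let ?c = "measure \<mu> (?C 0)"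
    obtain N where N: "1 < real N * ?c" using pos0 reals_Archimedean3 by blast
    have "real N * ?c \<le> (\<Sum>n<N. measure \<mu> (?C n))"
      using sum_mono[of "{..<N}" "\<lambda>_. ?c" "\<lambda>n. measure \<mu> (?C n)"] measure_merge_class_mono[OF pos0] by simp
    also have "\<dots> = measure \<mu> (\<Union>n<N. ?C n)"
      using disj by (intro \<mu>.finite_measure_finite_Union[symmetric]) (auto simp: disjoint_family_on_def)
    also have "\<dots> \<le> 1" by simp
    finally show False using N by simp
  qed
  then obtain m n y where mn: "m < n" and y: "y \<in> ?C m" "y \<in> ?C n" by blast
  have "R m n" using merge_class_meet[OF y] by (simp add: R_def)
  with mn have ex: "\<exists>d>0. \<exists>i. R i (i + d)" by (intro exI[of _ "n - m"]) (auto intro!: exI[of _ m])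
  \<comment> \<open>The gap is minimal over all starting times \<open>i\<close>, which makes any two
    of the \<open>d\<close> classes from time \<open>i\<close> on disjoint.\<close>
  define d where "d = (LEAST d. 0 < d \<and> (\<exists>i. R i (i + d)))"
  have d: "0 < d \<and> (\<exists>i. R i (i + d))" unfolding d_def by (rule LeastI_ex) (use ex in blast)
  then obtain i where i: "R i (i + d)" by blast
  have least: "\<not> R j (j + e)" if "0 < e" "e < d" for j e
    using that not_less_Least[of e "\<lambda>d. 0 < d \<and> (\<exists>i. R i (i + d))"] unfolding d_def by blast
  have cycle: "?C (i + d) = ?C i" using merge_class_eqI i by (simp add: R_def)
  \<comment> \<open>Periodicity asks for transition probability one at every point of a class, not
    almost every. \<open>N0\<close> collects the failures and \<open>N\<close> the points from which
    a failure can be reached; deleting the null set \<open>N\<close> leaves classes that map into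
    each other without exception.\<close>
  define N0 where "N0 = {y \<in> space M. \<exists>n. y \<in> ?C n \<and> measure (K y) (?C (Suc n)) \<noteq> 1}"
  have [measurable]: "(\<lambda>y. measure (K y) (?C n)) \<in> borel_measurable M" for n
    by (rule measurable_measure_kernel[OF kernel sets_merge_class])
  have N0: "N0 \<in> sets M" unfolding N0_def by measurable
  have "AE y in \<mu>. \<forall>n. y \<in> ?C n \<longrightarrow> measure (K y) (?C (Suc n)) = 1"
    unfolding AE_all_countable using merge_class_step[OF pos] by blast
  then have "AE y in \<mu>. y \<notin> N0" by eventually_elim (auto simp: N0_def)
  then have N0_null: "measure \<mu> N0 = 0" using N0 by (simp add: \<mu>.prob_eq_0)
  define N where "N = {y \<in> space M. \<exists>m. measure (P m y) N0 \<noteq> 0}"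
  have [measurable]: "(\<lambda>y. measure (P m y) N0) \<in> borel_measurable M" for m
    by (rule measurable_measure_kernel[OF measurable_P N0])
  have N: "N \<in> sets M" unfolding N_def by measurable
  have "AE y in \<mu>. \<forall>m. measure (P m y) N0 = 0"
    unfolding AE_all_countable
    using integral_nonneg_eq_0_iff_AE[OF integrable_P_measure[OF N0]] integral_P_measure[OF N0] N0_null by simp
  then have N_AE: "AE y in \<mu>. y \<notin> N" by eventually_elim (auto simp: N_def)
  have N0N: "y \<in> N" if "y \<in> N0" for y
  proof -
    have y: "y \<in> space M" using that by (simp add: N0_def)
    then have "measure (P 0 y) N0 \<noteq> 0" using that N0 by (simp add: measure_return)
    then show ?thesis using y unfolding N_def by blast
  qed
  have step: "emeasure (K y) (?C (Suc n) - N) = 1" if y: "y \<in> ?C n" "y \<notin> N" for y n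
  proof -
    have yM: "y \<in> space M" using y(1) by (simp add: merge_class_def)
    have Ky: "K y \<in> space (prob_algebra M)" by (rule measurable_space[OF kernel yM])
    interpret prob_space "K y" by (rule prob_algebraD[OF Ky])
    have "y \<notin> N0" using y(2) N0N by blast
    then have "measure (K y) (?C (Suc n)) = 1" using y(1) yM by (auto simp: N0_def)
    then have 1: "AE u in K y. u \<in> ?C (Suc n)" by (simp add: prob_eq_1 prob_algebraD[OF Ky])
    have "AE u in K y. \<forall>m. measure (P m u) N0 = 0"
      unfolding AE_all_countable
    proof
      fix m
      have "measure (P (1 + m) y) N0 = 0" using y(2) yM unfolding N_def by blast
      from measure_P_add_eq_0[OF yM N0 this] show "AE u in K y. measure (P m u) N0 = 0"
        unfolding P_1[OF yM] .
    qed
    then have "AE u in K y. u \<notin> N" by eventually_elim (auto simp: N_def)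
    with 1 have "AE u in K y. u \<in> ?C (Suc n) - N" by eventually_elim simp
    then show ?thesis using N by (subst emeasure_eq_1_AE) (auto simp: prob_algebraD[OF Ky])
  qed
  define E where "E j = ?C (i + (j - 1)) - N" for j
  have E: "E j \<in> sets M" for j unfolding E_def using N by auto
  have E_next: "E (j mod d + 1) = ?C (Suc (i + (j - 1))) - N" if j: "j \<in> {1..d}" for j
  proof (cases "j = d")
    case True
    then show ?thesis using cycle d by (simp add: E_def)
  next
    case False
    then show ?thesis using j by (simp add: E_def)
  qed
  have E_step: "emeasure (K y) (E (j mod d + 1)) = 1" if "j \<in> {1..d}" "y \<in> E j" for j y
    unfolding E_next[OF that(1)] using that(2) by (intro step) (auto simp: E_def)
  have E_pos: "emeasure \<mu> (E 1) > 0"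
  proof -
    have "measure \<mu> (E 1) = measure \<mu> (?C i)"
      unfolding E_def by (rule \<mu>.finite_measure_eq_AE) (use N_AE N in \<open>auto elim!: eventually_mono\<close>)
    then show ?thesis using pos[of i] by (simp add: \<mu>.emeasure_eq_measure)
  qed
  have disj: "disjoint_family_on E {1..d}"
  proof -
    have lt: "E a \<inter> E b = {}" if "a \<in> {1..d}" "b \<in> {1..d}" "a < b" for a b
    proof (rule ccontr)
      assume "E a \<inter> E b \<noteq> {}"
      then have "R (i + (a - 1)) (i + (b - 1))" using merge_class_meet by (auto simp: R_def E_def)
      moreover have "i + (b - 1) = i + (a - 1) + (b - a)" using that by simp
      moreover have "0 < b - a" "b - a < d" using that by auto
      note least[OF this, of "i + (a - 1)"]
      ultimately show False by (simp only:)
    qed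
    show ?thesis
      unfolding disjoint_family_on_def
    proof (intro ballI impI)
      fix a b assume ab: "a \<in> {1..d}" "b \<in> {1..d}" "a \<noteq> b"
      show "E a \<inter> E b = {}"
        using ab(3) lt[OF ab(1,2)] lt[OF ab(2,1)] by (cases "a < b") (simp_all add: Int_commute)
    qed
  qed
  have "\<not> 2 \<le> d"
  proof
    assume "2 \<le> d"
    moreover have "periodic M K \<mu> d"
      unfolding periodic_def by (intro exI[of _ E] conjI ballI E disj E_pos E_step)
    ultimately show False using aper by (simp add: aperiodic_def)
  qed
  \<comment> \<open>A cycle of length one is a single absorbing set; its complement is not reached
    from inside and is therefore null by \<open>\<mu>_reach\<close>.\<close>
  then have d1: "d = 1" using d by simp
  have abs: "measure (P n y) (E 1) = 1" if "y \<in> E 1" for n y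
    using periodic_P[of d E 1 y n] E E_step d1 that by simp
  have "E 1 \<noteq> {}" using E_pos by auto
  then obtain y where y: "y \<in> E 1" by blast
  have yM: "y \<in> space M" using y sets.sets_into_space[OF E] by blast
  have "measure (P n y) (space M - E 1) = 0" for n
    using prob_space.prob_compl[OF prob_algebraD(1)[OF P_prob[OF yM]], of "E 1" n] E abs[OF y]
    by (simp add: prob_algebraD[OF P_prob[OF yM]])
  then have "\<not> 0 < measure \<mu> (space M - E 1)" using \<mu>_reach[OF irr _ _ yM, of "space M - E 1"] E by auto
  then have "measure \<mu> (space M - E 1) = 0" by (simp add: zero_less_measure_iff)
  then have "AE y in \<mu>. y \<notin> space M - E 1" using E by (subst (asm) \<mu>.prob_eq_0) auto
  then have "AE y in \<mu>. y \<in> ?C i" using AE_space by eventually_elim (auto simp: E_def)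
  then show ?thesis ..
qed

end

lemma B2_imp_A2:
  assumes "cond_B2 M K \<mu>"
  shows "cond_A2 M K"
proof (rule P2_imp_A2)
  have aper: "aperiodic M K \<mu>" and irr: "irreducible_kernel M K" using assms by (auto simp: cond_B2_def)
  have mh [measurable]: "(\<lambda>z. h (fst z) (snd z)) \<in> borel_measurable (\<mu> \<Otimes>\<^sub>M \<mu>)"
    using measurable_h unfolding split_beta' measurable_cong_sets[OF sets_pair_measure_cong[OF sets_\<mu> sets_\<mu>] refl] .
  \<comment> \<open>Otherwise \<open>h\<close> would be nonzero for almost every pair, hence equal
    to one by the zero-one law, against \<open>not_AE_h_eq_1\<close>.\<close>
  have "\<exists>x0\<in>space M. \<not> (AE y in \<mu>. h x0 y \<noteq> 0)"
  proof (rule ccontr)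
    assume "\<not> ?thesis"
    then have "AE x in \<mu>. AE y in \<mu>. h x y \<noteq> 0" by (intro AE_I2[of \<mu> "\<lambda>x. AE y in \<mu>. h x y \<noteq> 0"]) simp
    moreover have "{z \<in> space (\<mu> \<Otimes>\<^sub>M \<mu>). h (fst z) (snd z) \<noteq> 0} \<in> sets (\<mu> \<Otimes>\<^sub>M \<mu>)" by measurable
    ultimately have "AE z in \<mu> \<Otimes>\<^sub>M \<mu>. h (fst z) (snd z) \<noteq> 0"
      by (intro \<mu>\<mu>.AE_pair_measure) simp_all
    with h_zero_one have "AE z in \<mu> \<Otimes>\<^sub>M \<mu>. h (fst z) (snd z) = 1" by eventually_elim auto
    then show False using not_AE_h_eq_1[OF irr] by simp
  qed
  then obtain x0 where x0: "x0 \<in> space M" "\<not> (AE y in \<mu>. h x0 y \<noteq> 0)" by blast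
  have "measure \<mu> (merge_class x0 0) \<noteq> 0"
  proof
    assume "measure \<mu> (merge_class x0 0) = 0"
    then have "AE y in \<mu>. y \<notin> merge_class x0 0" using sets_merge_class[OF x0(1)] by (simp add: \<mu>.prob_eq_0)
    then have "AE y in \<mu>. h x0 y \<noteq> 0"
      using AE_space by eventually_elim (simp add: merge_class_def[OF x0(1)] h_def)
    with x0 show False by simp
  qed
  then have "0 < measure \<mu> (merge_class x0 0)" by (simp add: zero_less_measure_iff)
  then obtain n where n: "AE y in \<mu>. y \<in> merge_class x0 n"
    using aperiodic_irreducible_merge[OF x0(1) irr aper] by blast
  have "AE x in \<mu>. AE y in \<mu>. h x y = 0"
    using n
  proof eventually_elim
    case (elim x)
    show ?case
      using n
    proof eventually_elim
      case (elim y)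
      have xy: "x \<in> space M" "y \<in> space M"
        "lim_tv (P n x0) (return M x) = 0" "lim_tv (P n x0) (return M y) = 0"
        using elim \<open>x \<in> merge_class x0 n\<close> by (auto simp: merge_class_def[OF x0(1)])
      note Rx = return_in_prob_algebra[OF xy(1)] and Ry = return_in_prob_algebra[OF xy(2)]
      have "h x y \<le> 0"
        using lim_tv_triangle[OF Rx P_prob[OF x0(1)] Ry, of n] lim_tv_commute[OF Rx P_prob[OF x0(1)], of n] xy(3,4)
        by (simp add: h_def)
      then show ?case using h_nonneg[OF xy(1,2)] by simp
    qed
  qed
  moreover have "{z \<in> space (\<mu> \<Otimes>\<^sub>M \<mu>). h (fst z) (snd z) = 0} \<in> sets (\<mu> \<Otimes>\<^sub>M \<mu>)" by measurable
  ultimately have "AE z in \<mu> \<Otimes>\<^sub>M \<mu>. h (fst z) (snd z) = 0"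
    by (intro \<mu>\<mu>.AE_pair_measure) simp_all
  note conv = convergence_AE[OF this]
  show "cond_P2 M K \<mu>"
    unfolding cond_P2_def
  proof (intro conjI conv ballI)
    fix x assume x: "x \<in> space M"
    \<comment> \<open>Overlap at a single time suffices, because the distance to the invariant law
      does not increase.\<close>
    obtain n where "tv_dist M (P n x) \<mu> < 1" using irreducible_overlap[OF irr x] by blast
    then have "lim_tv (return M x) \<mu> < 1"
      using lim_tv_le[OF return_in_prob_algebra[OF x] \<mu>, of n] by (simp add: return_bind_P[OF x] \<mu>_bind_P)
    then show "\<exists>l<1. (\<lambda>n. tv_dist M (P n x) \<mu>) \<longlonglongrightarrow> l" using tv_P_\<mu>_lim[OF x] by blast
  qed
qed

lemma A2_iff_B2: "cond_A2 M K \<longleftrightarrow> cond_B2 M K \<mu>"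
proof
  assume "cond_A2 M K"
  then show "cond_B2 M K \<mu>"
    unfolding cond_B2_def by (intro conjI A2_imp_aperiodic A2_imp_irreducible)
next
  assume "cond_B2 M K \<mu>"
  then show "cond_A2 M K" by (rule B2_imp_A2)
qed

end

section \<open>Gluing along a common future\<close>

lemma AE_le_of_density_le:
  fixes f g :: "'a \<Rightarrow> real"
  assumes L: "sets L = sets M"
    and f: "f \<in> borel_measurable M" "\<And>x. 0 \<le> f x" "finite_measure (density L (\<lambda>x. ennreal (f x)))"
    and g: "g \<in> borel_measurable M" "\<And>x. 0 \<le> g x" "finite_measure (density L (\<lambda>x. ennreal (g x)))"
    and le: "\<And>A. A \<in> sets M \<Longrightarrow> emeasure (density L (\<lambda>x. ennreal (f x))) A \<le> emeasure (density L (\<lambda>x. ennreal (g x))) A"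
  shows "AE x in L. f x \<le> g x"
proof -
  note [measurable] = f(1) g(1)
  have sp: "space L = space M" using L by (rule sets_eq_imp_space_eq)
  let ?A = "{x \<in> space M. g x < f x}"
  have A: "?A \<in> sets M" by measurable
  note diff = measure_diff_density[OF L f g A]
  have "measure (density L (\<lambda>x. ennreal (f x))) ?A \<le> measure (density L (\<lambda>x. ennreal (g x))) ?A"
    using le[OF A] by (simp add: finite_measure.emeasure_eq_measure[OF f(3)] finite_measure.emeasure_eq_measure[OF g(3)])
  then have "(\<integral>x. indicator ?A x * (f x - g x) \<partial>L) \<le> 0" using diff(2) by linarith
  moreover have nn: "AE x in L. 0 \<le> indicator ?A x * (f x - g x)" by (auto split: split_indicator)
  ultimately have "(\<integral>x. indicator ?A x * (f x - g x) \<partial>L) = 0"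
    using integral_nonneg_AE[OF nn] by linarith
  then have "AE x in L. indicator ?A x * (f x - g x) = 0"
    using integral_nonneg_eq_0_iff_AE[OF diff(1) nn] by simp
  then show ?thesis
    using AE_space by eventually_elim (auto simp: sp indicator_def split: if_splits)
qed

section \<open>Regenerating a variable by conditional quantiles\<close>

abbreviation unif :: "real measure" where "unif \<equiv> uniform_measure lborel {0..1}"

lemma prob_space_unif: "prob_space unif"
  by (rule prob_space_uniform_measure) auto

lemma emeasure_unif_atMost:
  assumes "0 \<le> c" "c \<le> 1"
  shows "emeasure unif {..c} = ennreal c"
proof -
  have "{0..1} \<inter> {..c} = {0..c}" using assms by auto
  then show ?thesis using assms by (simp add: emeasure_uniform_measure divide_ennreal_def)
qed

text \<open>Half-lines in the second factor match the tail probabilities produced by a quantile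
  function. For fixed \<open>A\<close> they determine a finite measure on the line, and rectangles
  then determine the product.\<close>

lemma pair_measure_eqI_greaterThan:
  fixes P Q :: "('a \<times> real) measure"
  assumes P: "finite_measure P" "sets P = sets (N \<Otimes>\<^sub>M borel)"
    and Q: "finite_measure Q" "sets Q = sets (N \<Otimes>\<^sub>M borel)"
    and eq: "\<And>A t. A \<in> sets N \<Longrightarrow> emeasure P (A \<times> {t<..}) = emeasure Q (A \<times> {t<..})"
  shows "P = Q"
proof -
  interpret P: finite_measure P by fact
  interpret Q: finite_measure Q by fact
  let ?m = "\<lambda>R A. distr (density R (indicator (A \<times> UNIV))) borel snd"
  have m: "emeasure (?m R A) B = emeasure R (A \<times> B)"
    if R: "sets R = sets (N \<Otimes>\<^sub>M borel)" and A: "A \<in> sets N" and B: "B \<in> sets borel" for R A and B :: "real set"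
  proof -
    have sp: "space R = space N \<times> UNIV" using sets_eq_imp_space_eq[OF R] by (simp add: space_pair_measure)
    have snd: "snd \<in> density R (indicator (A \<times> UNIV)) \<rightarrow>\<^sub>M borel"
      using R by (simp cong: measurable_cong_sets)
    have AU: "A \<times> UNIV \<in> sets R" using R A by simp
    have NB: "space N \<times> B \<in> sets R" using R B by simp
    have "emeasure (?m R A) B = emeasure (density R (indicator (A \<times> UNIV))) (snd -` B \<inter> space R)"
      using emeasure_distr[OF snd B] by simp
    also have "snd -` B \<inter> space R = space N \<times> B" by (auto simp: sp)
    also have "emeasure (density R (indicator (A \<times> UNIV))) (space N \<times> B) = emeasure R ((A \<times> UNIV) \<inter> (space N \<times> B))"
      by (rule emeasure_restricted[OF AU NB])
    also have "(A \<times> UNIV) \<inter> (space N \<times> B) = A \<times> B" using sets.sets_into_space[OF A] by auto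
    finally show ?thesis .
  qed
  have AB: "emeasure P (A \<times> B) = emeasure Q (A \<times> B)" if A: "A \<in> sets N" and B: "B \<in> sets borel" for A B
  proof -
    have "?m P A = ?m Q A"
    proof (rule measure_eqI_lessThan)
      fix t :: real
      show "emeasure (?m P A) {t<..} < \<infinity>"
        by (simp add: m[OF P(2) A] less_top[symmetric])
      show "emeasure (?m P A) {t<..} = emeasure (?m Q A) {t<..}"
        by (simp add: m[OF P(2) A] m[OF Q(2) A] eq[OF A])
    qed simp_all
    then show ?thesis using m[OF P(2) A B] m[OF Q(2) A B] by simp
  qed
  let ?E = "{a \<times> b | a b. a \<in> sets N \<and> b \<in> sets (borel :: real measure)}"
  show ?thesis
  proof (rule measure_eqI_generator_eq[OF Int_stable_pair_measure_generator[of N "borel :: real measure"], where A="\<lambda>_. space N \<times> UNIV"])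
    show "?E \<subseteq> Pow (space N \<times> UNIV)" using sets.space_closed[of N] by auto
    show "sets P = sigma_sets (space N \<times> UNIV) ?E" "sets Q = sigma_sets (space N \<times> UNIV) ?E"
      using P(2) Q(2) by (simp_all add: sets_pair_measure)
    show "emeasure P X = emeasure Q X" if "X \<in> ?E" for X using that AB by auto
    show "range (\<lambda>_. space N \<times> UNIV) \<subseteq> ?E"
      using sets.top[of N] by (auto intro!: exI[of _ "space N"] exI[of _ "UNIV :: real set"])
    show "(\<Union>i::nat. space N \<times> UNIV) = space N \<times> UNIV" by simp
    show "emeasure P (space N \<times> UNIV) \<noteq> \<infinity>" by simp
  qed
qed

text \<open>\<open>V\<close> is regenerated from \<open>Z\<close> and an independent uniform variable by inverting the
  conditional tail probabilities \<open>F q\<close> of \<open>V > q\<close> given \<open>Z\<close>. As \<open>g\<close> only involves rational \<open>q\<close>,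
  the versions \<open>F q\<close> need not be regularised in \<open>q\<close>.\<close>

lemma quantile_transfer:
  fixes V :: "'w \<Rightarrow> real"
  assumes p: "finite_measure p" and Z: "Z \<in> p \<rightarrow>\<^sub>M N" and V: "V \<in> borel_measurable p"
    and V01: "\<And>\<omega>. \<omega> \<in> space p \<Longrightarrow> 0 \<le> V \<omega>" "\<And>\<omega>. \<omega> \<in> space p \<Longrightarrow> V \<omega> \<le> 1"
  obtains g where "(\<lambda>(z, u). g z u) \<in> borel_measurable (N \<Otimes>\<^sub>M borel)"
    "distr (distr p N Z \<Otimes>\<^sub>M unif) (N \<Otimes>\<^sub>M borel) (\<lambda>(z, u). (z, g z u)) = distr p (N \<Otimes>\<^sub>M borel) (\<lambda>\<omega>. (Z \<omega>, V \<omega>))"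
proof -
  interpret p: finite_measure p by fact
  interpret U: prob_space unif by (rule prob_space_unif)
  note [measurable] = Z V
  define k where "k = distr p N Z"
  have sets_k [measurable_cong, simp]: "sets k = sets N" and space_k [simp]: "space k = space N"
    by (simp_all add: k_def)
  interpret k: finite_measure k unfolding k_def by (rule p.finite_measure_distr[OF Z])
  \<comment> \<open>The law of \<open>Z\<close> restricted to the event \<open>q < V\<close> is
    dominated by the law of \<open>Z\<close>; its density is a version of the conditional
    probability of that event given \<open>Z\<close>.\<close>
  have "\<exists>f. f \<in> borel_measurable N \<and> (\<forall>z. 0 \<le> f z) \<and>
      (\<forall>A\<in>sets N. emeasure (density k (\<lambda>z. ennreal (f z))) A = emeasure p {\<omega> \<in> space p. Z \<omega> \<in> A \<and> q < V \<omega>})" for q :: real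
  proof -
    let ?S = "{\<omega> \<in> space p. q < V \<omega>}"
    define r where "r = distr (density p (indicator ?S)) N Z"
    have Z': "Z \<in> density p (indicator ?S) \<rightarrow>\<^sub>M N" by simp
    have r: "emeasure r A = emeasure p {\<omega> \<in> space p. Z \<omega> \<in> A \<and> q < V \<omega>}" if A: "A \<in> sets N" for A
    proof -
      have "emeasure r A = emeasure (density p (indicator ?S)) (Z -` A \<inter> space p)"
        unfolding r_def using emeasure_distr[OF Z' A] by simp
      also have "\<dots> = emeasure p (?S \<inter> (Z -` A \<inter> space p))"
        by (rule emeasure_restricted) (use A in measurable)
      also have "?S \<inter> (Z -` A \<inter> space p) = {\<omega> \<in> space p. Z \<omega> \<in> A \<and> q < V \<omega>}" by auto
      finally show ?thesis .
    qed
    have k: "emeasure k A = emeasure p {\<omega> \<in> space p. Z \<omega> \<in> A}" if "A \<in> sets N" for A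
      unfolding k_def using that by (simp add: emeasure_distr vimage_def Int_def conj_commute)
    have sets_r: "sets r = sets k" by (simp add: r_def)
    have le: "emeasure r A \<le> emeasure k A" if A: "A \<in> sets N" for A
      unfolding r[OF A] k[OF A] using A by (intro emeasure_mono) auto
    have fin: "finite_measure r"
      by (rule finite_measureI) (use le[of "space N"] k.emeasure_finite[of "space N"] in \<open>auto simp: r_def top_unique\<close>)
    have ac: "absolutely_continuous k r"
      unfolding absolutely_continuous_def null_sets_def using le sets_r by (auto simp: k_def) (metis le_zero_eq)
    obtain f where f: "f \<in> borel_measurable k" "AE z in k. RN_deriv k r z = ennreal (f z)" "\<And>z. 0 \<le> f z"
      using k.real_RN_deriv[OF fin ac sets_r] by metis
    have "r = density k (RN_deriv k r)" using k.density_RN_deriv[OF ac sets_r] by simp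
    also have "\<dots> = density k (\<lambda>z. ennreal (f z))" using f by (intro density_cong) auto
    finally show ?thesis using f r by (intro exI[of _ f]) (auto cong: measurable_cong_sets)
  qed
  then have "\<forall>q::real. \<exists>f. f \<in> borel_measurable N \<and> (\<forall>z. 0 \<le> f z) \<and>
      (\<forall>A\<in>sets N. emeasure (density k (\<lambda>z. ennreal (f z))) A = emeasure p {\<omega> \<in> space p. Z \<omega> \<in> A \<and> q < V \<omega>})" ..
  from choice[OF this] obtain F where F_all: "\<forall>q::real. F q \<in> borel_measurable N \<and> (\<forall>z. 0 \<le> F q z) \<and>
      (\<forall>A\<in>sets N. emeasure (density k (\<lambda>z. ennreal (F q z))) A = emeasure p {\<omega> \<in> space p. Z \<omega> \<in> A \<and> q < V \<omega>})" ..
  have F [measurable]: "\<And>q. F q \<in> borel_measurable N" and F0: "\<And>q z. 0 \<le> F q z"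
    using F_all by simp_all
  have dens: "emeasure (density k (\<lambda>z. ennreal (F q z))) A = emeasure p {\<omega> \<in> space p. Z \<omega> \<in> A \<and> q < V \<omega>}"
    if "A \<in> sets N" for q A
    using F_all that by simp
  have fin: "finite_measure (density k (\<lambda>z. ennreal (F q z)))" for q
    by (rule finite_measureI) (use dens[of "space N" q] in simp)
  have anti: "AE z in k. F r z \<le> F q z" if "q \<le> r" for q r
  proof (rule AE_le_of_density_le[OF sets_k F F0 fin F F0 fin])
    fix A assume A: "A \<in> sets N"
    show "emeasure (density k (\<lambda>z. ennreal (F r z))) A \<le> emeasure (density k (\<lambda>z. ennreal (F q z))) A"
      unfolding dens[OF A] using A that by (intro emeasure_mono) auto
  qed
  have F1: "AE z in k. F q z \<le> 1" for q
  proof (rule AE_le_of_density_le[OF sets_k F F0 fin])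
    have k1: "density k (\<lambda>z. ennreal 1) = k" by (simp add: density_1)
    show "finite_measure (density k (\<lambda>z. ennreal 1))" unfolding k1 by unfold_locales
    fix A assume A: "A \<in> sets N"
    show "emeasure (density k (\<lambda>z. ennreal (F q z))) A \<le> emeasure (density k (\<lambda>z. ennreal 1)) A"
    proof -
      have kA: "emeasure k A = emeasure p (Z -` A \<inter> space p)" unfolding k_def by (rule emeasure_distr[OF Z A])
      show ?thesis unfolding dens[OF A] k1 kA using A by (intro emeasure_mono) auto
    qed
  qed simp_all
  define T where "T z u = {real_of_rat q | q. 0 \<le> q \<and> q \<le> 1 \<and> u \<le> F (real_of_rat q) z}" for z u
  \<comment> \<open>Inserting \<open>0\<close> keeps the set nonempty when no rational level
    qualifies, and \<open>0\<close> is the smallest value \<open>V\<close> can take.\<close>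
  define g where "g z u = Sup (insert 0 (T z u))" for z u
  have bdd: "bdd_above (insert 0 (T z u))" for z u
    by (auto intro!: bdd_aboveI[of _ 1] simp: T_def)
  have g_less: "t < g z u \<longleftrightarrow> t < 0 \<or> (\<exists>q::rat. 0 \<le> q \<and> q \<le> 1 \<and> u \<le> F (real_of_rat q) z \<and> t < real_of_rat q)" for t z u
    unfolding g_def less_cSup_iff[OF insert_not_empty bdd] by (auto simp: T_def)
  have g_meas [measurable]: "(\<lambda>(z, u). g z u) \<in> borel_measurable (N \<Otimes>\<^sub>M borel)"
    unfolding split_beta' borel_measurable_iff_greater g_less by (intro allI) measurable
  have pair: "(\<lambda>(z, u). (z, g z u)) \<in> k \<Otimes>\<^sub>M unif \<rightarrow>\<^sub>M N \<Otimes>\<^sub>M borel"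
    by measurable
  have "distr (k \<Otimes>\<^sub>M unif) (N \<Otimes>\<^sub>M borel) (\<lambda>(z, u). (z, g z u)) = distr p (N \<Otimes>\<^sub>M borel) (\<lambda>\<omega>. (Z \<omega>, V \<omega>))"
  proof (rule pair_measure_eqI_greaterThan)
    interpret kU: pair_sigma_finite k unif ..
    have "finite_measure (k \<Otimes>\<^sub>M unif)" by (intro finite_measure_pair_measure) unfold_locales
    then show "finite_measure (distr (k \<Otimes>\<^sub>M unif) (N \<Otimes>\<^sub>M borel) (\<lambda>(z, u). (z, g z u)))"
      by (rule finite_measure.finite_measure_distr[OF _ pair])
    show "finite_measure (distr p (N \<Otimes>\<^sub>M borel) (\<lambda>\<omega>. (Z \<omega>, V \<omega>)))"
      by (rule p.finite_measure_distr) measurable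
    fix A and t :: real assume A [measurable]: "A \<in> sets N"
    have AM: "A \<subseteq> space N" by (rule sets.sets_into_space[OF A])
    have At: "A \<times> {t<..} \<in> sets (N \<Otimes>\<^sub>M borel)" by simp
    let ?E = "{w \<in> space (N \<Otimes>\<^sub>M (borel::real measure)). fst w \<in> A \<and> t < g (fst w) (snd w)}"
    have E: "?E \<in> sets (k \<Otimes>\<^sub>M unif)"
      using g_meas by (simp add: split_beta' cong: sets_pair_measure_cong)
    have "emeasure (distr (k \<Otimes>\<^sub>M unif) (N \<Otimes>\<^sub>M borel) (\<lambda>(z, u). (z, g z u))) (A \<times> {t<..}) = emeasure (k \<Otimes>\<^sub>M unif) ?E"
      unfolding emeasure_distr[OF pair At]
      by (rule arg_cong[where f="emeasure _"]) (auto simp: space_pair_measure)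
    also have "\<dots> = (\<integral>\<^sup>+z. emeasure unif (Pair z -` ?E) \<partial>k)"
      by (rule U.emeasure_pair_measure_alt[OF E])
    also have "\<dots> = (\<integral>\<^sup>+z. indicator A z * emeasure unif {u. t < g z u} \<partial>k)"
      using AM by (intro nn_integral_cong) (auto simp: space_pair_measure vimage_def split: split_indicator)
    finally have lhs: "emeasure (distr (k \<Otimes>\<^sub>M unif) (N \<Otimes>\<^sub>M borel) (\<lambda>(z, u). (z, g z u))) (A \<times> {t<..})
        = (\<integral>\<^sup>+z. indicator A z * emeasure unif {u. t < g z u} \<partial>k)" .
    have pairZV: "(\<lambda>\<omega>. (Z \<omega>, V \<omega>)) \<in> p \<rightarrow>\<^sub>M N \<Otimes>\<^sub>M borel" by measurable
    have rhs: "emeasure (distr p (N \<Otimes>\<^sub>M borel) (\<lambda>\<omega>. (Z \<omega>, V \<omega>))) (A \<times> {t<..}) = emeasure p {\<omega> \<in> space p. Z \<omega> \<in> A \<and> t < V \<omega>}"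
      unfolding emeasure_distr[OF pairZV At] by (rule arg_cong[where f="emeasure p"]) auto
    consider "t < 0" | "1 \<le> t" | "0 \<le> t" "t < 1" by linarith
    then show "emeasure (distr (k \<Otimes>\<^sub>M unif) (N \<Otimes>\<^sub>M borel) (\<lambda>(z, u). (z, g z u))) (A \<times> {t<..})
        = emeasure (distr p (N \<Otimes>\<^sub>M borel) (\<lambda>\<omega>. (Z \<omega>, V \<omega>))) (A \<times> {t<..})"
    proof cases
      case 1
      have "emeasure unif {u. t < g z u} = 1" for z
        using U.emeasure_space_1 1 by (simp add: g_less)
      then have "(\<integral>\<^sup>+z. indicator A z * emeasure unif {u. t < g z u} \<partial>k) = emeasure k A" by simp
      also have "\<dots> = emeasure p {\<omega> \<in> space p. Z \<omega> \<in> A \<and> t < V \<omega>}"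
        unfolding k_def emeasure_distr[OF Z A] using V01(1) 1
        by (intro arg_cong[where f="emeasure p"]) force
      finally show ?thesis using lhs rhs by simp
    next
      case 2
      have "\<not> t < g z u" for z u
      proof
        assume "t < g z u"
        then obtain q :: rat where "q \<le> 1" "t < real_of_rat q" using 2 by (auto simp: g_less)
        moreover from this(1) have "real_of_rat q \<le> 1" by simp
        ultimately show False using 2 by linarith
      qed
      moreover have "{\<omega> \<in> space p. Z \<omega> \<in> A \<and> t < V \<omega>} = {}" using V01(2) 2 by force
      ultimately show ?thesis unfolding lhs rhs by (simp only:) simp
    next
      case 3
      \<comment> \<open>The levels decrease to \<open>t\<close>, and the summand \<open>2\<close>
        keeps even the first one strictly below one.\<close>
      define v where "v n = t + (1 - t) / real (n + 2)" for n
      have v: "t < v n" "v n < 1" for n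
        using 3 divide_strict_left_mono[of 1 "real (n + 2)" "1 - t"] by (auto simp: v_def)
      have v_anti: "v n \<le> v m" if "m \<le> n" for m n
        using that 3 by (auto simp: v_def intro!: divide_left_mono)
      have v_lim: "\<exists>n. v n \<le> s" if "t < s" for s
      proof -
        obtain n where "(1 - t) / (s - t) < real n" using reals_Archimedean2 by blast
        then have "1 - t < (s - t) * real (n + 2)" using that by (simp add: field_simps)
        then have "v n \<le> s" using that by (simp add: v_def field_simps)
        then show ?thesis ..
      qed
      \<comment> \<open>Monotonicity in the level is only known almost everywhere for each pair of
        levels; the countably many pairs used below share one null set.\<close>
      have good: "AE z in k. (\<forall>n. F (v n) z \<le> 1) \<and> (\<forall>n. F (v n) z \<le> F (v (Suc n)) z) \<and>
          (\<forall>n (q::rat). (v n \<le> real_of_rat q \<longrightarrow> F (real_of_rat q) z \<le> F (v n) z) \<and>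
                 (real_of_rat q \<le> v n \<longrightarrow> F (v n) z \<le> F (real_of_rat q) z))"
        unfolding AE_conj_iff AE_all_countable using F1 anti v_anti by auto
      have inner: "AE z in k. emeasure unif {u. t < g z u} = (SUP n. ennreal (F (v n) z))"
        using good
      proof eventually_elim
        case (elim z)
        have "{u. t < g z u} = (\<Union>n. {..F (v n) z})"
        proof (intro set_eqI iffI)
          fix u assume "u \<in> {u. t < g z u}"
          then obtain q :: rat where q: "u \<le> F (real_of_rat q) z" "t < real_of_rat q"
            using 3 by (auto simp: g_less)
          obtain n where "v n \<le> real_of_rat q" using v_lim[OF q(2)] by blast
          then have "u \<le> F (v n) z" using elim q(1) by (meson order_trans)
          then show "u \<in> (\<Union>n. {..F (v n) z})" by blast
        next
          fix u assume "u \<in> (\<Union>n. {..F (v n) z})"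
          then obtain n where n: "u \<le> F (v n) z" by blast
          obtain q :: rat where q: "t < real_of_rat q" "real_of_rat q < v n" using of_rat_dense[OF v(1)] by blast
          then have "u \<le> F (real_of_rat q) z" using elim n by (meson less_imp_le order_trans)
          moreover have "0 < real_of_rat q" "real_of_rat q < 1" using q v(2)[of n] 3 by linarith+
          ultimately show "u \<in> {u. t < g z u}" using q(1) by (auto simp: g_less intro!: exI[of _ q])
        qed
        also have "emeasure unif \<dots> = (SUP n. emeasure unif {..F (v n) z})"
          by (rule SUP_emeasure_incseq[symmetric]) (use elim in \<open>auto intro!: incseq_SucI\<close>)
        also have "\<dots> = (SUP n. ennreal (F (v n) z))"
          using elim F0 by (intro SUP_cong refl emeasure_unif_atMost) auto
        finally show ?case .
      qed
      have "(\<integral>\<^sup>+z. indicator A z * emeasure unif {u. t < g z u} \<partial>k)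
          = (\<integral>\<^sup>+z. (SUP n. indicator A z * ennreal (F (v n) z)) \<partial>k)"
        by (rule nn_integral_cong_AE) (use inner in \<open>eventually_elim, simp add: SUP_mult_left_ennreal\<close>)
      also have "\<dots> = (SUP n. \<integral>\<^sup>+z. indicator A z * ennreal (F (v n) z) \<partial>k)"
      proof (rule nn_integral_monotone_convergence_SUP_AE)
        show "AE z in k. indicator A z * ennreal (F (v n) z) \<le> indicator A z * ennreal (F (v (Suc n)) z)" for n
          using good by eventually_elim (auto intro!: mult_left_mono ennreal_leI)
      qed measurable
      also have "\<dots> = (SUP n. emeasure p {\<omega> \<in> space p. Z \<omega> \<in> A \<and> v n < V \<omega>})"
        unfolding dens[OF A, symmetric] by (subst emeasure_density) (simp_all add: mult.commute)
      also have "\<dots> = emeasure p (\<Union>n. {\<omega> \<in> space p. Z \<omega> \<in> A \<and> v n < V \<omega>})"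
      proof (rule SUP_emeasure_incseq)
        show "incseq (\<lambda>n. {\<omega> \<in> space p. Z \<omega> \<in> A \<and> v n < V \<omega>})"
        proof (rule incseq_SucI)
          fix n
          have "v (Suc n) \<le> v n" by (rule v_anti) simp
          then show "{\<omega> \<in> space p. Z \<omega> \<in> A \<and> v n < V \<omega>} \<subseteq> {\<omega> \<in> space p. Z \<omega> \<in> A \<and> v (Suc n) < V \<omega>}"
            by auto
        qed
      qed auto
      also have "(\<Union>n. {\<omega> \<in> space p. Z \<omega> \<in> A \<and> v n < V \<omega>}) = {\<omega> \<in> space p. Z \<omega> \<in> A \<and> t < V \<omega>}"
      proof -
        have "(\<exists>n. v n < s) \<longleftrightarrow> t < s" for s
        proof
          assume "t < s"
          then obtain n where "v n \<le> (t + s) / 2" using v_lim[of "(t + s) / 2"] by auto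
          also have "(t + s) / 2 < s" using \<open>t < s\<close> by (simp add: field_simps)
          finally have "v n < s" .
          then show "\<exists>n. v n < s" ..
        qed (use v(1) less_trans in blast)
        then show ?thesis by auto
      qed
      finally show ?thesis using lhs rhs by simp
    qed
  qed simp_all
  then show thesis unfolding k_def by (rule that[OF g_meas])
qed

lemma borel_space_retract:
  assumes bs: "borel_space M" and ne: "space M \<noteq> {}"
  obtains f :: "'a \<Rightarrow> real" and r where "f \<in> borel_measurable M" "r \<in> borel \<rightarrow>\<^sub>M M"
    "\<And>x. x \<in> space M \<Longrightarrow> 0 \<le> f x" "\<And>x. x \<in> space M \<Longrightarrow> f x \<le> 1" "\<And>x. x \<in> space M \<Longrightarrow> r (f x) = x"
proof -
  obtain B f where B: "B \<in> sets (borel :: real measure)" "B \<subseteq> {0..1}" and bij: "bij_betw f (space M) B"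
    and f: "f \<in> M \<rightarrow>\<^sub>M restrict_space borel B" and inv: "inv_into (space M) f \<in> restrict_space borel B \<rightarrow>\<^sub>M M"
    using bs unfolding borel_space_def by blast
  obtain x0 where x0: "x0 \<in> space M" using ne by blast
  \<comment> \<open>The inverse gets the default value \<open>x0\<close> outside the image, so it
    can be applied to any regenerated real number.\<close>
  define r where "r y = (if y \<in> B then inv_into (space M) f y else x0)" for y
  have fB: "f x \<in> B" if "x \<in> space M" for x using bij that by (auto simp: bij_betw_def)
  show thesis
  proof
    show "f \<in> borel_measurable M" using f by (auto simp: measurable_restrict_space2_iff)
    show "r \<in> borel \<rightarrow>\<^sub>M M"
      unfolding r_def
    proof (rule measurable_If_restrict_space_iff[THEN iffD2])
      show "{x \<in> space borel. x \<in> B} \<in> sets borel" using B(1) by simp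
      show "inv_into (space M) f \<in> restrict_space borel {x. x \<in> B} \<rightarrow>\<^sub>M M \<and>
          (\<lambda>x. x0) \<in> restrict_space borel {x. x \<notin> B} \<rightarrow>\<^sub>M M"
        using inv x0 by simp
    qed
    fix x assume x: "x \<in> space M"
    show "0 \<le> f x" "f x \<le> 1" using fB[OF x] B(2) by auto
    show "r (f x) = x" using fB[OF x] bij x by (simp add: r_def bij_betw_def)
  qed
qed

section \<open>Restoring the initial states of a path\<close>

lemma case_nat_shift: "case_nat (\<omega> 0) (path_shift 1 \<omega>) = \<omega>"
  by (rule ext) (simp add: path_shift_def split: nat.split)

lemma shift_case_nat: "path_shift 1 (case_nat x \<omega>) = \<omega>"
  by (rule ext) (simp add: path_shift_def)

lemma distr_shift_shift:
  assumes "sets q = sets (path_space M)"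
  shows "distr (distr q (path_space M) (path_shift m)) (path_space M) (path_shift n) = distr q (path_space M) (path_shift (n + m))"
  by (subst distr_distr) (simp_all add: comp_def shift_shift cong: measurable_cong_sets[OF assms refl])

text \<open>\<open>G\<close> couples a variable in \<open>X\<close> with the future of a
  \<open>q\<close>-path. The first state is regenerated from that future and a fresh uniform
  variable independent of \<open>G\<close>: the old joint law is untouched, and the future together
  with the new state has law \<open>q\<close>.\<close>

lemma lift_first_state:
  assumes bs: "borel_space M" and ne: "space M \<noteq> {}"
    and q: "finite_measure q" "sets q = sets (path_space M)"
    and G: "sets G = sets (X \<Otimes>\<^sub>M path_space M)" "distr G (path_space M) snd = distr q (path_space M) (path_shift 1)"
  obtains G' where "sets G' = sets (X \<Otimes>\<^sub>M path_space M)" "distr G' (path_space M) snd = q"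
    "distr G' (X \<Otimes>\<^sub>M path_space M) (\<lambda>w. (fst w, path_shift 1 (snd w))) = G"
proof -
  let ?S = "path_space M"
  interpret q: finite_measure q by fact
  interpret U: prob_space unif by (rule prob_space_unif)
  note [measurable_cong] = q(2) G(1)
  obtain f :: "'a \<Rightarrow> real" and r where f [measurable]: "f \<in> borel_measurable M" and r [measurable]: "r \<in> borel \<rightarrow>\<^sub>M M"
    and f01: "\<And>x. x \<in> space M \<Longrightarrow> 0 \<le> f x" "\<And>x. x \<in> space M \<Longrightarrow> f x \<le> 1" and rf: "\<And>x. x \<in> space M \<Longrightarrow> r (f x) = x"
    by (rule borel_space_retract[OF bs ne]) (rule that)
  have spq: "space q = space ?S" by (rule sets_eq_imp_space_eq[OF q(2)])
  have coord: "\<omega> i \<in> space M" if "\<omega> \<in> space ?S" for \<omega> and i :: nat using that by (simp add: space_PiM PiE_iff)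
  have V: "(\<lambda>\<omega>. f (\<omega> 0)) \<in> borel_measurable q" by measurable
  have Z: "path_shift 1 \<in> q \<rightarrow>\<^sub>M ?S" by measurable
  obtain g where g [measurable]: "(\<lambda>(z, u). g z u) \<in> borel_measurable (?S \<Otimes>\<^sub>M borel)"
    and transfer: "distr (distr q ?S (path_shift 1) \<Otimes>\<^sub>M unif) (?S \<Otimes>\<^sub>M borel) (\<lambda>(z, u). (z, g z u))
      = distr q (?S \<Otimes>\<^sub>M borel) (\<lambda>\<omega>. (path_shift 1 \<omega>, f (\<omega> 0)))"
    by (rule quantile_transfer[OF q(1) Z V]) (use f01 coord spq in auto)
  define \<phi> where "\<phi> z s = case_nat (r s) z" for z :: "nat \<Rightarrow> 'a" and s
  have \<phi> [measurable]: "(\<lambda>w. \<phi> (fst w) (snd w)) \<in> ?S \<Otimes>\<^sub>M borel \<rightarrow>\<^sub>M ?S"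
    unfolding \<phi>_def by measurable
  have g' [measurable]: "(\<lambda>w. g (fst w) (snd w)) \<in> borel_measurable (?S \<Otimes>\<^sub>M borel)"
    using g by (simp add: split_beta')
  define \<psi> where "\<psi> w = \<phi> (fst w) (g (fst w) (snd w))" for w
  have \<psi> [measurable]: "\<psi> \<in> ?S \<Otimes>\<^sub>M borel \<rightarrow>\<^sub>M ?S"
    using measurable_compose[OF measurable_Pair[OF measurable_fst g'] \<phi>] by (simp add: \<psi>_def[abs_def])
  define G' where "G' = distr (G \<Otimes>\<^sub>M unif) (X \<Otimes>\<^sub>M ?S) (\<lambda>w. (fst (fst w), \<psi> (snd (fst w), snd w)))"
  have meas: "(\<lambda>w. (fst (fst w), \<psi> (snd (fst w), snd w))) \<in> G \<Otimes>\<^sub>M unif \<rightarrow>\<^sub>M X \<Otimes>\<^sub>M ?S"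
    by measurable
  have fst_G: "distr (G \<Otimes>\<^sub>M unif) G fst = G" by (rule U.distr_pair_fst)
  show thesis
  proof
    show "sets G' = sets (X \<Otimes>\<^sub>M ?S)" by (simp add: G'_def)
    have "distr G' ?S snd = distr (G \<Otimes>\<^sub>M unif) ?S (\<lambda>w. \<psi> (snd (fst w), snd w))"
      unfolding G'_def by (subst distr_distr[OF _ meas]) (simp_all add: comp_def)
    also have "\<dots> = distr (distr (G \<Otimes>\<^sub>M unif) (?S \<Otimes>\<^sub>M borel) (\<lambda>(w, u). (snd w, u))) ?S \<psi>"
      by (subst distr_distr) (simp_all add: comp_def split_beta')
    also have "distr (G \<Otimes>\<^sub>M unif) (?S \<Otimes>\<^sub>M borel) (\<lambda>(w, u). (snd w, u)) = distr G ?S snd \<Otimes>\<^sub>M distr unif borel (\<lambda>u. u)"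
      by (rule pair_measure_distr[symmetric])
         (simp_all add: prob_space_imp_sigma_finite U.prob_space_distr)
    also have "distr unif borel (\<lambda>u. u) = unif" by (rule distr_id2) simp
    also have "distr (distr G ?S snd \<Otimes>\<^sub>M unif) ?S \<psi>
        = distr (distr (distr q ?S (path_shift 1) \<Otimes>\<^sub>M unif) (?S \<Otimes>\<^sub>M borel) (\<lambda>(z, u). (z, g z u))) ?S (\<lambda>w. \<phi> (fst w) (snd w))"
      unfolding G(2) by (subst distr_distr) (simp_all add: comp_def split_beta' \<psi>_def[abs_def])
    also have "\<dots> = distr q ?S (\<lambda>\<omega>. \<phi> (path_shift 1 \<omega>) (f (\<omega> 0)))"
      unfolding transfer by (subst distr_distr) (simp_all add: comp_def)
    also have "\<dots> = distr q ?S (\<lambda>\<omega>. \<omega>)"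
      by (rule distr_cong) (simp_all add: \<phi>_def spq rf coord case_nat_shift[unfolded One_nat_def])
    also have "\<dots> = q" by (rule distr_id2) (simp add: q(2))
    finally show "distr G' ?S snd = q" .
    have "distr G' (X \<Otimes>\<^sub>M ?S) (\<lambda>w. (fst w, path_shift 1 (snd w)))
        = distr (G \<Otimes>\<^sub>M unif) (X \<Otimes>\<^sub>M ?S) (\<lambda>w. (fst (fst w), path_shift 1 (\<psi> (snd (fst w), snd w))))"
      unfolding G'_def by (subst distr_distr[OF _ meas]) (simp_all add: comp_def)
    also have "\<dots> = distr (G \<Otimes>\<^sub>M unif) G fst"
      by (rule distr_cong) (simp_all add: G(1) \<psi>_def \<phi>_def shift_case_nat[unfolded One_nat_def])
    finally show "distr G' (X \<Otimes>\<^sub>M ?S) (\<lambda>w. (fst w, path_shift 1 (snd w))) = G" using fst_G by simp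
  qed
qed

text \<open>States are restored from the latest to the earliest: the induction hypothesis, applied
  to the law shifted by one, restores all but the state at time zero.\<close>

lemma lift_initial_states:
  assumes bs: "borel_space M" and ne: "space M \<noteq> {}"
    and q: "finite_measure q" "sets q = sets (path_space M)"
    and G: "sets G = sets (X \<Otimes>\<^sub>M path_space M)" "distr G (path_space M) snd = distr q (path_space M) (path_shift n)"
  shows "\<exists>G'. sets G' = sets (X \<Otimes>\<^sub>M path_space M) \<and> distr G' (path_space M) snd = q \<and>
    distr G' (X \<Otimes>\<^sub>M path_space M) (\<lambda>w. (fst w, path_shift n (snd w))) = G"
  using q G
proof (induction n arbitrary: q)
  case 0
  have "distr q (path_space M) (path_shift 0) = q" using distr_id2[of "path_space M" q] 0 by simp
  moreover have "distr G (X \<Otimes>\<^sub>M path_space M) (\<lambda>w. (fst w, path_shift 0 (snd w))) = G"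
    using distr_id2[of "X \<Otimes>\<^sub>M path_space M" G] 0 by simp
  ultimately show ?case using 0 by auto
next
  case (Suc n)
  let ?S = "path_space M"
  let ?q1 = "distr q ?S (path_shift 1)"
  note [measurable_cong] = Suc.prems(2)
  have "finite_measure ?q1" by (rule finite_measure.finite_measure_distr[OF Suc.prems(1)]) measurable
  moreover have "distr G ?S snd = distr ?q1 ?S (path_shift n)"
    using Suc.prems(4) distr_shift_shift[OF Suc.prems(2), of 1 n] by simp
  ultimately obtain G1 where G1: "sets G1 = sets (X \<Otimes>\<^sub>M ?S)" "distr G1 ?S snd = ?q1"
    "distr G1 (X \<Otimes>\<^sub>M ?S) (\<lambda>w. (fst w, path_shift n (snd w))) = G"
    using Suc.IH[of ?q1] Suc.prems(3) by auto
  obtain G2 where G2: "sets G2 = sets (X \<Otimes>\<^sub>M ?S)" "distr G2 ?S snd = q"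
    "distr G2 (X \<Otimes>\<^sub>M ?S) (\<lambda>w. (fst w, path_shift 1 (snd w))) = G1"
    by (rule lift_first_state[OF bs ne Suc.prems(1,2) G1(1,2)]) (rule that)
  note [measurable_cong] = G2(1)
  have "distr G2 (X \<Otimes>\<^sub>M ?S) (\<lambda>w. (fst w, path_shift (Suc n) (snd w)))
      = distr (distr G2 (X \<Otimes>\<^sub>M ?S) (\<lambda>w. (fst w, path_shift 1 (snd w)))) (X \<Otimes>\<^sub>M ?S) (\<lambda>w. (fst w, path_shift n (snd w)))"
    by (subst distr_distr) (simp_all add: comp_def shift_shift)
  also have "\<dots> = G" unfolding G2(3) by (rule G1(3))
  finally show ?case using G2 by blast
qed

lemma sets_agree:
  assumes "diagonal M \<in> sets (M \<Otimes>\<^sub>M M)"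
  shows "{w \<in> space (path_space M \<Otimes>\<^sub>M path_space M). \<forall>k\<ge>n. fst w k = snd w k} \<in> sets (path_space M \<Otimes>\<^sub>M path_space M)"
proof -
  let ?SS = "path_space M \<Otimes>\<^sub>M path_space M"
  have meas: "(\<lambda>w. (fst w k, snd w k)) \<in> ?SS \<rightarrow>\<^sub>M M \<Otimes>\<^sub>M M" for k by measurable
  have "{w \<in> space ?SS. \<forall>k\<ge>n. fst w k = snd w k} = (\<Inter>k\<in>{n..}. (\<lambda>w. (fst w k, snd w k)) -` diagonal M \<inter> space ?SS)"
    by (auto simp: diagonal_def space_pair_measure space_PiM PiE_iff)
  also have "\<dots> \<in> sets ?SS"
    using measurable_sets[OF meas assms] by (intro sets.countable_INT') auto
  finally show ?thesis .
qed

text \<open>The first path is paired with its own future. By \<open>eq\<close> this is also a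
  possible future of the second path, whose missing initial states are then restored without
  changing the pair.\<close>

lemma glue_common_future:
  assumes bs: "borel_space M" and ne: "space M \<noteq> {}" and diag: "diagonal M \<in> sets (M \<Otimes>\<^sub>M M)"
    and p: "finite_measure p" "sets p = sets (path_space M)"
    and q: "finite_measure q" "sets q = sets (path_space M)"
    and eq: "distr p (path_space M) (path_shift n) = distr q (path_space M) (path_shift n)"
  shows "\<exists>G. sets G = sets (path_space M \<Otimes>\<^sub>M path_space M) \<and> distr G (path_space M) fst = p \<and>
    distr G (path_space M) snd = q \<and> (AE w in G. \<forall>k\<ge>n. fst w k = snd w k)"
proof -
  let ?S = "path_space M"
  note [measurable_cong] = p(2)
  let ?G = "distr p (?S \<Otimes>\<^sub>M ?S) (\<lambda>\<omega>. (\<omega>, path_shift n \<omega>))"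
  have meas: "(\<lambda>\<omega>. (\<omega>, path_shift n \<omega>)) \<in> p \<rightarrow>\<^sub>M ?S \<Otimes>\<^sub>M ?S" by measurable
  have "distr ?G ?S snd = distr q ?S (path_shift n)"
    unfolding eq[symmetric] by (subst distr_distr[OF _ meas]) (simp_all add: comp_def)
  then obtain G where G: "sets G = sets (?S \<Otimes>\<^sub>M ?S)" "distr G ?S snd = q"
    "distr G (?S \<Otimes>\<^sub>M ?S) (\<lambda>w. (fst w, path_shift n (snd w))) = ?G"
    using lift_initial_states[OF bs ne q, of ?G ?S n] by auto
  note [measurable_cong] = G(1)
  have measG: "(\<lambda>w. (fst w, path_shift n (snd w))) \<in> G \<rightarrow>\<^sub>M ?S \<Otimes>\<^sub>M ?S" by measurable
  have "distr G ?S fst = distr (distr G (?S \<Otimes>\<^sub>M ?S) (\<lambda>w. (fst w, path_shift n (snd w)))) ?S fst"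
    by (subst distr_distr[OF _ measG]) (simp_all add: comp_def)
  also have "\<dots> = distr p ?S (\<lambda>\<omega>. \<omega>)"
    unfolding G(3) by (subst distr_distr[OF _ meas]) (simp_all add: comp_def)
  also have "\<dots> = p" by (rule distr_id2) (simp add: p(2))
  finally have "distr G ?S fst = p" .
  let ?E = "{w \<in> space (?S \<Otimes>\<^sub>M ?S). \<forall>k\<ge>0. path_shift n (fst w) k = snd w k}"
  have meas2: "(\<lambda>w. (path_shift n (fst w), snd w)) \<in> ?S \<Otimes>\<^sub>M ?S \<rightarrow>\<^sub>M ?S \<Otimes>\<^sub>M ?S" by measurable
  have "(\<lambda>w. (path_shift n (fst w), snd w)) -` {w \<in> space (?S \<Otimes>\<^sub>M ?S). \<forall>k\<ge>0. fst w k = snd w k} \<inter> space (?S \<Otimes>\<^sub>M ?S) = ?E"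
    using measurable_space[OF meas2]
    by (intro vimage_Int_eq_Collect) (simp only: mem_Collect_eq fst_conv snd_conv simp_thms)
  with measurable_sets[OF meas2 sets_agree[OF diag, of 0]] have E: "?E \<in> sets (?S \<Otimes>\<^sub>M ?S)" by (simp only:)
  have "AE w in ?G. \<forall>k\<ge>0. path_shift n (fst w) k = snd w k"
    by (subst AE_distr_iff[OF meas E]) simp
  then have "AE w in distr G (?S \<Otimes>\<^sub>M ?S) (\<lambda>w. (fst w, path_shift n (snd w))). \<forall>k\<ge>0. path_shift n (fst w) k = snd w k"
    unfolding G(3) .
  then have "AE w in G. \<forall>k\<ge>0. path_shift n (fst w) k = path_shift n (snd w) k"
    by (subst (asm) AE_distr_iff[OF measG E]) simp
  then have "AE w in G. \<forall>k\<ge>n. fst w k = snd w k"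
  proof eventually_elim
    case (elim w)
    show ?case
    proof (intro allI impI)
      fix k assume "n \<le> k"
      then show "fst w k = snd w k" using elim[rule_format, of "k - n"] by (simp add: path_shift_def)
    qed
  qed
  then show ?thesis using G(1,2) \<open>distr G ?S fst = p\<close> by blast
qed

section \<open>A coupling that is maximal at all times\<close>

text \<open>At time \<open>n\<close> the common part of the laws of the shifted residual paths is glued
  together. As equal amounts are removed from both sides, the residuals keep the difference of the
  original laws, and after time \<open>n\<close> they are mutually singular on the future of \<open>n\<close>.\<close>

lemma maximal_future_coupling:
  assumes bs: "borel_space M" and ne: "space M \<noteq> {}" and diag: "diagonal M \<in> sets (M \<Otimes>\<^sub>M M)"
    and p: "p \<in> space (prob_algebra (path_space M))" and q: "q \<in> space (prob_algebra (path_space M))"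
    and c: "\<And>n A. A \<in> sets (path_space M) \<Longrightarrow>
      measure (distr p (path_space M) (path_shift n)) A - measure (distr q (path_space M) (path_shift n)) A \<le> c n"
  shows "\<exists>\<Gamma>\<in>couplings (path_space M) p q.
    \<forall>n. ennreal (1 - c n) \<le> emeasure \<Gamma> {w \<in> space (path_space M \<Otimes>\<^sub>M path_space M). \<forall>k\<ge>n. fst w k = snd w k}"
proof -
  let ?S = "path_space M"
  interpret p: prob_space p by (rule prob_algebraD[OF p])
  interpret q: prob_space q by (rule prob_algebraD[OF q])
  note [measurable_cong] = prob_algebraD(2)[OF p] prob_algebraD(2)[OF q]
  note [simp] = prob_algebraD(2,3)[OF p] prob_algebraD(2,3)[OF q]
  \<comment> \<open>Residual laws are encoded as weights with values in the unit interval relative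
    to the fixed laws \<open>p\<close> and \<open>q\<close>, so that removing mass is subtraction of
    functions.\<close>
  define D where "D r u = density r (\<lambda>\<omega>. ennreal (u \<omega>))" for r :: "(nat \<Rightarrow> 'a) measure" and u
  have sets_D [simp, measurable_cong]: "sets (D r u) = sets r" and space_D [simp]: "space (D r u) = space r" for r u
    by (simp_all add: D_def)
  define W where "W u \<longleftrightarrow> u \<in> borel_measurable ?S \<and> (\<forall>\<omega>. 0 \<le> u \<omega>) \<and> (\<forall>\<omega>. u \<omega> \<le> 1)" for u :: "(nat \<Rightarrow> 'a) \<Rightarrow> real"
  have D_le: "emeasure (D r u) A \<le> emeasure r A" if "W u" "sets r = sets ?S" "A \<in> sets ?S" for r u A
  proof -
    have "emeasure (D r u) A = (\<integral>\<^sup>+x. ennreal (u x) * indicator A x \<partial>r)"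
      unfolding D_def using that by (intro emeasure_density) (auto simp: W_def cong: measurable_cong_sets)
    also have "\<dots> \<le> (\<integral>\<^sup>+x. indicator A x \<partial>r)"
      using that(1) by (intro nn_integral_mono) (auto simp: W_def split: split_indicator)
    finally show ?thesis using that by simp
  qed
  have fin_D: "finite_measure (D r u)" if "W u" "finite_measure r" "sets r = sets ?S" for r u
    using D_le[OF that(1,3), of "space ?S"] finite_measure.emeasure_finite[OF that(2), of "space ?S"] sets_eq_imp_space_eq[OF that(3)]
    by (intro finite_measureI) (auto simp: top_unique)
  have W_diff: "W (\<lambda>\<omega>. u \<omega> - v \<omega>)" if uv: "W u" "W v" "\<And>\<omega>. v \<omega> \<le> u \<omega>" for u v
  proof -
    have *: "u \<omega> \<le> 1" "0 \<le> v \<omega>" for \<omega> using uv by (auto simp: W_def)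
    show ?thesis
      unfolding W_def
    proof (intro conjI allI)
      show "(\<lambda>\<omega>. u \<omega> - v \<omega>) \<in> borel_measurable ?S" using uv by (auto simp: W_def)
      show "0 \<le> u \<omega> - v \<omega>" for \<omega> using uv(3)[of \<omega>] by simp
      show "u \<omega> - v \<omega> \<le> 1" for \<omega> using *[of \<omega>] by linarith
    qed
  qed
  have D_diff: "measure (D r u) A - measure (D r v) A = measure (D r (\<lambda>\<omega>. u \<omega> - v \<omega>)) A"
    if uv: "W u" "W v" "\<And>\<omega>. v \<omega> \<le> u \<omega>" and r: "prob_space r" "sets r = sets ?S" and A: "A \<in> sets ?S" for r u v A
  proof -
    have W': "W (\<lambda>\<omega>. u \<omega> - v \<omega>)" by (rule W_diff[OF uv])
    note fin = prob_space.finite_measure[OF r(1)]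
    have "measure (D r u) A - measure (D r v) A = (\<integral>x. indicator A x * (u x - v x) \<partial>r)"
      unfolding D_def using uv fin_D[OF _ fin r(2)] r A
      by (intro measure_diff_density(2)[OF r(2)]) (auto simp: W_def D_def)
    also have "\<dots> = measure (D r (\<lambda>\<omega>. u \<omega> - v \<omega>)) A"
      unfolding D_def using W' fin_D[OF W' fin r(2)] r A
      by (subst measure_density_real(2)[OF r(2)]) (auto simp: W_def D_def mult.commute)
    finally show ?thesis .
  qed
  define Inv where "Inv n s \<longleftrightarrow> W (fst s) \<and> W (snd s) \<and>
      (\<forall>A\<in>sets ?S. measure (distr (D p (fst s)) ?S (path_shift n)) A - measure (distr (D q (snd s)) ?S (path_shift n)) A
        = measure (distr p ?S (path_shift n)) A - measure (distr q ?S (path_shift n)) A)" for n s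
  define Step where "Step n s s' \<longleftrightarrow> (\<forall>\<omega>. fst s' \<omega> \<le> fst s \<omega>) \<and> (\<forall>\<omega>. snd s' \<omega> \<le> snd s \<omega>) \<and>
      (\<integral>\<omega>. fst s' \<omega> \<partial>p) \<le> c n \<and>
      distr (D p (\<lambda>\<omega>. fst s \<omega> - fst s' \<omega>)) ?S (path_shift n) = distr (D q (\<lambda>\<omega>. snd s \<omega> - snd s' \<omega>)) ?S (path_shift n)" for n s s'
  have D1: "D r (\<lambda>_. 1) = r" for r by (simp add: D_def density_1)
  \<comment> \<open>Dependent choice only provides some start, so the initial weights are pinned
    down inside the invariant.\<close>
  have "\<exists>s. s 0 = (\<lambda>_. 1, \<lambda>_. 1) \<and> (\<forall>n. Inv n (s n) \<and> Step n (s n) (s (Suc n)))"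
  proof (rule dependent_nat_choice[where P="\<lambda>n s. Inv n s \<and> (n = 0 \<longrightarrow> s = (\<lambda>_. 1, \<lambda>_. 1))" and Q=Step, THEN exE])
    show "\<exists>s. Inv 0 s \<and> (0 = (0::nat) \<longrightarrow> s = (\<lambda>_. 1, \<lambda>_. 1))"
      by (rule exI[of _ "(\<lambda>_. 1, \<lambda>_. 1)"]) (simp add: Inv_def W_def D1)
  next
    fix s n assume "Inv n s \<and> (n = 0 \<longrightarrow> s = (\<lambda>_. 1, \<lambda>_. 1))"
    then obtain u v where s: "s = (u, v)" and u: "W u" and v: "W v"
      and inv: "\<And>A. A \<in> sets ?S \<Longrightarrow> measure (distr (D p u) ?S (path_shift n)) A - measure (distr (D q v) ?S (path_shift n)) A
        = measure (distr p ?S (path_shift n)) A - measure (distr q ?S (path_shift n)) A"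
      by (cases s) (auto simp: Inv_def)
    have uv_meas [measurable]: "u \<in> borel_measurable ?S" "v \<in> borel_measurable ?S" using u v by (auto simp: W_def)
    let ?P = "distr (D p u) ?S (path_shift n)" and ?Q = "distr (D q v) ?S (path_shift n)"
    have shD: "path_shift n \<in> D p u \<rightarrow>\<^sub>M ?S" "path_shift n \<in> D q v \<rightarrow>\<^sub>M ?S" by measurable
    have finPQ: "finite_measure ?P" "finite_measure ?Q"
      using fin_D[OF u p.finite_measure_axioms] fin_D[OF v q.finite_measure_axioms] shD
      by (simp_all add: finite_measure.finite_measure_distr)
    obtain a b :: "(nat \<Rightarrow> 'a) \<Rightarrow> real" and A
      where ab [measurable]: "a \<in> borel_measurable ?S" "b \<in> borel_measurable ?S"
      and a: "\<And>x. 0 \<le> a x" "\<And>x. a x \<le> 1" and b: "\<And>x. 0 \<le> b x" "\<And>x. b x \<le> 1"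
      and eq: "density ?P (\<lambda>x. ennreal (a x)) = density ?Q (\<lambda>x. ennreal (b x))"
      and A: "A \<in> sets ?S" "(\<integral>x. 1 - a x \<partial>?P) = measure ?P A - measure ?Q A"
      by (rule common_part[of ?P ?S ?Q]) (use finPQ in simp_all)
    \<comment> \<open>Thinning by a function of the shifted path removes exactly the common part of
      the two laws of the future of \<open>n\<close>.\<close>
    define u' v' where "u' \<omega> = u \<omega> * (1 - a (path_shift n \<omega>))" and "v' \<omega> = v \<omega> * (1 - b (path_shift n \<omega>))" for \<omega>
    have u': "W u'" "\<And>\<omega>. u' \<omega> \<le> u \<omega>" and v': "W v'" "\<And>\<omega>. v' \<omega> \<le> v \<omega>"
      using u v a b unfolding W_def u'_def v'_def by (auto intro!: mult_nonneg_nonneg mult_le_one mult_right_le_one_le)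
    have diff_u: "D p (\<lambda>\<omega>. u \<omega> - u' \<omega>) = density (D p u) (\<lambda>\<omega>. ennreal (a (path_shift n \<omega>)))"
      unfolding D_def using u a
      by (subst density_density_eq) (auto simp: u'_def W_def ennreal_mult[symmetric] right_diff_distrib)
    have diff_v: "D q (\<lambda>\<omega>. v \<omega> - v' \<omega>) = density (D q v) (\<lambda>\<omega>. ennreal (b (path_shift n \<omega>)))"
      unfolding D_def using v b
      by (subst density_density_eq) (auto simp: v'_def W_def ennreal_mult[symmetric] right_diff_distrib)
    have removed: "distr (D p (\<lambda>\<omega>. u \<omega> - u' \<omega>)) ?S (path_shift n) = distr (D q (\<lambda>\<omega>. v \<omega> - v' \<omega>)) ?S (path_shift n)"
      unfolding diff_u diff_v using eq
      by (subst (1 2) density_distr[symmetric]) (simp_all add: shD)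
    have "(\<integral>\<omega>. u' \<omega> \<partial>p) = (\<integral>\<omega>. 1 - a (path_shift n \<omega>) \<partial>D p u)"
      unfolding D_def using u by (subst integral_density) (auto simp: u'_def[abs_def] W_def)
    also have "\<dots> = (\<integral>x. 1 - a x \<partial>?P)" by (subst integral_distr[OF shD(1)]) simp_all
    also have "\<dots> \<le> c n" using A inv[OF A(1)] c[OF A(1), of n] by simp
    finally have mass: "(\<integral>\<omega>. u' \<omega> \<partial>p) \<le> c n" .
    have "Inv (Suc n) (u', v')"
      unfolding Inv_def fst_conv snd_conv
    proof (intro conjI u' v' ballI)
      fix B assume B: "B \<in> sets ?S"
      \<comment> \<open>An event about the future of \<open>n + 1\<close> is also one about the
        future of \<open>n\<close>, where both residuals lose the same mass; so their difference is
        unchanged.\<close>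
      let ?B = "path_shift 1 -` B \<inter> space ?S"
      have B': "?B \<in> sets ?S" by (rule measurable_sets[OF measurable_shift B])
      have vim: "path_shift (Suc n) -` B \<inter> space ?S = path_shift n -` ?B \<inter> space ?S"
        using measurable_space[OF measurable_shift[of n M]] by (auto simp: shift_shift)
      have C: "path_shift n -` ?B \<inter> space ?S \<in> sets ?S" by (rule measurable_sets[OF measurable_shift B'])
      have sh: "measure (distr r ?S (path_shift (Suc n))) B = measure r (path_shift n -` ?B \<inter> space ?S)"
        "measure (distr r ?S (path_shift n)) ?B = measure r (path_shift n -` ?B \<inter> space ?S)" if r: "sets r = sets ?S" for r
      proof -
        note [measurable_cong] = r
        show "measure (distr r ?S (path_shift (Suc n))) B = measure r (path_shift n -` ?B \<inter> space ?S)"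
          using B vim sets_eq_imp_space_eq[OF r] by (subst measure_distr) simp_all
        show "measure (distr r ?S (path_shift n)) ?B = measure r (path_shift n -` ?B \<inter> space ?S)"
          using B' sets_eq_imp_space_eq[OF r] by (subst measure_distr) simp_all
      qed
      let ?C = "path_shift n -` ?B \<inter> space ?S"
      have "measure (D p (\<lambda>\<omega>. u \<omega> - u' \<omega>)) ?C = measure (D q (\<lambda>\<omega>. v \<omega> - v' \<omega>)) ?C"
        using removed sh(2)[of "D p (\<lambda>\<omega>. u \<omega> - u' \<omega>)"] sh(2)[of "D q (\<lambda>\<omega>. v \<omega> - v' \<omega>)"] by simp
      then have "measure (D p u) ?C - measure (D p u') ?C = measure (D q v) ?C - measure (D q v') ?C"
        using D_diff[OF u u'(1) u'(2) p.prob_space_axioms _ C] D_diff[OF v v'(1) v'(2) q.prob_space_axioms _ C] by simp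
      moreover have "measure (D p u) ?C - measure (D q v) ?C = measure p ?C - measure q ?C"
        using inv[OF B'] sh(2)[of "D p u"] sh(2)[of "D q v"] sh(2)[of p] sh(2)[of q] by simp
      ultimately show "measure (distr (D p u') ?S (path_shift (Suc n))) B - measure (distr (D q v') ?S (path_shift (Suc n))) B
          = measure (distr p ?S (path_shift (Suc n))) B - measure (distr q ?S (path_shift (Suc n))) B"
        using sh(1)[of "D p u'"] sh(1)[of "D q v'"] sh(1)[of p] sh(1)[of q] by simp
    qed
    moreover have "Step n s (u', v')"
      unfolding Step_def s fst_conv snd_conv using u'(2) v'(2) mass removed by blast
    ultimately show "\<exists>s'. (Inv (Suc n) s' \<and> (Suc n = 0 \<longrightarrow> s' = (\<lambda>_. 1, \<lambda>_. 1))) \<and> Step n s s'"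
      by blast
  qed blast
  then obtain s where s0: "s 0 = (\<lambda>_. 1, \<lambda>_. 1)" and s: "\<And>n. Inv n (s n)" "\<And>n. Step n (s n) (s (Suc n))"
    by blast
  define u v where "u n = fst (s n)" and "v n = snd (s n)" for n
  have W: "W (u n)" "W (v n)" for n using s(1)[of n] by (auto simp: Inv_def u_def v_def)
  have dec: "u (Suc n) \<omega> \<le> u n \<omega>" "v (Suc n) \<omega> \<le> v n \<omega>" for n \<omega>
    using s(2)[of n] by (auto simp: Step_def u_def v_def)
  have mass: "(\<integral>\<omega>. u (Suc n) \<omega> \<partial>p) \<le> c n"
    and match: "distr (D p (\<lambda>\<omega>. u n \<omega> - u (Suc n) \<omega>)) ?S (path_shift n) = distr (D q (\<lambda>\<omega>. v n \<omega> - v (Suc n) \<omega>)) ?S (path_shift n)" for n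
    using s(2)[of n] by (auto simp: Step_def u_def v_def)
  have uv0: "u 0 = (\<lambda>_. 1)" "v 0 = (\<lambda>_. 1)" by (simp_all add: u_def v_def s0)
  have Wd: "W (\<lambda>\<omega>. u n \<omega> - u (Suc n) \<omega>)" "W (\<lambda>\<omega>. v n \<omega> - v (Suc n) \<omega>)" for n
    by (rule W_diff[OF W(1) W(1) dec(1)], rule W_diff[OF W(2) W(2) dec(2)])
  have "\<forall>n. \<exists>G. sets G = sets (?S \<Otimes>\<^sub>M ?S) \<and> distr G ?S fst = D p (\<lambda>\<omega>. u n \<omega> - u (Suc n) \<omega>) \<and>
      distr G ?S snd = D q (\<lambda>\<omega>. v n \<omega> - v (Suc n) \<omega>) \<and> (AE w in G. \<forall>k\<ge>n. fst w k = snd w k)"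
    using fin_D[OF Wd(1) p.finite_measure_axioms] fin_D[OF Wd(2) q.finite_measure_axioms] match
    by (intro allI glue_common_future[OF bs ne diag]) simp_all
  from choice[OF this] obtain G where G: "\<And>n. sets (G n) = sets (?S \<Otimes>\<^sub>M ?S)"
    "\<And>n. distr (G n) ?S fst = D p (\<lambda>\<omega>. u n \<omega> - u (Suc n) \<omega>)"
    "\<And>n. distr (G n) ?S snd = D q (\<lambda>\<omega>. v n \<omega> - v (Suc n) \<omega>)"
    "\<And>n. AE w in G n. \<forall>k\<ge>n. fst w k = snd w k" by blast
  note [measurable_cong] = G(1)
  define H where "H = sum_measure (?S \<Otimes>\<^sub>M ?S) G"
  have sets_H [measurable_cong]: "sets H = sets (?S \<Otimes>\<^sub>M ?S)" by (simp add: H_def)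
  have H: "emeasure H C = (\<Sum>n. emeasure (G n) C)" if "C \<in> sets (?S \<Otimes>\<^sub>M ?S)" for C
    unfolding H_def using that by (intro emeasure_sum_measure G(1))
  \<comment> \<open>The pieces removed before time \<open>N\<close> add up to the weight
    \<open>1 - w N\<close>, which is at most one. Hence all glued pieces together stay below
    \<open>p\<close> and \<open>q\<close>, as \<open>coupling_completion\<close> requires.\<close>
  have telescope: "(\<Sum>n<N. emeasure (D r (\<lambda>\<omega>. w n \<omega> - w (Suc n) \<omega>)) A) = emeasure (D r (\<lambda>\<omega>. 1 - w N \<omega>)) A"
    if r: "sets r = sets ?S" and A: "A \<in> sets ?S" and w: "\<And>n. W (w n)" "\<And>n \<omega>. w (Suc n) \<omega> \<le> w n \<omega>" "w 0 = (\<lambda>_. 1)"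
    for N r w A
  proof (induction N)
    case 0
    then show ?case using r A w(3) by (simp add: D_def emeasure_density)
  next
    case (Suc N)
    have [measurable_cong]: "sets r = sets ?S" by fact
    have wm [measurable]: "w n \<in> borel_measurable ?S" for n using w(1) by (simp add: W_def)
    have w01: "0 \<le> w n \<omega>" "w n \<omega> \<le> 1" for n \<omega> using w(1) by (auto simp: W_def)
    have "emeasure (D r (\<lambda>\<omega>. 1 - w N \<omega>)) A + emeasure (D r (\<lambda>\<omega>. w N \<omega> - w (Suc N) \<omega>)) A
        = (\<integral>\<^sup>+\<omega>. ennreal (1 - w N \<omega>) * indicator A \<omega> + ennreal (w N \<omega> - w (Suc N) \<omega>) * indicator A \<omega> \<partial>r)"
      unfolding D_def using A by (subst (1 2) emeasure_density) (auto intro!: nn_integral_add[symmetric] simp: r)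
    also have "\<dots> = (\<integral>\<^sup>+\<omega>. ennreal (1 - w (Suc N) \<omega>) * indicator A \<omega> \<partial>r)"
      using w01 w(2) by (intro nn_integral_cong) (auto simp: ennreal_plus[symmetric] simp del: ennreal_plus split: split_indicator)
    also have "\<dots> = emeasure (D r (\<lambda>\<omega>. 1 - w (Suc N) \<omega>)) A"
      unfolding D_def using A by (subst emeasure_density) (auto simp: r)
    finally show ?case using Suc by simp
  qed
  have W1: "W (\<lambda>\<omega>. 1 - w \<omega>)" if "W w" for w using that by (auto simp: W_def)
  have H_fst: "emeasure (distr H ?S fst) A \<le> emeasure p A" if A: "A \<in> sets ?S" for A
  proof -
    have f: "fst -` A \<inter> space (?S \<Otimes>\<^sub>M ?S) \<in> sets (?S \<Otimes>\<^sub>M ?S)" using A by measurable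
    have "emeasure (distr H ?S fst) A = (\<Sum>n. emeasure (G n) (fst -` A \<inter> space (?S \<Otimes>\<^sub>M ?S)))"
      using A sets_eq_imp_space_eq[OF sets_H] by (subst emeasure_distr) (simp_all add: H[OF f])
    also have "\<dots> = (\<Sum>n. emeasure (distr (G n) ?S fst) A)"
      using A sets_eq_imp_space_eq[OF G(1)] by (intro suminf_cong) (subst emeasure_distr, simp_all)
    also have "\<dots> \<le> emeasure p A"
      unfolding G(2)
    proof (rule suminf_le_const[OF summableI])
      fix N
      show "(\<Sum>n<N. emeasure (D p (\<lambda>\<omega>. u n \<omega> - u (Suc n) \<omega>)) A) \<le> emeasure p A"
        using telescope[of p A u N] A W dec uv0 D_le[OF W1[OF W(1)], of p A N] by simp
    qed
    finally show ?thesis .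
  qed
  have H_snd: "emeasure (distr H ?S snd) A \<le> emeasure q A" if A: "A \<in> sets ?S" for A
  proof -
    have f: "snd -` A \<inter> space (?S \<Otimes>\<^sub>M ?S) \<in> sets (?S \<Otimes>\<^sub>M ?S)" using A by measurable
    have "emeasure (distr H ?S snd) A = (\<Sum>n. emeasure (G n) (snd -` A \<inter> space (?S \<Otimes>\<^sub>M ?S)))"
      using A sets_eq_imp_space_eq[OF sets_H] by (subst emeasure_distr) (simp_all add: H[OF f])
    also have "\<dots> = (\<Sum>n. emeasure (distr (G n) ?S snd) A)"
      using A sets_eq_imp_space_eq[OF G(1)] by (intro suminf_cong) (subst emeasure_distr, simp_all)
    also have "\<dots> \<le> emeasure q A"
      unfolding G(3)
    proof (rule suminf_le_const[OF summableI])
      fix N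
      show "(\<Sum>n<N. emeasure (D q (\<lambda>\<omega>. v n \<omega> - v (Suc n) \<omega>)) A) \<le> emeasure q A"
        using telescope[of q A v N] A W dec uv0 D_le[OF W1[OF W(2)], of q A N] by simp
    qed
    finally show ?thesis .
  qed
  obtain \<Gamma> where \<Gamma>: "\<Gamma> \<in> couplings ?S p q" "\<And>C. C \<in> sets (?S \<Otimes>\<^sub>M ?S) \<Longrightarrow> emeasure H C \<le> emeasure \<Gamma> C"
    by (rule coupling_completion[OF p q sets_H H_fst H_snd]) (assumption | rule that)+
  have "ennreal (1 - c n) \<le> emeasure \<Gamma> {w \<in> space (?S \<Otimes>\<^sub>M ?S). \<forall>k\<ge>n. fst w k = snd w k}" for n
  proof -
    let ?E = "{w \<in> space (?S \<Otimes>\<^sub>M ?S). \<forall>k\<ge>n. fst w k = snd w k}"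
    have E: "?E \<in> sets (?S \<Otimes>\<^sub>M ?S)" by (rule sets_agree[OF diag])
    have Iu: "integrable p (u (Suc n))"
      using W(1)[of "Suc n"] by (intro integrable_prob_bounded[OF p, where B=1]) (auto simp: W_def)
    have "1 - c n \<le> 1 - (\<integral>\<omega>. u (Suc n) \<omega> \<partial>p)" using mass[of n] by simp
    also have "\<dots> = (\<integral>\<omega>. 1 - u (Suc n) \<omega> \<partial>p)" using Iu by (simp add: p.prob_space[simplified])
    finally have "ennreal (1 - c n) \<le> ennreal (\<integral>\<omega>. 1 - u (Suc n) \<omega> \<partial>p)" by (rule ennreal_leI)
    also have "\<dots> = (\<integral>\<^sup>+\<omega>. ennreal (1 - u (Suc n) \<omega>) \<partial>p)"
      using Iu W(1)[of "Suc n"] by (intro nn_integral_eq_integral[symmetric]) (auto simp: W_def)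
    also have "\<dots> = (\<integral>\<^sup>+\<omega>. ennreal (1 - u (Suc n) \<omega>) * indicator (space ?S) \<omega> \<partial>p)"
      by (intro nn_integral_cong) simp
    also have "\<dots> = emeasure (D p (\<lambda>\<omega>. 1 - u (Suc n) \<omega>)) (space ?S)"
      unfolding D_def using W(1)[of "Suc n"] by (intro emeasure_density[symmetric]) (auto simp: W_def)
    also have "\<dots> = (\<Sum>j<Suc n. emeasure (distr (G j) ?S fst) (space ?S))"
      unfolding G(2) using telescope[of p "space ?S" u "Suc n"] W dec uv0 by simp
    \<comment> \<open>A piece glued at time \<open>j\<close> agrees from \<open>j\<close> on, so
      every \<open>j\<close> up to and including \<open>n\<close> counts. This is why the bound
      \<open>c n\<close> was established for the weight \<open>u (Suc n)\<close>.\<close>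
    also have "\<dots> = (\<Sum>j<Suc n. emeasure (G j) ?E)"
    proof (rule sum.cong[OF refl])
      fix j assume "j \<in> {..<Suc n}"
      then have j: "j \<le> n" by simp
      have sp: "space (G j) = space (?S \<Otimes>\<^sub>M ?S)" by (rule sets_eq_imp_space_eq[OF G(1)])
      have "fst \<in> G j \<rightarrow>\<^sub>M ?S" by measurable
      from emeasure_distr[OF this sets.top]
      have "emeasure (distr (G j) ?S fst) (space ?S) = emeasure (G j) (fst -` space ?S \<inter> space (G j))" .
      also have "fst -` space ?S \<inter> space (G j) = space (G j)" by (auto simp: sp space_pair_measure)
      also have "emeasure (G j) (space (G j)) = emeasure (G j) ?E"
      proof (rule emeasure_eq_AE)
        show "AE w in G j. w \<in> space (G j) \<longleftrightarrow> w \<in> ?E"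
          using G(4)[of j] AE_space
        proof eventually_elim
          case (elim w)
          then have "\<forall>k\<ge>n. fst w k = snd w k" using j order_trans by blast
          then show ?case using elim(2) unfolding sp by blast
        qed
        show "?E \<in> sets (G j)" using E by (simp only: G(1))
      qed simp
      finally show "emeasure (distr (G j) ?S fst) (space ?S) = emeasure (G j) ?E" .
    qed
    also have "\<dots> \<le> (\<Sum>j. emeasure (G j) ?E)" by (rule sum_le_suminf[OF summableI]) auto
    also have "\<dots> = emeasure H ?E" by (rule H[OF E, symmetric])
    also have "\<dots> \<le> emeasure \<Gamma> ?E" by (rule \<Gamma>(2)[OF E])
    finally show ?thesis .
  qed
  then show ?thesis using \<Gamma>(1) by blast
qed

section \<open>Equivalence of the conditions\<close>

context invariant_kernel
begin

lemma A2_imp_coupling: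
  assumes A2: "cond_A2 M K" and diag: "diagonal M \<in> sets (M \<Otimes>\<^sub>M M)" and x: "x \<in> space M" and y: "y \<in> space M"
  shows "\<exists>n\<ge>1. \<exists>\<zeta>\<in>couplings M (P n x) (P n y). 0 < emeasure \<zeta> (diagonal M)"
proof -
  obtain n where n: "1 \<le> n" "non_singular M (P n x) (P n y)" using A2 x y unfolding cond_A2_def by blast
  show ?thesis
    by (intro exI[of _ n] conjI n(1) coupling_of_non_singular P_prob x y n(2) diag)
qed

lemma A2_iff_C2:
  assumes diag: "diagonal M \<in> sets (M \<Otimes>\<^sub>M M)"
  shows "cond_A2 M K \<longleftrightarrow> cond_C2 M K"
proof
  assume "cond_A2 M K"
  then show "cond_C2 M K"
    unfolding cond_C2_def using A2_imp_coupling[OF _ diag] by meson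
next
  assume C2: "cond_C2 M K"
  show "cond_A2 M K"
    unfolding cond_A2_def
  proof (intro ballI)
    fix x y assume x: "x \<in> space M" and y: "y \<in> space M"
    obtain k \<zeta> where "\<zeta> \<in> couplings M (P k x) (P k y)" "0 < emeasure \<zeta> (diagonal M)"
      using C2 x y unfolding cond_C2_def by blast
    then have "non_singular M (P k x) (P k y)"
      using couplings_subset_ac_couplings[of M "P k x" "P k y"] P_prob[OF x] P_prob[OF y]
      by (intro ac_coupling_non_singular[of \<zeta>]) auto
    then have "tv_dist M (P k x) (P k y) < 1" by (simp add: non_singular_iff_tv_dist P_prob x y)
    \<comment> \<open>(C2) admits \<open>k = 0\<close> whereas (A2) asks for a positive time; one
      more step does not increase the distance.\<close>
    moreover have "tv_dist M (P (Suc k) x) (P (Suc k) y) \<le> tv_dist M (P k x) (P k y)"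
      using tv_dist_bind_le[OF P_prob[OF x] P_prob[OF y] kernel, of k k] by simp
    ultimately have "non_singular M (P (Suc k) x) (P (Suc k) y)"
      unfolding non_singular_iff_tv_dist[OF P_prob[OF x] P_prob[OF y]] by (rule order_le_less_trans[rotated])
    then show "\<exists>n\<ge>1. non_singular M (P n x) (P n y)" by (intro exI[of _ "Suc k"]) simp
  qed
qed

lemma A2_iff_G2:
  assumes diag: "diagonal M \<in> sets (M \<Otimes>\<^sub>M M)"
  shows "cond_A2 M K \<longleftrightarrow> cond_G2 M K"
proof
  assume A2: "cond_A2 M K"
  show "cond_G2 M K"
    unfolding cond_G2_def using A2_imp_coupling[OF A2 diag] couplings_subset_ac_couplings by (meson subsetD)
next
  assume "cond_G2 M K"
  then show "cond_A2 M K"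
    unfolding cond_A2_def cond_G2_def using ac_coupling_non_singular P_prob by meson
qed

text \<open>A positive lower limit yields a positive time from which the paths agree with positive
  probability, and the pair of states at that time is a coupling that charges the diagonal.\<close>

lemma C2'_imp_A2:
  assumes C2': "cond_C2' TYPE('w) M K \<mu>" and diag: "diagonal M \<in> sets (M \<Otimes>\<^sub>M M)"
  shows "cond_A2 M K"
  unfolding cond_A2_def
proof (intro ballI)
  fix x y assume x: "x \<in> space M" and y: "y \<in> space M"
  let ?S = "path_space M"
  obtain \<Omega> :: "'w measure" and X Y where c: "is_coupling \<Omega> ?S X Y (chain_law M K x) (chain_law M K y)"
    and pos: "0 < liminf (\<lambda>n. emeasure \<Omega> (agree_from \<Omega> X Y n))"
    using C2' x y unfolding cond_C2'_def by blast
  have X [measurable]: "X \<in> \<Omega> \<rightarrow>\<^sub>M ?S" and Y [measurable]: "Y \<in> \<Omega> \<rightarrow>\<^sub>M ?S" and \<Omega>: "prob_space \<Omega>"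
    and XY: "distr \<Omega> (?S \<Otimes>\<^sub>M ?S) (\<lambda>\<omega>. (X \<omega>, Y \<omega>)) \<in> couplings ?S (chain_law M K x) (chain_law M K y)"
    using c by (auto simp: is_coupling_def)
  have lawX: "distr \<Omega> ?S X = chain_law M K x"
  proof -
    have "distr (distr \<Omega> (?S \<Otimes>\<^sub>M ?S) (\<lambda>\<omega>. (X \<omega>, Y \<omega>))) ?S fst = chain_law M K x"
      using XY by (simp add: couplings_def)
    then show ?thesis by (subst (asm) distr_distr) (simp_all add: comp_def)
  qed
  have lawY: "distr \<Omega> ?S Y = chain_law M K y"
  proof -
    have "distr (distr \<Omega> (?S \<Otimes>\<^sub>M ?S) (\<lambda>\<omega>. (X \<omega>, Y \<omega>))) ?S snd = chain_law M K y"
      using XY by (simp add: couplings_def)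
    then show ?thesis by (subst (asm) distr_distr) (simp_all add: comp_def)
  qed
  have "\<forall>\<^sub>F n in sequentially. 0 < emeasure \<Omega> (agree_from \<Omega> X Y n)"
    using pos by (rule less_LiminfD)
  then have "\<forall>\<^sub>F n in sequentially. 1 \<le> n \<and> 0 < emeasure \<Omega> (agree_from \<Omega> X Y n)"
    using eventually_ge_at_top[of 1] by eventually_elim simp
  then obtain n where n: "1 \<le> n" "0 < emeasure \<Omega> (agree_from \<Omega> X Y n)"
    using eventually_happens'[OF sequentially_bot] by blast
  let ?f = "\<lambda>\<omega>. (X \<omega> n, Y \<omega> n)"
  have f: "?f \<in> \<Omega> \<rightarrow>\<^sub>M M \<Otimes>\<^sub>M M" by measurable
  let ?\<zeta> = "distr \<Omega> (M \<Otimes>\<^sub>M M) ?f"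
  have 1: "distr ?\<zeta> M fst = P n x"
    unfolding chain_law_marginal[OF x, symmetric] lawX[symmetric]
    by (subst distr_distr[OF _ f], simp, subst distr_distr) (simp_all add: comp_def)
  have 2: "distr ?\<zeta> M snd = P n y"
    unfolding chain_law_marginal[OF y, symmetric] lawY[symmetric]
    by (subst distr_distr[OF _ f], simp, subst distr_distr) (simp_all add: comp_def)
  have "prob_space ?\<zeta>" by (rule prob_space.prob_space_distr[OF \<Omega> f])
  with 1 2 have \<zeta>: "?\<zeta> \<in> couplings M (P n x) (P n y)" by (simp add: couplings_def)
  have "agree_from \<Omega> X Y n \<subseteq> ?f -` diagonal M \<inter> space \<Omega>"
  proof
    fix \<omega> assume "\<omega> \<in> agree_from \<Omega> X Y n"
    then have \<omega>: "\<omega> \<in> space \<Omega>" "X \<omega> n = Y \<omega> n" by (auto simp: agree_from_def)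
    have "X \<omega> n \<in> space M" using measurable_space[OF X \<omega>(1)] by (simp add: space_PiM PiE_iff)
    then show "\<omega> \<in> ?f -` diagonal M \<inter> space \<Omega>" using \<omega> by (auto simp: diagonal_def)
  qed
  then have "emeasure \<Omega> (agree_from \<Omega> X Y n) \<le> emeasure \<Omega> (?f -` diagonal M \<inter> space \<Omega>)"
    by (rule emeasure_mono[OF _ measurable_sets[OF f diag]])
  also have "\<dots> = emeasure ?\<zeta> (diagonal M)" by (rule emeasure_distr[OF f diag, symmetric])
  finally have "0 < emeasure ?\<zeta> (diagonal M)" using n(2) by (rule less_le_trans[rotated])
  then have "non_singular M (P n x) (P n y)"
    using \<zeta> couplings_subset_ac_couplings by (intro ac_coupling_non_singular[OF _ _ P_prob[OF x] P_prob[OF y]]) blast+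
  with n(1) show "\<exists>n\<ge>1. non_singular M (P n x) (P n y)" by blast
qed

text \<open>By the Markov property the future laws are images of \<open>P n x\<close> and
  \<open>P n y\<close> under one kernel, so their distance is at most that of the states. The sample
  space consists of pairs of paths with the projections as chains.\<close>

lemma chain_coupling:
  assumes bs: "borel_space M" and diag: "diagonal M \<in> sets (M \<Otimes>\<^sub>M M)" and x: "x \<in> space M" and y: "y \<in> space M"
  shows "\<exists>(\<Omega> :: ((nat \<Rightarrow> 'a) \<times> (nat \<Rightarrow> 'a)) measure) X Y.
    is_coupling \<Omega> (path_space M) X Y (chain_law M K x) (chain_law M K y) \<and>
    (\<forall>n. ennreal (1 - tv_dist M (P n x) (P n y)) \<le> emeasure \<Omega> (agree_from \<Omega> X Y n))"
proof -
  let ?S = "path_space M"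
  have "measure (distr (chain_law M K x) ?S (path_shift n)) A - measure (distr (chain_law M K y) ?S (path_shift n)) A
      \<le> tv_dist M (P n x) (P n y)" if A: "A \<in> sets ?S" for n A
  proof -
    note law_x = bind_in_prob_algebra[OF P_prob[OF x, of n] measurable_chain_law]
      and law_y = bind_in_prob_algebra[OF P_prob[OF y, of n] measurable_chain_law]
    have "measure (P n x \<bind> chain_law M K) A - measure (P n y \<bind> chain_law M K) A
        \<le> tv_dist ?S (P n x \<bind> chain_law M K) (P n y \<bind> chain_law M K)"
      using tv_dist_upper[OF law_x law_y A] by linarith
    also have "\<dots> \<le> tv_dist M (P n x) (P n y)"
      by (rule tv_dist_bind_le[OF P_prob[OF x] P_prob[OF y] measurable_chain_law])
    finally show ?thesis unfolding chain_law_shift[OF x] chain_law_shift[OF y] .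
  qed
  moreover have "space M \<noteq> {}" using x by blast
  ultimately obtain \<Gamma> where \<Gamma>: "\<Gamma> \<in> couplings ?S (chain_law M K x) (chain_law M K y)"
    and agree: "\<And>n. ennreal (1 - tv_dist M (P n x) (P n y))
      \<le> emeasure \<Gamma> {w \<in> space (?S \<Otimes>\<^sub>M ?S). \<forall>k\<ge>n. fst w k = snd w k}"
    using maximal_future_coupling[OF bs _ diag chain_law_prob[OF x] chain_law_prob[OF y],
        of "\<lambda>n. tv_dist M (P n x) (P n y)"] by blast
  have sets_\<Gamma> [measurable_cong]: "sets \<Gamma> = sets (?S \<Otimes>\<^sub>M ?S)" using \<Gamma> by (simp add: couplings_def)
  have sp: "space \<Gamma> = space (?S \<Otimes>\<^sub>M ?S)" by (rule sets_eq_imp_space_eq[OF sets_\<Gamma>])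
  have "distr \<Gamma> (?S \<Otimes>\<^sub>M ?S) (\<lambda>\<omega>. (fst \<omega>, snd \<omega>)) = \<Gamma>"
    using distr_id2[of "?S \<Otimes>\<^sub>M ?S" \<Gamma>] sets_\<Gamma> by simp
  moreover have "fst \<in> \<Gamma> \<rightarrow>\<^sub>M ?S" "snd \<in> \<Gamma> \<rightarrow>\<^sub>M ?S" by measurable
  ultimately have "is_coupling \<Gamma> ?S fst snd (chain_law M K x) (chain_law M K y)"
    using \<Gamma> by (simp add: is_coupling_def couplings_def)
  moreover have "\<forall>n. ennreal (1 - tv_dist M (P n x) (P n y)) \<le> emeasure \<Gamma> (agree_from \<Gamma> fst snd n)"
    using agree unfolding agree_from_def sp by blast
  ultimately show ?thesis by blast
qed

text \<open>The agreement probabilities are bounded below by a sequence tending to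
  \<open>1 - h x y\<close>, which under (A2) is positive for all pairs and equal to one for almost
  all.\<close>

lemma A2_imp_C2':
  assumes bs: "borel_space M" and diag: "diagonal M \<in> sets (M \<Otimes>\<^sub>M M)" and A2: "cond_A2 M K"
  shows "cond_C2' TYPE((nat \<Rightarrow> 'a) \<times> (nat \<Rightarrow> 'a)) M K \<mu>"
  unfolding cond_C2'_def
proof (intro conjI ballI)
  have lim: "(\<lambda>n. ennreal (1 - tv_dist M (P n x) (P n y))) \<longlonglongrightarrow> ennreal (1 - h x y)"
    if x: "x \<in> space M" and y: "y \<in> space M" for x y
    by (intro tendsto_ennrealI tendsto_diff tendsto_const h_lim[OF x y])
  show "\<exists>(\<Omega> :: ((nat \<Rightarrow> 'a) \<times> (nat \<Rightarrow> 'a)) measure) X Y.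
      is_coupling \<Omega> (path_space M) X Y (chain_law M K x) (chain_law M K y) \<and>
      0 < liminf (\<lambda>n. emeasure \<Omega> (agree_from \<Omega> X Y n))"
    if x: "x \<in> space M" and y: "y \<in> space M" for x y
  proof -
    obtain \<Omega> :: "((nat \<Rightarrow> 'a) \<times> (nat \<Rightarrow> 'a)) measure" and X Y
      where c: "is_coupling \<Omega> (path_space M) X Y (chain_law M K x) (chain_law M K y)"
        and le: "\<And>n. ennreal (1 - tv_dist M (P n x) (P n y)) \<le> emeasure \<Omega> (agree_from \<Omega> X Y n)"
      using chain_coupling[OF bs diag x y] by blast
    have "0 < ennreal (1 - h x y)" using A2_h_less_1[OF A2 x y] by simp
    also have "\<dots> = liminf (\<lambda>n. ennreal (1 - tv_dist M (P n x) (P n y)))"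
      by (rule lim_imp_Liminf[OF _ lim[OF x y], symmetric]) simp
    also have "\<dots> \<le> liminf (\<lambda>n. emeasure \<Omega> (agree_from \<Omega> X Y n))"
      by (rule Liminf_mono) (use le in simp)
    finally show ?thesis using c by blast
  qed
  have "AE z in \<mu> \<Otimes>\<^sub>M \<mu>. \<exists>(\<Omega> :: ((nat \<Rightarrow> 'a) \<times> (nat \<Rightarrow> 'a)) measure) X Y.
      is_coupling \<Omega> (path_space M) X Y (chain_law M K (fst z)) (chain_law M K (snd z)) \<and>
      (\<lambda>n. emeasure \<Omega> (agree_from \<Omega> X Y n)) \<longlonglongrightarrow> 1"
    using A2_h_eq_0[OF A2] AE_space
  proof eventually_elim
    case (elim z)
    then have x: "fst z \<in> space M" and y: "snd z \<in> space M" by (auto simp: space_pair_measure)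
    obtain \<Omega> :: "((nat \<Rightarrow> 'a) \<times> (nat \<Rightarrow> 'a)) measure" and X Y
      where c: "is_coupling \<Omega> (path_space M) X Y (chain_law M K (fst z)) (chain_law M K (snd z))"
        and le: "\<And>n. ennreal (1 - tv_dist M (P n (fst z)) (P n (snd z))) \<le> emeasure \<Omega> (agree_from \<Omega> X Y n)"
      using chain_coupling[OF bs diag x y] by blast
    interpret prob_space \<Omega> using c by (simp add: is_coupling_def)
    have "(\<lambda>n. emeasure \<Omega> (agree_from \<Omega> X Y n)) \<longlonglongrightarrow> 1"
    proof (rule tendsto_sandwich)
      show "(\<lambda>n. ennreal (1 - tv_dist M (P n (fst z)) (P n (snd z)))) \<longlonglongrightarrow> 1"
        using lim[OF x y] elim(1) by simp
      show "\<forall>\<^sub>F n in sequentially. emeasure \<Omega> (agree_from \<Omega> X Y n) \<le> 1"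
        by (intro always_eventually allI measure_le_1)
    qed (use le in simp_all)
    then show ?case using c by blast
  qed
  then show "AE (x, y) in \<mu> \<Otimes>\<^sub>M \<mu>. \<exists>(\<Omega> :: ((nat \<Rightarrow> 'a) \<times> (nat \<Rightarrow> 'a)) measure) X Y.
      is_coupling \<Omega> (path_space M) X Y (chain_law M K x) (chain_law M K y) \<and>
      (\<lambda>n. emeasure \<Omega> (agree_from \<Omega> X Y n)) \<longlonglongrightarrow> 1"
    by (simp add: split_beta')
qed

end

theorem theorem2p17:
  fixes M :: "'a measure" and K :: "'a \<Rightarrow> 'a measure" and \<mu> :: "'a measure"
  assumes "countably_generated M"
    and "diagonal M \<in> sets (M \<Otimes>\<^sub>M M)"
    and "K \<in> M \<rightarrow>\<^sub>M prob_algebra M"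
    and "invariant_prob M K \<mu>"
  shows "(cond_A2 M K \<longleftrightarrow> cond_B2 M K \<mu>) \<and>
         (cond_A2 M K \<longleftrightarrow> cond_C2 M K) \<and>
         (cond_A2 M K \<longleftrightarrow> cond_G2 M K) \<and>
         (cond_A2 M K \<longleftrightarrow> cond_P2 M K \<mu>) \<and>
         (cond_C2' TYPE('w) M K \<mu> \<longrightarrow> cond_A2 M K) \<and>
         (borel_space M \<and> cond_A2 M K \<longrightarrow>
            cond_C2' TYPE((nat \<Rightarrow> 'a) \<times> (nat \<Rightarrow> 'a)) M K \<mu>)"
proof -
  interpret invariant_kernel M K \<mu>
    by unfold_locales (fact assms)+
  note diag = assms(2)
  show ?thesis
  proof (intro conjI impI)
    show "cond_A2 M K \<longleftrightarrow> cond_B2 M K \<mu>" by (rule A2_iff_B2)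
    show "cond_A2 M K \<longleftrightarrow> cond_C2 M K" by (rule A2_iff_C2[OF diag])
    show "cond_A2 M K \<longleftrightarrow> cond_G2 M K" by (rule A2_iff_G2[OF diag])
    show "cond_A2 M K \<longleftrightarrow> cond_P2 M K \<mu>" using A2_imp_P2 P2_imp_A2 by (rule iffI)
    show "cond_A2 M K" if "cond_C2' TYPE('w) M K \<mu>" by (rule C2'_imp_A2[OF that diag])
    show "cond_C2' TYPE((nat \<Rightarrow> 'a) \<times> (nat \<Rightarrow> 'a)) M K \<mu>" if "borel_space M \<and> cond_A2 M K"
      using that by (intro A2_imp_C2'[OF _ diag]) simp_all
  qed
qed

end
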